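(* The Gray presentation $\mathsf{PMon}$ of pseudomonoids is a coherent Gray presentation, i.e. any two parallel $3$-cells of the localization $\overline{\mathsf{PMon}}^\top$ are equal.
   Context: **Precategories.** An $n$-precategory is an $n$-globular set $C$ (sets $C_0,\dots,C_n$ with source/target maps $\partial^-_i,\partial^+_i:C_{i+1}\to C_i$ satisfying the globular identities; $\partial^\epsilon_i$ also denotes iterated source/target) with identities $\mathrm{id}:C_{k-1}\to C_k$ and compositions $u\ast_i v\in C_{\max(k,l)}$ for $u\in C_k$, $v\in C_l$, $k,l>0$, $i=\min(k,l)-1$, $\partial^+_i(u)=\partial^-_i(v)$ ("$i$-composable"), such that: $\partial^\pm(\mathrm{id}_u)=u$; $\partial^\epsilon(u\ast_i v)$ is $u\ast_i\partial^\epsilon v$ if $k<l$, $\partial^\epsilon u\ast_i v$ if $k>l$, and $\partial^-u$ (resp. $\partial^+v$) for $\epsilon=-$ (resp. $+$) if $k=l$; composing with an identity on a cell of dimension $i$ via $\ast_i$ is trivial, and $\mathrm{id}_u\ast_i v=\mathrm{id}_{u\ast_i v}$, $v\ast_i\mathrm{id}_u=\mathrm{id}_{v\ast_i u}$ when $\dim u>i$ and $\dim v=i+1$; each $\ast_i$ is associative whenever both sides are defined; for $i<j$ and $u$ of dimension $i+1$, $u\ast_i(v\ast_j v')=(u\ast_i v)\ast_j(u\ast_i v')$ and $(v\ast_j v')\ast_i u=(v\ast_i u)\ast_j(v'\ast_i u)$ whenever the left sides are defined. Morphisms preserve all the structure. **Prepolygraphs.** A $0$-prepolygraph is a set $\mathsf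 P_0$, with $\mathsf P^*_0=\mathsf P_0$. An $(n+1)$-prepolygraph is an $n$-prepolygraph $(\mathsf P_0,\dots,\mathsf P_n)$, generating a free $n$-precategory with $i$-cells $\mathsf P^*_i$, together with a set $\mathsf P_{n+1}$ of $(n+1)$-generators with source and target in $\mathsf P^*_n$ (parallel if $n\ge1$); its free $(n+1)$-precategory $\mathsf P^*$ is obtained by freely adjoining the elements of $\mathsf P_{n+1}$ as $(n+1)$-cells. $\mathsf P_{\le k}$ is the underlying $k$-prepolygraph. Every $2$-cell of $\mathsf P^*$ is uniquely a $\ast_1$-composite of whiskers $l\ast_0\alpha\ast_0 r$ with $\alpha\in\mathsf P_2$, $l,r\in\mathsf P^*_1$. **Presented precategory, localization, coherence.** A congruence on an $n$-precategory $C$ is an equivalence relation on $C_n$ relating only cells with the same source and target and stable under $u\mapsto v\ast_i u\ast_i w$ for all $i<n$ and $v,w\in C_{i+1}$. For a $4$-prepolygraph $\mathsf P$, $\overline{\mathsf P}=(\mathsf P_{\le 3})^*/{\sim^{\mathsf P}}$ where $\sim^{\mathsf P}$ is the smallest congruence with $\partial^-(G)\sim^{\mathsf P}\partial^+(G)$ for all $G\in\mathsf P_4$. The localization $C^\top$ of a $3$-precategory $C$ is obtained by formally inverting all $3$-cells with respect to $\ast_2$ (image of $C$ under the left adjoint to the inclusion of $3$-precategories with all $3$-cells invertible); it has the same cells as $C$ in dimensions $\le2$. A Gray presentation $\mathsf P$ is coherent when any two parallel $3$-cells of $\overline{\mathsf P}^\top$ are equal. **Gray presentation.** A $4$-prepolygraph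 $\mathsf P$ containing the following distinguished generators. (a) For $\alpha:f\Rightarrow f'$, $\beta:h\Rightarrow h'$ in $\mathsf P_2$ and $g\in\mathsf P^*_1$ with $\alpha,g,\beta$ $0$-composable, a $3$-generator (interchange generator) $X_{\alpha,g,\beta}:(\alpha\ast_0 g\ast_0 h)\ast_1(f'\ast_0 g\ast_0\beta)\Rrightarrow(f\ast_0 g\ast_0\beta)\ast_1(\alpha\ast_0 g\ast_0 h')$. (b) For $A:\phi\Rrightarrow\phi'$, $B:\psi\Rrightarrow\psi'$ in $\mathsf P_3$, $e,h,e',h'\in\mathsf P^*_1$, $\chi\in\mathsf P^*_2$ such that $(e\ast_0\phi\ast_0 h)\ast_1\chi\ast_1(e'\ast_0\psi\ast_0 h')$ is defined, a $4$-generator (independence generator) from $((e\ast_0 A\ast_0 h)\ast_1\chi\ast_1(e'\ast_0\psi\ast_0 h'))\ast_2((e\ast_0\phi'\ast_0 h)\ast_1\chi\ast_1(e'\ast_0 B\ast_0 h'))$ to $((e\ast_0\phi\ast_0 h)\ast_1\chi\ast_1(e'\ast_0 B\ast_0 h'))\ast_2((e\ast_0 A\ast_0 h)\ast_1\chi\ast_1(e'\ast_0\psi'\ast_0 h'))$. (c) For $0$-composable $A,g,\beta$ with $A:\phi\Rrightarrow\phi':f\Rightarrow f'$ in $\mathsf P_3$, $g\in\mathsf P^*_1$, $\beta:h\Rightarrow h'$ in $\mathsf P_2$, a $4$-generator (interchange naturality generator) from $((A\ast_0 g\ast_0 h)\ast_1(f'\ast_0 g\ast_0\beta))\ast_2 X_{\phi',g\ast_0\beta}$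 to $X_{\phi,g\ast_0\beta}\ast_2((f\ast_0 g\ast_0\beta)\ast_1(A\ast_0 g\ast_0 h'))$; and for $0$-composable $\alpha,g,B$ with $\alpha:f\Rightarrow f'$ in $\mathsf P_2$, $B:\psi\Rrightarrow\psi':h\Rightarrow h'$ in $\mathsf P_3$, a $4$-generator from $((\alpha\ast_0 g\ast_0 h)\ast_1(f'\ast_0 g\ast_0 B))\ast_2 X_{\alpha\ast_0 g,\psi'}$ to $X_{\alpha\ast_0 g,\psi}\ast_2((f\ast_0 g\ast_0 B)\ast_1(\alpha\ast_0 g\ast_0 h'))$. Here, for $0$-composable $\phi,\psi\in\mathsf P^*_2$ with whisker decompositions $\phi=\phi_1\ast_1\cdots\ast_1\phi_k$, $\psi=\psi_1\ast_1\cdots\ast_1\psi_{k'}$, $\phi_i=f_i\ast_0\alpha_i\ast_0 g_i$, $\psi_j=f'_j\ast_0\beta_j\ast_0 g'_j$, the $3$-cell $X_{\phi,\psi}:(\phi\ast_0\partial^-_1\psi)\ast_1(\partial^+_1\phi\ast_0\psi)\Rrightarrow(\partial^-_1\phi\ast_0\psi)\ast_1(\phi\ast_0\partial^+_1\psi)$ is the $\ast_2$-composite of $kk'$ elementary swaps, which first move $\phi_k$ successively past $\psi_1,\dots,\psi_{k'}$, then $\phi_{k-1}$ past $\psi_1,\dots,\psi_{k'}$, and so on; the elementary swap of consecutive $\phi_i,\psi_j$ in an interleaving is $\lambda\ast_1(f_i\ast_0 X_{\alpha_i,\,g_i\ast_0 f'_j,\,\beta_j}\ast_0 g'_j)\ast_1\rho$,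 where $\lambda,\rho$ are the parts of the interleaving before and after. **The Gray presentation $\mathsf{PMon}$.** One $0$-generator $x$, one $1$-generator $a:x\to x$; write $\bar n=a\ast_0\cdots\ast_0a$ ($n$ factors). $2$-generators $\mu:\bar2\Rightarrow\bar1$, $\eta:\bar0\Rightarrow\bar1$. $3$-generators: $\mathsf A:(\mu\ast_0\bar1)\ast_1\mu\Rrightarrow(\bar1\ast_0\mu)\ast_1\mu$, $\mathsf L:(\eta\ast_0\bar1)\ast_1\mu\Rrightarrow\mathrm{id}_{\bar1}$, $\mathsf R:(\bar1\ast_0\eta)\ast_1\mu\Rrightarrow\mathrm{id}_{\bar1}$, and the interchange generators $X_{\alpha,\bar n,\beta}$ for $\alpha,\beta\in\{\mu,\eta\}$, $n\in\mathbb N$. $4$-generators: exactly the independence and interchange naturality generators required in (b), (c), and five more, one between the two parallel $3$-cells in each of the following pairs (the orientation of a $4$-generator is irrelevant for $\overline{\mathsf{PMon}}$): 1. $((\mathsf A\ast_0\bar1)\ast_1\mu)\ast_2((\bar1\ast_0\mu\ast_0\bar1)\ast_1\mathsf A)\ast_2((\bar1\ast_0\mathsf A)\ast_1\mu)$ and $((\mu\ast_0\bar2)\ast_1\mathsf A)\ast_2(X_{\mu,\bar0,\mu}\ast_1\mu)\ast_2((\bar2\ast_0\mu)\ast_1\mathsf A)$; 2. $(\mathsf L\ast_0\bar1)\ast_1\mu$ and $((\eta\ast_0\bar2)\ast_1\mathsf A)\ast_2(X_{\eta,\bar0,\mu}\ast_1\mu)\ast_2(\mu\ast_1\mathsf L)$;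 3. $\mu\ast_1\mathsf R$ and $(X_{\mu,\bar0,\eta}\ast_1\mu)\ast_2((\bar2\ast_0\eta)\ast_1\mathsf A)\ast_2((\bar1\ast_0\mathsf R)\ast_1\mu)$; 4. $(\mathsf R\ast_0\bar1)\ast_1\mu$ and $((\bar1\ast_0\eta\ast_0\bar1)\ast_1\mathsf A)\ast_2((\bar1\ast_0\mathsf L)\ast_1\mu)$; 5. $\eta\ast_1\mathsf R$ and $(X_{\eta,\bar0,\eta}\ast_1\mu)\ast_2(\eta\ast_1\mathsf L)$. *)

theory Defs
  imports Main
begin

section \<open>Precategories\<close>

datatype sign = Neg | Pos

text \<open>
  \<open>bdry C e i\<close> is the map from (i+1)-cells to i-cells (source for \<open>Neg\<close>, target for \<open>Pos\<close>),
  \<open>idt C k\<close> maps k-cells to (k+1)-cells, and \<open>comp C k l u v\<close> composes a k-cell with an l-cell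
  along their common boundary of dimension \<open>min k l - 1\<close>. All data are indexed by dimension,
  so the sets \<open>cells C k\<close> need not be disjoint.
\<close>

record 'c precat =
  cells :: "nat \<Rightarrow> 'c set"
  bdry :: "sign \<Rightarrow> nat \<Rightarrow> 'c \<Rightarrow> 'c"
  idt :: "nat \<Rightarrow> 'c \<Rightarrow> 'c"
  comp :: "nat \<Rightarrow> nat \<Rightarrow> 'c \<Rightarrow> 'c \<Rightarrow> 'c"

text \<open>\<open>ibdry C e i k u\<close> is the iterated i-dimensional boundary of a k-cell.\<close>

fun ibdry :: "('c, 'z) precat_scheme \<Rightarrow> sign \<Rightarrow> nat \<Rightarrow> nat \<Rightarrow> 'c \<Rightarrow> 'c" where
  "ibdry C e i 0 u = u"
| "ibdry C e i (Suc k) u = (if i \<le> k then ibdry C e i k (bdry C e k u) else u)"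

definition composable ::
  "nat \<Rightarrow> ('c, 'z) precat_scheme \<Rightarrow> nat \<Rightarrow> nat \<Rightarrow> 'c \<Rightarrow> 'c \<Rightarrow> bool" where
  "composable n C k l u v \<longleftrightarrow>
     k \<in> {1..n} \<and> l \<in> {1..n} \<and> u \<in> cells C k \<and> v \<in> cells C l \<and>
     ibdry C Pos (min k l - 1) k u = ibdry C Neg (min k l - 1) l v"

text \<open>
  In the associativity law, the side condition on \<open>k\<close>, \<open>l\<close>, \<open>m\<close> says that all four compositions
  are along a boundary of the same dimension.
\<close>

definition precategory :: "nat \<Rightarrow> ('c, 'z) precat_scheme \<Rightarrow> bool" where
  "precategory n C \<longleftrightarrow>
     (\<forall>e i u. i < n \<longrightarrow> u \<in> cells C (i + 1) \<longrightarrow> bdry C e i u \<in> cells C i) \<and>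
     (\<forall>e i u. i + 1 < n \<longrightarrow> u \<in> cells C (i + 2) \<longrightarrow>
        bdry C e i (bdry C Neg (i + 1) u) = bdry C e i (bdry C Pos (i + 1) u)) \<and>
     (\<forall>k u. k < n \<longrightarrow> u \<in> cells C k \<longrightarrow> idt C k u \<in> cells C (k + 1)) \<and>
     (\<forall>k l u v. composable n C k l u v \<longrightarrow> comp C k l u v \<in> cells C (max k l)) \<and>
     (\<forall>e k u. k < n \<longrightarrow> u \<in> cells C k \<longrightarrow> bdry C e k (idt C k u) = u) \<and>
     (\<forall>e k l u v. composable n C k l u v \<longrightarrow>
        bdry C e (max k l - 1) (comp C k l u v) =
          (if k < l then comp C k (l - 1) u (bdry C e (l - 1) v)
           else if k > l then comp C (k - 1) l (bdry C e (k - 1) u) v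
           else if e = Neg then bdry C Neg (k - 1) u
           else bdry C Pos (k - 1) v)) \<and>
     (\<forall>i k u. i < k \<longrightarrow> k \<le> n \<longrightarrow> u \<in> cells C k \<longrightarrow>
        comp C (i + 1) k (idt C i (ibdry C Neg i k u)) u = u \<and>
        comp C k (i + 1) u (idt C i (ibdry C Pos i k u)) = u) \<and>
     (\<forall>i k u v. i < k \<longrightarrow> k < n \<longrightarrow> composable n C k (i + 1) u v \<longrightarrow>
        comp C (k + 1) (i + 1) (idt C k u) v = idt C k (comp C k (i + 1) u v)) \<and>
     (\<forall>i k u v. i < k \<longrightarrow> k < n \<longrightarrow> composable n C (i + 1) k v u \<longrightarrow>
        comp C (i + 1) (k + 1) v (idt C k u) = idt C k (comp C (i + 1) k v u)) \<and>
     (\<forall>k l m u v w.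
        min k l = min l m \<and> min (max k l) m = min k l \<and> min k (max l m) = min k l \<longrightarrow>
        composable n C k l u v \<and> composable n C (max k l) m (comp C k l u v) w \<longrightarrow>
        composable n C l m v w \<and> composable n C k (max l m) u (comp C l m v w) \<longrightarrow>
        comp C (max k l) m (comp C k l u v) w = comp C k (max l m) u (comp C l m v w)) \<and>
     (\<forall>i k l u v w. i + 1 < min k l \<longrightarrow> composable n C k l v w \<longrightarrow>
        composable n C (i + 1) (max k l) u (comp C k l v w) \<longrightarrow>
        comp C (i + 1) (max k l) u (comp C k l v w) =
          comp C k l (comp C (i + 1) k u v) (comp C (i + 1) l u w)) \<and>
     (\<forall>i k l u v w. i + 1 < min k l \<longrightarrow> composable n C k l v w \<longrightarrow>
        composable n C (max k l) (i + 1) (comp C k l v w) u \<longrightarrow>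
        comp C (max k l) (i + 1) (comp C k l v w) u =
          comp C k l (comp C k (i + 1) v u) (comp C l (i + 1) w u))"

definition parallel :: "('c, 'z) precat_scheme \<Rightarrow> nat \<Rightarrow> 'c \<Rightarrow> 'c \<Rightarrow> bool" where
  "parallel C k u v \<longleftrightarrow> (\<forall>e. bdry C e (k - 1) u = bdry C e (k - 1) v)"

definition precat_morphism ::
  "nat \<Rightarrow> ('c, 'y) precat_scheme \<Rightarrow> ('d, 'z) precat_scheme \<Rightarrow> (nat \<Rightarrow> 'c \<Rightarrow> 'd) \<Rightarrow> bool" where
  "precat_morphism n C D F \<longleftrightarrow>
     (\<forall>k u. k \<le> n \<longrightarrow> u \<in> cells C k \<longrightarrow> F k u \<in> cells D k) \<and>
     (\<forall>e k u. k < n \<longrightarrow> u \<in> cells C (k + 1) \<longrightarrow>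
        F k (bdry C e k u) = bdry D e k (F (k + 1) u)) \<and>
     (\<forall>k u. k < n \<longrightarrow> u \<in> cells C k \<longrightarrow> F (k + 1) (idt C k u) = idt D k (F k u)) \<and>
     (\<forall>k l u v. composable n C k l u v \<longrightarrow>
        F (max k l) (comp C k l u v) = comp D k l (F k u) (F l v))"


subsection \<open>Congruences and quotients\<close>

definition congruence :: "nat \<Rightarrow> ('c, 'z) precat_scheme \<Rightarrow> 'c rel \<Rightarrow> bool" where
  "congruence n C R \<longleftrightarrow>
     equiv (cells C n) R \<and>
     (\<forall>(u, u') \<in> R. parallel C n u u') \<and>
     (\<forall>(u, u') \<in> R. \<forall>i < n. \<forall>v \<in> cells C (i + 1). \<forall>w \<in> cells C (i + 1).
        composable n C (i + 1) n v u \<longrightarrow> composable n C n (i + 1) (comp C (i + 1) n v u) w \<longrightarrow>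
        (comp C n (i + 1) (comp C (i + 1) n v u) w,
         comp C n (i + 1) (comp C (i + 1) n v u') w) \<in> R)"

definition generated_congruence ::
  "nat \<Rightarrow> ('c, 'z) precat_scheme \<Rightarrow> 'c rel \<Rightarrow> 'c rel" where
  "generated_congruence n C S = \<Inter> {R. congruence n C R \<and> S \<subseteq> R}"

text \<open>
  The cells of the quotient are equivalence classes in dimension \<open>n\<close> and singletons below; the
  operations are computed on representatives.
\<close>

definition quotient_class :: "nat \<Rightarrow> 'c rel \<Rightarrow> nat \<Rightarrow> 'c \<Rightarrow> 'c set" where
  "quotient_class n R k u = (if k = n then R `` {u} else {u})"

definition representative :: "'c set \<Rightarrow> 'c" where
  "representative U = (SOME u. u \<in> U)"

definition quotient_precat ::
  "nat \<Rightarrow> ('c, 'z) precat_scheme \<Rightarrow> 'c rel \<Rightarrow> 'c set precat" where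
  "quotient_precat n C R = \<lparr>
     cells = (\<lambda>k. quotient_class n R k ` cells C k),
     bdry = (\<lambda>e i U. quotient_class n R i (bdry C e i (representative U))),
     idt = (\<lambda>k U. quotient_class n R (k + 1) (idt C k (representative U))),
     comp = (\<lambda>k l U V.
       quotient_class n R (max k l) (comp C k l (representative U) (representative V))) \<rparr>"


subsection \<open>Localization\<close>

text \<open>
  Formally inverting the n-cells of an n-precategory (\<open>n \<ge> 1\<close>) with respect to the composition
  along (n-1)-cells. A zigzag \<open>Zig \<phi> [(s\<^sub>1, u\<^sub>1), \<dots>]\<close> is a formal composite, starting at the
  (n-1)-cell \<open>\<phi>\<close>, of n-cells (\<open>Pos\<close>) and formal inverses of n-cells (\<open>Neg\<close>). Since
  \<open>v * u\<^sup>-\<^sup>1 = (v * u)\<^sup>-\<^sup>1\<close> holds for whiskerings as soon as n-cells are invertible, lower cells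
  act on zigzags factor by factor. The localization is the quotient by the smallest
  congruence that makes \<open>u \<mapsto> [u]\<close> functorial and \<open>(Neg, u)\<close> inverse to \<open>(Pos, u)\<close>.
\<close>

datatype 'c zcell = Low 'c | Zig 'c "(sign \<times> 'c) list"

fun zbdry :: "nat \<Rightarrow> ('c, 'z) precat_scheme \<Rightarrow> sign \<Rightarrow> sign \<times> 'c \<Rightarrow> 'c" where
  "zbdry n C e (Pos, u) = bdry C e (n - 1) u"
| "zbdry n C e (Neg, u) = bdry C (if e = Neg then Pos else Neg) (n - 1) u"

fun zchain :: "nat \<Rightarrow> ('c, 'z) precat_scheme \<Rightarrow> 'c \<Rightarrow> (sign \<times> 'c) list \<Rightarrow> bool" where
  "zchain n C \<phi> [] \<longleftrightarrow> True"
| "zchain n C \<phi> (z # zs) \<longleftrightarrow>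
     snd z \<in> cells C n \<and> zbdry n C Neg z = \<phi> \<and> zchain n C (zbdry n C Pos z) zs"

fun zsource :: "'c zcell \<Rightarrow> 'c" where
  "zsource (Zig \<phi> zs) = \<phi>"
| "zsource (Low u) = u"

fun ztarget :: "nat \<Rightarrow> ('c, 'z) precat_scheme \<Rightarrow> 'c zcell \<Rightarrow> 'c" where
  "ztarget n C (Zig \<phi> zs) = (if zs = [] then \<phi> else zbdry n C Pos (last zs))"
| "ztarget n C (Low u) = u"

fun zcomp :: "nat \<Rightarrow> ('c, 'z) precat_scheme \<Rightarrow> nat \<Rightarrow> nat \<Rightarrow> 'c zcell \<Rightarrow> 'c zcell \<Rightarrow> 'c zcell" where
  "zcomp n C k l (Low u) (Low v) = Low (comp C k l u v)"
| "zcomp n C k l (Low u) (Zig \<psi> zs) =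
     Zig (comp C k (n - 1) u \<psi>) (map (\<lambda>(s, v). (s, comp C k n u v)) zs)"
| "zcomp n C k l (Zig \<phi> zs) (Low v) =
     Zig (comp C (n - 1) l \<phi> v) (map (\<lambda>(s, u). (s, comp C n l u v)) zs)"
| "zcomp n C k l (Zig \<phi> zs) (Zig \<psi> zs') = Zig \<phi> (zs @ zs')"

definition zigzag_precat :: "nat \<Rightarrow> ('c, 'z) precat_scheme \<Rightarrow> 'c zcell precat" where
  "zigzag_precat n C = \<lparr>
     cells = (\<lambda>k. if k < n then Low ` cells C k
                  else if k = n then {Zig \<phi> zs | \<phi> zs. \<phi> \<in> cells C (n - 1) \<and> zchain n C \<phi> zs}
                  else {}),
     bdry = (\<lambda>e i x. case x of
               Low u \<Rightarrow> Low (bdry C e i u)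
             | Zig \<phi> zs \<Rightarrow> Low (if e = Neg then zsource x else ztarget n C x)),
     idt = (\<lambda>k x. case x of
               Low u \<Rightarrow> if k + 1 = n then Zig u [] else Low (idt C k u)
             | Zig \<phi> zs \<Rightarrow> x),
     comp = zcomp n C \<rparr>"

definition localization_relations ::
  "nat \<Rightarrow> ('c, 'z) precat_scheme \<Rightarrow> 'c zcell rel" where
  "localization_relations n C =
     {(Zig (bdry C Neg (n - 1) u) [(Pos, u), (Pos, v)],
       Zig (bdry C Neg (n - 1) u) [(Pos, comp C n n u v)]) | u v. composable n C n n u v} \<union>
     {(Zig \<phi> [(Pos, idt C (n - 1) \<phi>)], Zig \<phi> []) | \<phi>. \<phi> \<in> cells C (n - 1)} \<union>
     {(Zig (bdry C Neg (n - 1) u) [(Pos, u), (Neg, u)], Zig (bdry C Neg (n - 1) u) [])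
       | u. u \<in> cells C n} \<union>
     {(Zig (bdry C Pos (n - 1) u) [(Neg, u), (Pos, u)], Zig (bdry C Pos (n - 1) u) [])
       | u. u \<in> cells C n}"

definition localization :: "nat \<Rightarrow> ('c, 'z) precat_scheme \<Rightarrow> 'c zcell set precat" where
  "localization n C =
     quotient_precat n (zigzag_precat n C)
       (generated_congruence n (zigzag_precat n C) (localization_relations n C))"


section \<open>Prepolygraphs\<close>

text \<open>
  Free precategories are built from normal forms. A 1-cell is a path of 1-generators together
  with its source. A 2-cell is a list of whiskers \<open>l *\<^sub>0 \<alpha> *\<^sub>0 r\<close>, and a 3-cell a list of whiskers
  \<open>\<kappa> *\<^sub>1 (l *\<^sub>0 A *\<^sub>0 r) *\<^sub>1 \<rho>\<close>, again together with the source. That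
  these are indeed the freely generated precategories is proved below
  (\<open>precategory_free\<close>, \<open>free_extension1\<close>, \<open>free_extension2\<close>, \<open>free_extension3\<close>).
\<close>

datatype ('o, 'a) cell1 = Cell1 (dom1: 'o) (steps1: "'a list")

datatype ('o, 'a, 'b) wh2 = Wh2 "('o, 'a) cell1" 'b "('o, 'a) cell1"

datatype ('o, 'a, 'b) cell2 = Cell2 (dom2: "('o, 'a) cell1") (steps2: "('o, 'a, 'b) wh2 list")

datatype ('o, 'a, 'b, 'c) wh3 =
  Wh3 "('o, 'a, 'b) cell2" "('o, 'a) cell1" 'c "('o, 'a) cell1" "('o, 'a, 'b) cell2"

datatype ('o, 'a, 'b, 'c) cell3 =
  Cell3 (dom3: "('o, 'a, 'b) cell2") (steps3: "('o, 'a, 'b, 'c) wh3 list")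

record ('o, 'a, 'b) prepoly2 =
  gen0 :: "'o set"
  gen1 :: "'a set"
  src1 :: "'a \<Rightarrow> 'o"
  tgt1 :: "'a \<Rightarrow> 'o"
  gen2 :: "'b set"
  src2 :: "'b \<Rightarrow> ('o, 'a) cell1"
  tgt2 :: "'b \<Rightarrow> ('o, 'a) cell1"

record ('o, 'a, 'b, 'c) prepoly3 = "('o, 'a, 'b) prepoly2" +
  gen3 :: "'c set"
  src3 :: "'c \<Rightarrow> ('o, 'a, 'b) cell2"
  tgt3 :: "'c \<Rightarrow> ('o, 'a, 'b) cell2"

record ('o, 'a, 'b, 'c, 'd) prepoly4 = "('o, 'a, 'b, 'c) prepoly3" +
  gen4 :: "'d set"
  src4 :: "'d \<Rightarrow> ('o, 'a, 'b, 'c) cell3"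
  tgt4 :: "'d \<Rightarrow> ('o, 'a, 'b, 'c) cell3"


subsection \<open>Identities and compositions\<close>

text \<open>
  The composition of a k-cell with an l-cell is written with the two dimensions \<open>k\<close>, \<open>l\<close> as
  subscripts; it is the composition along \<open>min k l - 1\<close>. The priorities make lower-dimensional
  boundaries bind tighter.
\<close>

definition id1 :: "'o \<Rightarrow> ('o, 'a) cell1" where
  "id1 x = Cell1 x []"

definition id2 :: "('o, 'a) cell1 \<Rightarrow> ('o, 'a, 'b) cell2" where
  "id2 f = Cell2 f []"

definition id3 :: "('o, 'a, 'b) cell2 \<Rightarrow> ('o, 'a, 'b, 'c) cell3" where
  "id3 \<phi> = Cell3 \<phi> []"

definition comp11 :: "('o, 'a) cell1 \<Rightarrow> ('o, 'a) cell1 \<Rightarrow> ('o, 'a) cell1"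
    (infixl "\<star>\<^sub>1\<^sub>1" 75) where
  "f \<star>\<^sub>1\<^sub>1 g = Cell1 (dom1 f) (steps1 f @ steps1 g)"

definition comp12 :: "('o, 'a) cell1 \<Rightarrow> ('o, 'a, 'b) cell2 \<Rightarrow> ('o, 'a, 'b) cell2"
    (infixl "\<star>\<^sub>1\<^sub>2" 75) where
  "f \<star>\<^sub>1\<^sub>2 \<phi> = Cell2 (f \<star>\<^sub>1\<^sub>1 dom2 \<phi>) (map (\<lambda>w. case w of Wh2 l \<alpha> r \<Rightarrow> Wh2 (f \<star>\<^sub>1\<^sub>1 l) \<alpha> r) (steps2 \<phi>))"

definition comp21 :: "('o, 'a, 'b) cell2 \<Rightarrow> ('o, 'a) cell1 \<Rightarrow> ('o, 'a, 'b) cell2"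
    (infixl "\<star>\<^sub>2\<^sub>1" 75) where
  "\<phi> \<star>\<^sub>2\<^sub>1 g = Cell2 (dom2 \<phi> \<star>\<^sub>1\<^sub>1 g) (map (\<lambda>w. case w of Wh2 l \<alpha> r \<Rightarrow> Wh2 l \<alpha> (r \<star>\<^sub>1\<^sub>1 g)) (steps2 \<phi>))"

definition comp22 :: "('o, 'a, 'b) cell2 \<Rightarrow> ('o, 'a, 'b) cell2 \<Rightarrow> ('o, 'a, 'b) cell2"
    (infixl "\<star>\<^sub>2\<^sub>2" 70) where
  "\<phi> \<star>\<^sub>2\<^sub>2 \<psi> = Cell2 (dom2 \<phi>) (steps2 \<phi> @ steps2 \<psi>)"

definition comp13 :: "('o, 'a) cell1 \<Rightarrow> ('o, 'a, 'b, 'c) cell3 \<Rightarrow> ('o, 'a, 'b, 'c) cell3"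
    (infixl "\<star>\<^sub>1\<^sub>3" 75) where
  "f \<star>\<^sub>1\<^sub>3 F = Cell3 (f \<star>\<^sub>1\<^sub>2 dom3 F)
     (map (\<lambda>w. case w of Wh3 \<kappa> l A r \<rho> \<Rightarrow> Wh3 (f \<star>\<^sub>1\<^sub>2 \<kappa>) (f \<star>\<^sub>1\<^sub>1 l) A r (f \<star>\<^sub>1\<^sub>2 \<rho>)) (steps3 F))"

definition comp31 :: "('o, 'a, 'b, 'c) cell3 \<Rightarrow> ('o, 'a) cell1 \<Rightarrow> ('o, 'a, 'b, 'c) cell3"
    (infixl "\<star>\<^sub>3\<^sub>1" 75) where
  "F \<star>\<^sub>3\<^sub>1 g = Cell3 (dom3 F \<star>\<^sub>2\<^sub>1 g)
     (map (\<lambda>w. case w of Wh3 \<kappa> l A r \<rho> \<Rightarrow> Wh3 (\<kappa> \<star>\<^sub>2\<^sub>1 g) l A (r \<star>\<^sub>1\<^sub>1 g) (\<rho> \<star>\<^sub>2\<^sub>1 g)) (steps3 F))"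

definition comp23 :: "('o, 'a, 'b) cell2 \<Rightarrow> ('o, 'a, 'b, 'c) cell3 \<Rightarrow> ('o, 'a, 'b, 'c) cell3"
    (infixl "\<star>\<^sub>2\<^sub>3" 70) where
  "\<phi> \<star>\<^sub>2\<^sub>3 F = Cell3 (\<phi> \<star>\<^sub>2\<^sub>2 dom3 F)
     (map (\<lambda>w. case w of Wh3 \<kappa> l A r \<rho> \<Rightarrow> Wh3 (\<phi> \<star>\<^sub>2\<^sub>2 \<kappa>) l A r \<rho>) (steps3 F))"

definition comp32 :: "('o, 'a, 'b, 'c) cell3 \<Rightarrow> ('o, 'a, 'b) cell2 \<Rightarrow> ('o, 'a, 'b, 'c) cell3"
    (infixl "\<star>\<^sub>3\<^sub>2" 70) where
  "F \<star>\<^sub>3\<^sub>2 \<psi> = Cell3 (dom3 F \<star>\<^sub>2\<^sub>2 \<psi>)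
     (map (\<lambda>w. case w of Wh3 \<kappa> l A r \<rho> \<Rightarrow> Wh3 \<kappa> l A r (\<rho> \<star>\<^sub>2\<^sub>2 \<psi>)) (steps3 F))"

definition comp33 :: "('o, 'a, 'b, 'c) cell3 \<Rightarrow> ('o, 'a, 'b, 'c) cell3 \<Rightarrow> ('o, 'a, 'b, 'c) cell3"
    (infixl "\<star>\<^sub>3\<^sub>3" 65) where
  "F \<star>\<^sub>3\<^sub>3 G = Cell3 (dom3 F) (steps3 F @ steps3 G)"


subsection \<open>Cells and boundaries\<close>

definition cod1 :: "('o, 'a, 'b, 'z) prepoly2_scheme \<Rightarrow> ('o, 'a) cell1 \<Rightarrow> 'o" where
  "cod1 P f = (if steps1 f = [] then dom1 f else tgt1 P (last (steps1 f)))"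

fun path1 :: "('o, 'a, 'b, 'z) prepoly2_scheme \<Rightarrow> 'o \<Rightarrow> 'a list \<Rightarrow> bool" where
  "path1 P x [] \<longleftrightarrow> True"
| "path1 P x (a # as) \<longleftrightarrow> a \<in> gen1 P \<and> src1 P a = x \<and> path1 P (tgt1 P a) as"

definition cells1 :: "('o, 'a, 'b, 'z) prepoly2_scheme \<Rightarrow> ('o, 'a) cell1 set" where
  "cells1 P = {f. dom1 f \<in> gen0 P \<and> path1 P (dom1 f) (steps1 f)}"

fun wh2_src :: "('o, 'a, 'b, 'z) prepoly2_scheme \<Rightarrow> ('o, 'a, 'b) wh2 \<Rightarrow> ('o, 'a) cell1" where
  "wh2_src P (Wh2 l \<alpha> r) = l \<star>\<^sub>1\<^sub>1 src2 P \<alpha> \<star>\<^sub>1\<^sub>1 r"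

fun wh2_tgt :: "('o, 'a, 'b, 'z) prepoly2_scheme \<Rightarrow> ('o, 'a, 'b) wh2 \<Rightarrow> ('o, 'a) cell1" where
  "wh2_tgt P (Wh2 l \<alpha> r) = l \<star>\<^sub>1\<^sub>1 tgt2 P \<alpha> \<star>\<^sub>1\<^sub>1 r"

fun wh2_ok :: "('o, 'a, 'b, 'z) prepoly2_scheme \<Rightarrow> ('o, 'a, 'b) wh2 \<Rightarrow> bool" where
  "wh2_ok P (Wh2 l \<alpha> r) \<longleftrightarrow>
     l \<in> cells1 P \<and> \<alpha> \<in> gen2 P \<and> r \<in> cells1 P \<and>
     cod1 P l = dom1 (src2 P \<alpha>) \<and> cod1 P (src2 P \<alpha>) = dom1 r"

definition cod2 :: "('o, 'a, 'b, 'z) prepoly2_scheme \<Rightarrow> ('o, 'a, 'b) cell2 \<Rightarrow> ('o, 'a) cell1" where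
  "cod2 P \<phi> = (if steps2 \<phi> = [] then dom2 \<phi> else wh2_tgt P (last (steps2 \<phi>)))"

fun path2 ::
  "('o, 'a, 'b, 'z) prepoly2_scheme \<Rightarrow> ('o, 'a) cell1 \<Rightarrow> ('o, 'a, 'b) wh2 list \<Rightarrow> bool" where
  "path2 P f [] \<longleftrightarrow> True"
| "path2 P f (w # ws) \<longleftrightarrow> wh2_ok P w \<and> wh2_src P w = f \<and> path2 P (wh2_tgt P w) ws"

definition cells2 :: "('o, 'a, 'b, 'z) prepoly2_scheme \<Rightarrow> ('o, 'a, 'b) cell2 set" where
  "cells2 P = {\<phi>. dom2 \<phi> \<in> cells1 P \<and> path2 P (dom2 \<phi>) (steps2 \<phi>)}"

fun wh3_src ::
  "('o, 'a, 'b, 'c, 'z) prepoly3_scheme \<Rightarrow> ('o, 'a, 'b, 'c) wh3 \<Rightarrow> ('o, 'a, 'b) cell2" where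
  "wh3_src P (Wh3 \<kappa> l A r \<rho>) = \<kappa> \<star>\<^sub>2\<^sub>2 (l \<star>\<^sub>1\<^sub>2 src3 P A \<star>\<^sub>2\<^sub>1 r) \<star>\<^sub>2\<^sub>2 \<rho>"

fun wh3_tgt ::
  "('o, 'a, 'b, 'c, 'z) prepoly3_scheme \<Rightarrow> ('o, 'a, 'b, 'c) wh3 \<Rightarrow> ('o, 'a, 'b) cell2" where
  "wh3_tgt P (Wh3 \<kappa> l A r \<rho>) = \<kappa> \<star>\<^sub>2\<^sub>2 (l \<star>\<^sub>1\<^sub>2 tgt3 P A \<star>\<^sub>2\<^sub>1 r) \<star>\<^sub>2\<^sub>2 \<rho>"

fun wh3_ok :: "('o, 'a, 'b, 'c, 'z) prepoly3_scheme \<Rightarrow> ('o, 'a, 'b, 'c) wh3 \<Rightarrow> bool" where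
  "wh3_ok P (Wh3 \<kappa> l A r \<rho>) \<longleftrightarrow>
     \<kappa> \<in> cells2 P \<and> l \<in> cells1 P \<and> A \<in> gen3 P \<and> r \<in> cells1 P \<and> \<rho> \<in> cells2 P \<and>
     cod1 P l = dom1 (dom2 (src3 P A)) \<and> cod1 P (dom2 (src3 P A)) = dom1 r \<and>
     cod2 P \<kappa> = l \<star>\<^sub>1\<^sub>1 dom2 (src3 P A) \<star>\<^sub>1\<^sub>1 r \<and> l \<star>\<^sub>1\<^sub>1 cod2 P (src3 P A) \<star>\<^sub>1\<^sub>1 r = dom2 \<rho>"

definition cod3 ::
  "('o, 'a, 'b, 'c, 'z) prepoly3_scheme \<Rightarrow> ('o, 'a, 'b, 'c) cell3 \<Rightarrow> ('o, 'a, 'b) cell2" where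
  "cod3 P F = (if steps3 F = [] then dom3 F else wh3_tgt P (last (steps3 F)))"

fun path3 ::
  "('o, 'a, 'b, 'c, 'z) prepoly3_scheme \<Rightarrow> ('o, 'a, 'b) cell2 \<Rightarrow> ('o, 'a, 'b, 'c) wh3 list \<Rightarrow> bool"
where
  "path3 P \<phi> [] \<longleftrightarrow> True"
| "path3 P \<phi> (w # ws) \<longleftrightarrow> wh3_ok P w \<and> wh3_src P w = \<phi> \<and> path3 P (wh3_tgt P w) ws"

definition cells3 :: "('o, 'a, 'b, 'c, 'z) prepoly3_scheme \<Rightarrow> ('o, 'a, 'b, 'c) cell3 set" where
  "cells3 P = {F. dom3 F \<in> cells2 P \<and> path3 P (dom3 F) (steps3 F)}"


definition gcell1 :: "('o, 'a, 'b, 'z) prepoly2_scheme \<Rightarrow> 'a \<Rightarrow> ('o, 'a) cell1" where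
  "gcell1 P a = Cell1 (src1 P a) [a]"

definition gcell2 :: "('o, 'a, 'b, 'z) prepoly2_scheme \<Rightarrow> 'b \<Rightarrow> ('o, 'a, 'b) cell2" where
  "gcell2 P \<alpha> =
     Cell2 (src2 P \<alpha>) [Wh2 (id1 (dom1 (src2 P \<alpha>))) \<alpha> (id1 (cod1 P (src2 P \<alpha>)))]"

definition gcell3 :: "('o, 'a, 'b, 'c, 'z) prepoly3_scheme \<Rightarrow> 'c \<Rightarrow> ('o, 'a, 'b, 'c) cell3" where
  "gcell3 P A =
     Cell3 (src3 P A)
       [Wh3 (id2 (dom2 (src3 P A))) (id1 (dom1 (dom2 (src3 P A)))) A
          (id1 (cod1 P (dom2 (src3 P A)))) (id2 (cod2 P (src3 P A)))]"

definition wcell2 :: "('o, 'a, 'b, 'z) prepoly2_scheme \<Rightarrow> ('o, 'a, 'b) wh2 \<Rightarrow> ('o, 'a, 'b) cell2" where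
  "wcell2 P w = Cell2 (wh2_src P w) [w]"


subsection \<open>Well-formed prepolygraphs\<close>

definition prepolygraph2 :: "('o, 'a, 'b, 'z) prepoly2_scheme \<Rightarrow> bool" where
  "prepolygraph2 P \<longleftrightarrow>
     (\<forall>a \<in> gen1 P. src1 P a \<in> gen0 P \<and> tgt1 P a \<in> gen0 P) \<and>
     (\<forall>\<alpha> \<in> gen2 P. src2 P \<alpha> \<in> cells1 P \<and> tgt2 P \<alpha> \<in> cells1 P \<and>
        dom1 (src2 P \<alpha>) = dom1 (tgt2 P \<alpha>) \<and> cod1 P (src2 P \<alpha>) = cod1 P (tgt2 P \<alpha>))"

definition prepolygraph3 :: "('o, 'a, 'b, 'c, 'z) prepoly3_scheme \<Rightarrow> bool" where
  "prepolygraph3 P \<longleftrightarrow> prepolygraph2 P \<and>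
     (\<forall>A \<in> gen3 P. src3 P A \<in> cells2 P \<and> tgt3 P A \<in> cells2 P \<and>
        dom2 (src3 P A) = dom2 (tgt3 P A) \<and> cod2 P (src3 P A) = cod2 P (tgt3 P A))"

definition prepolygraph4 :: "('o, 'a, 'b, 'c, 'd, 'z) prepoly4_scheme \<Rightarrow> bool" where
  "prepolygraph4 P \<longleftrightarrow> prepolygraph3 P \<and>
     (\<forall>G \<in> gen4 P. src4 P G \<in> cells3 P \<and> tgt4 P G \<in> cells3 P \<and>
        dom3 (src4 P G) = dom3 (tgt4 P G) \<and> cod3 P (src4 P G) = cod3 P (tgt4 P G))"


subsection \<open>Free and presented precategories\<close>

datatype ('o, 'a, 'b, 'c) pcell =
    C0 'o
  | C1 "('o, 'a) cell1"
  | C2 "('o, 'a, 'b) cell2"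
  | C3 "('o, 'a, 'b, 'c) cell3"

fun free_bdry ::
  "('o, 'a, 'b, 'c, 'z) prepoly3_scheme \<Rightarrow> sign \<Rightarrow> ('o, 'a, 'b, 'c) pcell \<Rightarrow> ('o, 'a, 'b, 'c) pcell"
where
  "free_bdry P e (C0 x) = C0 x"
| "free_bdry P e (C1 f) = C0 (if e = Neg then dom1 f else cod1 P f)"
| "free_bdry P e (C2 \<phi>) = C1 (if e = Neg then dom2 \<phi> else cod2 P \<phi>)"
| "free_bdry P e (C3 F) = C2 (if e = Neg then dom3 F else cod3 P F)"

fun free_idt :: "('o, 'a, 'b, 'c) pcell \<Rightarrow> ('o, 'a, 'b, 'c) pcell" where
  "free_idt (C0 x) = C1 (id1 x)"
| "free_idt (C1 f) = C2 (id2 f)"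
| "free_idt (C2 \<phi>) = C3 (id3 \<phi>)"
| "free_idt (C3 F) = C3 F"

fun free_comp ::
  "('o, 'a, 'b, 'c) pcell \<Rightarrow> ('o, 'a, 'b, 'c) pcell \<Rightarrow> ('o, 'a, 'b, 'c) pcell" where
  "free_comp (C1 f) (C1 g) = C1 (f \<star>\<^sub>1\<^sub>1 g)"
| "free_comp (C1 f) (C2 \<psi>) = C2 (f \<star>\<^sub>1\<^sub>2 \<psi>)"
| "free_comp (C1 f) (C3 G) = C3 (f \<star>\<^sub>1\<^sub>3 G)"
| "free_comp (C2 \<phi>) (C1 g) = C2 (\<phi> \<star>\<^sub>2\<^sub>1 g)"
| "free_comp (C2 \<phi>) (C2 \<psi>) = C2 (\<phi> \<star>\<^sub>2\<^sub>2 \<psi>)"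
| "free_comp (C2 \<phi>) (C3 G) = C3 (\<phi> \<star>\<^sub>2\<^sub>3 G)"
| "free_comp (C3 F) (C1 g) = C3 (F \<star>\<^sub>3\<^sub>1 g)"
| "free_comp (C3 F) (C2 \<psi>) = C3 (F \<star>\<^sub>3\<^sub>2 \<psi>)"
| "free_comp (C3 F) (C3 G) = C3 (F \<star>\<^sub>3\<^sub>3 G)"
| "free_comp (C0 x) v = v"
| "free_comp u (C0 y) = u"

definition free_precat ::
  "('o, 'a, 'b, 'c, 'z) prepoly3_scheme \<Rightarrow> ('o, 'a, 'b, 'c) pcell precat" where
  "free_precat P = \<lparr>
     cells = (\<lambda>k. if k = 0 then C0 ` gen0 P else if k = 1 then C1 ` cells1 P
                  else if k = 2 then C2 ` cells2 P else if k = 3 then C3 ` cells3 P else {}),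
     bdry = (\<lambda>e i. free_bdry P e),
     idt = (\<lambda>k. free_idt),
     comp = (\<lambda>k l. free_comp) \<rparr>"


subsection \<open>The free precategory is a precategory\<close>

lemma dom1_comp11 [simp]: "dom1 (f \<star>\<^sub>1\<^sub>1 g) = dom1 f"
  by (simp add: comp11_def)

lemma comp11_assoc [simp]: "f \<star>\<^sub>1\<^sub>1 g \<star>\<^sub>1\<^sub>1 h = f \<star>\<^sub>1\<^sub>1 (g \<star>\<^sub>1\<^sub>1 h)"
  by (simp add: comp11_def)

lemma comp11_id [simp]: "f \<star>\<^sub>1\<^sub>1 id1 x = f" "dom1 f = x \<Longrightarrow> id1 x \<star>\<^sub>1\<^sub>1 f = f"
  by (auto simp: comp11_def id1_def)

lemma cod1_comp11 [simp]: "cod1 P f = dom1 g \<Longrightarrow> cod1 P (f \<star>\<^sub>1\<^sub>1 g) = cod1 P g"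
  by (auto simp: cod1_def comp11_def)

lemma dom_id [simp]: "dom1 (id1 x) = x" "dom2 (id2 f) = f" "dom3 (id3 \<phi>) = \<phi>"
  and cod_id [simp]: "cod1 P (id1 x) = x" "cod2 P (id2 f) = f" "cod3 Q (id3 \<phi>) = \<phi>"
  by (simp_all add: id1_def id2_def id3_def cod1_def cod2_def cod3_def)

lemma dom2_comp [simp]: "dom2 (f \<star>\<^sub>1\<^sub>2 \<phi>) = f \<star>\<^sub>1\<^sub>1 dom2 \<phi>" "dom2 (\<phi> \<star>\<^sub>2\<^sub>1 g) = dom2 \<phi> \<star>\<^sub>1\<^sub>1 g"
  "dom2 (\<phi> \<star>\<^sub>2\<^sub>2 \<psi>) = dom2 \<phi>"
  by (simp_all add: comp12_def comp21_def comp22_def)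

lemma cod2_comp12 [simp]: "cod2 P (f \<star>\<^sub>1\<^sub>2 \<phi>) = f \<star>\<^sub>1\<^sub>1 cod2 P \<phi>"
  by (auto simp: cod2_def comp12_def last_map split: wh2.splits)

lemma cod2_comp21 [simp]: "cod2 P (\<phi> \<star>\<^sub>2\<^sub>1 g) = cod2 P \<phi> \<star>\<^sub>1\<^sub>1 g"
  by (auto simp: cod2_def comp21_def last_map split: wh2.splits)

lemma cod2_comp22 [simp]: "cod2 P \<phi> = dom2 \<psi> \<Longrightarrow> cod2 P (\<phi> \<star>\<^sub>2\<^sub>2 \<psi>) = cod2 P \<psi>"
  by (auto simp: cod2_def comp22_def)

lemma comp22_assoc [simp]: "\<phi> \<star>\<^sub>2\<^sub>2 \<psi> \<star>\<^sub>2\<^sub>2 \<chi> = \<phi> \<star>\<^sub>2\<^sub>2 (\<psi> \<star>\<^sub>2\<^sub>2 \<chi>)"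
  by (simp add: comp22_def)

lemma comp12_comp12 [simp]: "f \<star>\<^sub>1\<^sub>2 (g \<star>\<^sub>1\<^sub>2 \<phi>) = f \<star>\<^sub>1\<^sub>1 g \<star>\<^sub>1\<^sub>2 \<phi>"
  and comp21_comp21 [simp]: "\<phi> \<star>\<^sub>2\<^sub>1 f \<star>\<^sub>2\<^sub>1 g = \<phi> \<star>\<^sub>2\<^sub>1 (f \<star>\<^sub>1\<^sub>1 g)"
  and comp12_comp21 [simp]: "f \<star>\<^sub>1\<^sub>2 (\<phi> \<star>\<^sub>2\<^sub>1 g) = f \<star>\<^sub>1\<^sub>2 \<phi> \<star>\<^sub>2\<^sub>1 g"
  by (auto simp: comp12_def comp21_def split: wh2.splits)

lemma comp12_comp22 [simp]: "f \<star>\<^sub>1\<^sub>2 (\<phi> \<star>\<^sub>2\<^sub>2 \<psi>) = (f \<star>\<^sub>1\<^sub>2 \<phi>) \<star>\<^sub>2\<^sub>2 (f \<star>\<^sub>1\<^sub>2 \<psi>)"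
  and comp22_comp21 [simp]: "(\<phi> \<star>\<^sub>2\<^sub>2 \<psi>) \<star>\<^sub>2\<^sub>1 g = (\<phi> \<star>\<^sub>2\<^sub>1 g) \<star>\<^sub>2\<^sub>2 (\<psi> \<star>\<^sub>2\<^sub>1 g)"
  by (auto simp: comp12_def comp21_def comp22_def split: wh2.splits)

lemma comp22_id [simp]: "\<phi> \<star>\<^sub>2\<^sub>2 id2 f = \<phi>" "dom2 \<phi> = f \<Longrightarrow> id2 f \<star>\<^sub>2\<^sub>2 \<phi> = \<phi>"
  by (auto simp: comp22_def id2_def)

lemma comp12_id2 [simp]: "f \<star>\<^sub>1\<^sub>2 id2 g = id2 (f \<star>\<^sub>1\<^sub>1 g)"
  and comp21_id2 [simp]: "id2 f \<star>\<^sub>2\<^sub>1 g = id2 (f \<star>\<^sub>1\<^sub>1 g)"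
  by (simp_all add: comp12_def comp21_def id2_def)

lemma comp21_id1 [simp]: "\<phi> \<star>\<^sub>2\<^sub>1 id1 x = \<phi>"
  by (cases \<phi>) (auto simp: comp21_def split: wh2.splits intro!: map_idI)

lemma dom3_comp [simp]: "dom3 (f \<star>\<^sub>1\<^sub>3 F) = f \<star>\<^sub>1\<^sub>2 dom3 F" "dom3 (F \<star>\<^sub>3\<^sub>1 g) = dom3 F \<star>\<^sub>2\<^sub>1 g"
  "dom3 (\<phi> \<star>\<^sub>2\<^sub>3 F) = \<phi> \<star>\<^sub>2\<^sub>2 dom3 F" "dom3 (F \<star>\<^sub>3\<^sub>2 \<psi>) = dom3 F \<star>\<^sub>2\<^sub>2 \<psi>" "dom3 (F \<star>\<^sub>3\<^sub>3 G) = dom3 F"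
  by (simp_all add: comp13_def comp31_def comp23_def comp32_def comp33_def)

lemma cod3_comp [simp]: "cod3 P (f \<star>\<^sub>1\<^sub>3 F) = f \<star>\<^sub>1\<^sub>2 cod3 P F" "cod3 P (F \<star>\<^sub>3\<^sub>1 g) = cod3 P F \<star>\<^sub>2\<^sub>1 g"
  "cod3 P (\<phi> \<star>\<^sub>2\<^sub>3 F) = \<phi> \<star>\<^sub>2\<^sub>2 cod3 P F" "cod3 P (F \<star>\<^sub>3\<^sub>2 \<psi>) = cod3 P F \<star>\<^sub>2\<^sub>2 \<psi>"
  by (auto simp: cod3_def comp13_def comp31_def comp23_def comp32_def last_map
      split: wh3.splits)

lemma cod3_comp33 [simp]: "cod3 P F = dom3 G \<Longrightarrow> cod3 P (F \<star>\<^sub>3\<^sub>3 G) = cod3 P G"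
  by (auto simp: cod3_def comp33_def)

lemma comp3_assoc [simp]:
  "f \<star>\<^sub>1\<^sub>3 (g \<star>\<^sub>1\<^sub>3 F) = f \<star>\<^sub>1\<^sub>1 g \<star>\<^sub>1\<^sub>3 F"
  "F \<star>\<^sub>3\<^sub>1 f \<star>\<^sub>3\<^sub>1 g = F \<star>\<^sub>3\<^sub>1 (f \<star>\<^sub>1\<^sub>1 g)"
  "f \<star>\<^sub>1\<^sub>3 (F \<star>\<^sub>3\<^sub>1 g) = f \<star>\<^sub>1\<^sub>3 F \<star>\<^sub>3\<^sub>1 g"
  "\<phi> \<star>\<^sub>2\<^sub>3 (\<psi> \<star>\<^sub>2\<^sub>3 F) = \<phi> \<star>\<^sub>2\<^sub>2 \<psi> \<star>\<^sub>2\<^sub>3 F"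
  "F \<star>\<^sub>3\<^sub>2 \<phi> \<star>\<^sub>3\<^sub>2 \<psi> = F \<star>\<^sub>3\<^sub>2 (\<phi> \<star>\<^sub>2\<^sub>2 \<psi>)"
  "\<phi> \<star>\<^sub>2\<^sub>3 (F \<star>\<^sub>3\<^sub>2 \<psi>) = \<phi> \<star>\<^sub>2\<^sub>3 F \<star>\<^sub>3\<^sub>2 \<psi>"
  "F \<star>\<^sub>3\<^sub>3 G \<star>\<^sub>3\<^sub>3 H = F \<star>\<^sub>3\<^sub>3 (G \<star>\<^sub>3\<^sub>3 H)"
  by (auto simp: comp13_def comp31_def comp23_def comp32_def comp33_def split: wh3.splits)

lemma comp3_distrib [simp]:
  "f \<star>\<^sub>1\<^sub>3 (\<phi> \<star>\<^sub>2\<^sub>3 F) = (f \<star>\<^sub>1\<^sub>2 \<phi>) \<star>\<^sub>2\<^sub>3 (f \<star>\<^sub>1\<^sub>3 F)"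
  "f \<star>\<^sub>1\<^sub>3 (F \<star>\<^sub>3\<^sub>2 \<psi>) = (f \<star>\<^sub>1\<^sub>3 F) \<star>\<^sub>3\<^sub>2 (f \<star>\<^sub>1\<^sub>2 \<psi>)"
  "f \<star>\<^sub>1\<^sub>3 (F \<star>\<^sub>3\<^sub>3 G) = (f \<star>\<^sub>1\<^sub>3 F) \<star>\<^sub>3\<^sub>3 (f \<star>\<^sub>1\<^sub>3 G)"
  "(\<phi> \<star>\<^sub>2\<^sub>3 F) \<star>\<^sub>3\<^sub>1 g = (\<phi> \<star>\<^sub>2\<^sub>1 g) \<star>\<^sub>2\<^sub>3 (F \<star>\<^sub>3\<^sub>1 g)"
  "(F \<star>\<^sub>3\<^sub>2 \<psi>) \<star>\<^sub>3\<^sub>1 g = (F \<star>\<^sub>3\<^sub>1 g) \<star>\<^sub>3\<^sub>2 (\<psi> \<star>\<^sub>2\<^sub>1 g)"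
  "(F \<star>\<^sub>3\<^sub>3 G) \<star>\<^sub>3\<^sub>1 g = (F \<star>\<^sub>3\<^sub>1 g) \<star>\<^sub>3\<^sub>3 (G \<star>\<^sub>3\<^sub>1 g)"
  "\<phi> \<star>\<^sub>2\<^sub>3 (F \<star>\<^sub>3\<^sub>3 G) = (\<phi> \<star>\<^sub>2\<^sub>3 F) \<star>\<^sub>3\<^sub>3 (\<phi> \<star>\<^sub>2\<^sub>3 G)"
  "(F \<star>\<^sub>3\<^sub>3 G) \<star>\<^sub>3\<^sub>2 \<psi> = (F \<star>\<^sub>3\<^sub>2 \<psi>) \<star>\<^sub>3\<^sub>3 (G \<star>\<^sub>3\<^sub>2 \<psi>)"
  by (auto simp: comp13_def comp31_def comp23_def comp32_def comp33_def split: wh3.splits)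

lemma comp3_id [simp]:
  "F \<star>\<^sub>3\<^sub>3 id3 \<phi> = F" "dom3 F = \<phi> \<Longrightarrow> id3 \<phi> \<star>\<^sub>3\<^sub>3 F = F"
  "f \<star>\<^sub>1\<^sub>3 id3 \<phi> = id3 (f \<star>\<^sub>1\<^sub>2 \<phi>)" "id3 \<phi> \<star>\<^sub>3\<^sub>1 g = id3 (\<phi> \<star>\<^sub>2\<^sub>1 g)"
  "\<phi> \<star>\<^sub>2\<^sub>3 id3 \<psi> = id3 (\<phi> \<star>\<^sub>2\<^sub>2 \<psi>)" "id3 \<phi> \<star>\<^sub>3\<^sub>2 \<psi> = id3 (\<phi> \<star>\<^sub>2\<^sub>2 \<psi>)"
  by (auto simp: comp13_def comp31_def comp23_def comp32_def comp33_def id3_def)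

lemma comp31_id1 [simp]: "F \<star>\<^sub>3\<^sub>1 id1 x = F"
  and comp32_id2 [simp]: "F \<star>\<^sub>3\<^sub>2 id2 f = F"
  by (cases F; auto simp: comp31_def comp32_def split: wh3.splits intro!: map_idI)+

lemma path1_append: "path1 P x (as @ bs) \<longleftrightarrow> path1 P x as \<and> path1 P (cod1 P (Cell1 x as)) bs"
  by (induction as arbitrary: x) (auto simp: cod1_def)

lemma path2_append: "path2 P f (vs @ ws) \<longleftrightarrow> path2 P f vs \<and> path2 P (cod2 P (Cell2 f vs)) ws"
  by (induction vs arbitrary: f) (auto simp: cod2_def)

lemma path3_append: "path3 P \<phi> (vs @ ws) \<longleftrightarrow> path3 P \<phi> vs \<and> path3 P (cod3 P (Cell3 \<phi> vs)) ws"
  by (induction vs arbitrary: \<phi>) (auto simp: cod3_def)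

lemma cells_id [simp]:
  "id1 x \<in> cells1 P \<longleftrightarrow> x \<in> gen0 P" "id2 f \<in> cells2 P \<longleftrightarrow> f \<in> cells1 P"
  "id3 \<phi> \<in> cells3 Q \<longleftrightarrow> \<phi> \<in> cells2 Q"
  by (simp_all add: cells1_def cells2_def cells3_def id1_def id2_def id3_def)

lemma comp11_cells [simp]:
  "f \<in> cells1 P \<Longrightarrow> g \<in> cells1 P \<Longrightarrow> cod1 P f = dom1 g \<Longrightarrow> f \<star>\<^sub>1\<^sub>1 g \<in> cells1 P"
  by (auto simp: cells1_def comp11_def path1_append)

lemma comp22_cells [simp]:
  "\<phi> \<in> cells2 P \<Longrightarrow> \<psi> \<in> cells2 P \<Longrightarrow> cod2 P \<phi> = dom2 \<psi> \<Longrightarrow> \<phi> \<star>\<^sub>2\<^sub>2 \<psi> \<in> cells2 P"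
  by (auto simp: cells2_def comp22_def path2_append)

lemma comp33_cells [simp]:
  "F \<in> cells3 P \<Longrightarrow> G \<in> cells3 P \<Longrightarrow> cod3 P F = dom3 G \<Longrightarrow> F \<star>\<^sub>3\<^sub>3 G \<in> cells3 P"
  by (auto simp: cells3_def comp33_def path3_append)

lemma cells1_path: "f \<in> cells1 P \<Longrightarrow> path1 P (dom1 f) (steps1 f)"
  and cells2_path: "\<phi> \<in> cells2 P \<Longrightarrow> path2 P (dom2 \<phi>) (steps2 \<phi>)"
  and cells3_path: "F \<in> cells3 Q \<Longrightarrow> path3 Q (dom3 F) (steps3 F)"
  by (simp_all add: cells1_def cells2_def cells3_def)

lemma cells1I: "x \<in> gen0 P \<Longrightarrow> path1 P x as \<Longrightarrow> Cell1 x as \<in> cells1 P"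
  and cells2I: "f \<in> cells1 P \<Longrightarrow> path2 P f ws \<Longrightarrow> Cell2 f ws \<in> cells2 P"
  and cells3I: "\<phi> \<in> cells2 Q \<Longrightarrow> path3 Q \<phi> vs \<Longrightarrow> Cell3 \<phi> vs \<in> cells3 Q"
  by (simp_all add: cells1_def cells2_def cells3_def)

lemma dom1_cells [simp]: "f \<in> cells1 P \<Longrightarrow> dom1 f \<in> gen0 P"
  and dom2_cells [simp]: "\<phi> \<in> cells2 P \<Longrightarrow> dom2 \<phi> \<in> cells1 P"
  and dom3_cells [simp]: "F \<in> cells3 Q \<Longrightarrow> dom3 F \<in> cells2 Q"
  by (simp_all add: cells1_def cells2_def cells3_def)

context
  fixes P :: "('o, 'a, 'b, 'z) prepoly2_scheme"
  assumes P: "prepolygraph2 P"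
begin

lemma tgt1_gen0: "a \<in> gen1 P \<Longrightarrow> tgt1 P a \<in> gen0 P"
  using P by (simp add: prepolygraph2_def)

lemma gen2_cells [simp]:
  "\<alpha> \<in> gen2 P \<Longrightarrow> src2 P \<alpha> \<in> cells1 P" "\<alpha> \<in> gen2 P \<Longrightarrow> tgt2 P \<alpha> \<in> cells1 P"
  "\<alpha> \<in> gen2 P \<Longrightarrow> dom1 (tgt2 P \<alpha>) = dom1 (src2 P \<alpha>)"
  "\<alpha> \<in> gen2 P \<Longrightarrow> cod1 P (tgt2 P \<alpha>) = cod1 P (src2 P \<alpha>)"
  using P by (auto simp: prepolygraph2_def)

lemma cod1_cells [simp]:
  assumes "f \<in> cells1 P"
  shows "cod1 P f \<in> gen0 P"
proof (cases "steps1 f = []")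
  case False
  then have "path1 P (dom1 f) (butlast (steps1 f) @ [last (steps1 f)])"
    using assms False by (simp add: cells1_path)
  then have "last (steps1 f) \<in> gen1 P" by (simp only: path1_append path1.simps)
  then have "tgt1 P (last (steps1 f)) \<in> gen0 P"
    by (rule tgt1_gen0)
  then show ?thesis using False by (simp add: cod1_def)
qed (use assms in \<open>simp add: cod1_def\<close>)

lemma wh2_ok_bdry:
  assumes "wh2_ok P w"
  shows "wh2_src P w \<in> cells1 P" "wh2_tgt P w \<in> cells1 P"
    "dom1 (wh2_tgt P w) = dom1 (wh2_src P w)" "cod1 P (wh2_tgt P w) = cod1 P (wh2_src P w)"
  using assms by (cases w; auto)+

lemma path2_globular:
  assumes "f \<in> cells1 P" "path2 P f ws"
  shows "cod2 P (Cell2 f ws) \<in> cells1 P \<and> dom1 (cod2 P (Cell2 f ws)) = dom1 f \<and>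
    cod1 P (cod2 P (Cell2 f ws)) = cod1 P f \<and>
    (\<forall>l \<alpha> r. Wh2 l \<alpha> r \<in> set ws \<longrightarrow> dom1 l = dom1 f \<and> cod1 P r = cod1 P f)"
  using assms
proof (induction ws arbitrary: f)
  case (Cons w ws)
  have w: "wh2_ok P w" "wh2_src P w = f" "path2 P (wh2_tgt P w) ws"
    using Cons.prems by auto
  note b = wh2_ok_bdry[OF w(1)]
  have "cod2 P (Cell2 f (w # ws)) = cod2 P (Cell2 (wh2_tgt P w) ws)"
    by (simp add: cod2_def)
  moreover have "Wh2 l \<alpha> r = w \<Longrightarrow> dom1 l = dom1 f \<and> cod1 P r = cod1 P f" for l \<alpha> r
    using w(1,2) by auto
  ultimately show ?case
    using Cons.IH[OF b(2) w(3)] b unfolding w(2) by simp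
qed (auto simp: cod2_def)

lemma cod2_cells [simp]:
  assumes "\<phi> \<in> cells2 P"
  shows "cod2 P \<phi> \<in> cells1 P" "dom1 (cod2 P \<phi>) = dom1 (dom2 \<phi>)"
    "cod1 P (cod2 P \<phi>) = cod1 P (dom2 \<phi>)"
  using path2_globular[of "dom2 \<phi>" "steps2 \<phi>"] assms by (simp_all add: cells2_path)

lemma path2_comp12:
  assumes "f \<in> cells1 P" "h \<in> cells1 P" "cod1 P f = dom1 h" "path2 P h ws"
  shows "path2 P (f \<star>\<^sub>1\<^sub>1 h) (map (\<lambda>w. case w of Wh2 l \<alpha> r \<Rightarrow> Wh2 (f \<star>\<^sub>1\<^sub>1 l) \<alpha> r) ws)"
  using assms
proof (induction ws arbitrary: h)
  case (Cons w ws)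
  obtain l \<alpha> r where w: "w = Wh2 l \<alpha> r" by (cases w)
  have "path2 P (f \<star>\<^sub>1\<^sub>1 wh2_tgt P w) (map (\<lambda>w. case w of Wh2 l \<alpha> r \<Rightarrow> Wh2 (f \<star>\<^sub>1\<^sub>1 l) \<alpha> r) ws)"
    using Cons.prems wh2_ok_bdry[of w] by (intro Cons.IH) simp_all
  moreover have "dom1 l = dom1 h" "cod1 P r = cod1 P h" "h = l \<star>\<^sub>1\<^sub>1 (src2 P \<alpha> \<star>\<^sub>1\<^sub>1 r)"
    using Cons.prems w by auto
  ultimately show ?case using Cons.prems w by simp
qed simp

lemma path2_comp21:
  assumes "g \<in> cells1 P" "h \<in> cells1 P" "cod1 P h = dom1 g" "path2 P h ws"
  shows "path2 P (h \<star>\<^sub>1\<^sub>1 g) (map (\<lambda>w. case w of Wh2 l \<alpha> r \<Rightarrow> Wh2 l \<alpha> (r \<star>\<^sub>1\<^sub>1 g)) ws)"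
  using assms
proof (induction ws arbitrary: h)
  case (Cons w ws)
  obtain l \<alpha> r where w: "w = Wh2 l \<alpha> r" by (cases w)
  have "path2 P (wh2_tgt P w \<star>\<^sub>1\<^sub>1 g) (map (\<lambda>w. case w of Wh2 l \<alpha> r \<Rightarrow> Wh2 l \<alpha> (r \<star>\<^sub>1\<^sub>1 g)) ws)"
    using Cons.prems wh2_ok_bdry[of w] by (intro Cons.IH) simp_all
  moreover have "dom1 l = dom1 h" "cod1 P r = cod1 P h" "h = l \<star>\<^sub>1\<^sub>1 (src2 P \<alpha> \<star>\<^sub>1\<^sub>1 r)"
    using Cons.prems w by auto
  ultimately show ?case using Cons.prems w by simp
qed simp

lemma comp12_cells [simp]:
  "f \<in> cells1 P \<Longrightarrow> \<phi> \<in> cells2 P \<Longrightarrow> cod1 P f = dom1 (dom2 \<phi>) \<Longrightarrow> f \<star>\<^sub>1\<^sub>2 \<phi> \<in> cells2 P"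
  using path2_comp12[of f "dom2 \<phi>" "steps2 \<phi>"] by (simp add: cells2I cells2_path comp12_def)

lemma comp21_cells [simp]:
  "\<phi> \<in> cells2 P \<Longrightarrow> g \<in> cells1 P \<Longrightarrow> cod1 P (dom2 \<phi>) = dom1 g \<Longrightarrow> \<phi> \<star>\<^sub>2\<^sub>1 g \<in> cells2 P"
  using path2_comp21[of g "dom2 \<phi>" "steps2 \<phi>"] by (simp add: cells2I cells2_path comp21_def)

lemma comp12_id1 [simp]:
  assumes "\<phi> \<in> cells2 P" "dom1 (dom2 \<phi>) = x"
  shows "id1 x \<star>\<^sub>1\<^sub>2 \<phi> = \<phi>"
proof -
  have "(case w of Wh2 l \<alpha> r \<Rightarrow> Wh2 (id1 x \<star>\<^sub>1\<^sub>1 l) \<alpha> r) = w" if "w \<in> set (steps2 \<phi>)" for w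
    using path2_globular[of "dom2 \<phi>" "steps2 \<phi>"] assms that
    by (cases w) (auto simp: cells2_path)
  then show ?thesis using assms dom2_cells[OF assms(1)] by (cases \<phi>) (auto simp: comp12_def intro!: map_idI)
qed

end

context
  fixes P :: "('o, 'a, 'b, 'c, 'z) prepoly3_scheme"
  assumes P3: "prepolygraph3 P"
begin

lemma P2: "prepolygraph2 P"
  using P3 by (simp add: prepolygraph3_def)

lemmas [simp] = gen2_cells[OF P2] cod1_cells[OF P2] cod2_cells[OF P2] comp12_cells[OF P2]
  comp21_cells[OF P2] comp12_id1[OF P2]

lemma gen3_cells [simp]:
  "A \<in> gen3 P \<Longrightarrow> src3 P A \<in> cells2 P" "A \<in> gen3 P \<Longrightarrow> tgt3 P A \<in> cells2 P"
  "A \<in> gen3 P \<Longrightarrow> dom2 (tgt3 P A) = dom2 (src3 P A)"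
  "A \<in> gen3 P \<Longrightarrow> cod2 P (tgt3 P A) = cod2 P (src3 P A)"
  using P3 by (auto simp: prepolygraph3_def)

lemma wh3_ok_bdry:
  assumes "wh3_ok P w"
  shows "wh3_src P w \<in> cells2 P" "wh3_tgt P w \<in> cells2 P"
    "dom2 (wh3_tgt P w) = dom2 (wh3_src P w)" "cod2 P (wh3_tgt P w) = cod2 P (wh3_src P w)"
  using assms by (cases w; auto)+

lemma path3_globular:
  assumes "\<phi> \<in> cells2 P" "path3 P \<phi> ws"
  shows "cod3 P (Cell3 \<phi> ws) \<in> cells2 P \<and> dom2 (cod3 P (Cell3 \<phi> ws)) = dom2 \<phi> \<and>
    cod2 P (cod3 P (Cell3 \<phi> ws)) = cod2 P \<phi> \<and>
    (\<forall>\<kappa> l A r \<rho>. Wh3 \<kappa> l A r \<rho> \<in> set ws \<longrightarrow> dom2 \<kappa> = dom2 \<phi> \<and> cod2 P \<rho> = cod2 P \<phi> \<and>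
       \<kappa> \<in> cells2 P \<and> \<rho> \<in> cells2 P \<and> dom1 (dom2 \<rho>) = dom1 (dom2 \<phi>) \<and> dom1 l = dom1 (dom2 \<phi>))"
  using assms
proof (induction ws arbitrary: \<phi>)
  case (Cons w ws)
  have w: "wh3_ok P w" "wh3_src P w = \<phi>" "path3 P (wh3_tgt P w) ws"
    using Cons.prems by auto
  note b = wh3_ok_bdry[OF w(1)]
  have e: "cod3 P (Cell3 \<phi> (w # ws)) = cod3 P (Cell3 (wh3_tgt P w) ws)"
    by (simp add: cod3_def)
  have "dom2 \<kappa> = dom2 \<phi> \<and> cod2 P \<rho> = cod2 P \<phi> \<and> \<kappa> \<in> cells2 P \<and> \<rho> \<in> cells2 P \<and>
      dom1 (dom2 \<rho>) = dom1 (dom2 \<phi>) \<and> dom1 l = dom1 (dom2 \<phi>)" if "w = Wh3 \<kappa> l A r \<rho>" for \<kappa> l A r \<rho>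
  proof -
    have k: "\<kappa> \<in> cells2 P" "\<rho> \<in> cells2 P" "cod2 P \<kappa> = l \<star>\<^sub>1\<^sub>1 dom2 (src3 P A) \<star>\<^sub>1\<^sub>1 r"
      "l \<star>\<^sub>1\<^sub>1 cod2 P (src3 P A) \<star>\<^sub>1\<^sub>1 r = dom2 \<rho>"
      using w(1) that by auto
    have "dom1 (dom2 \<rho>) = dom1 l"
      by (simp flip: k(4))
    moreover have "dom1 (dom2 \<kappa>) = dom1 l"
      using k(3) cod2_cells(2)[OF P2 k(1)] by simp
    moreover have "dom2 \<kappa> = dom2 \<phi>" "cod2 P \<rho> = cod2 P \<phi>"
      unfolding w(2)[symmetric] that using k by simp_all
    ultimately show ?thesis using k by metis
  qed
  then show ?case
    using Cons.IH[OF b(2) w(3)] b(3,4) unfolding e w(2) by (simp add: eq_commute[of _ w])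
qed (auto simp: cod3_def)

lemma cod3_cells [simp]:
  assumes "F \<in> cells3 P"
  shows "cod3 P F \<in> cells2 P" "dom2 (cod3 P F) = dom2 (dom3 F)"
    "cod2 P (cod3 P F) = cod2 P (dom3 F)"
  using path3_globular[of "dom3 F" "steps3 F"] assms by (simp_all add: cells3_path)

lemma path3_map:
  assumes "path3 P \<phi> ws" "\<phi> \<in> cells2 P"
    and "\<And>w. wh3_ok P w \<Longrightarrow> dom2 (wh3_src P w) = dom2 \<phi> \<Longrightarrow> cod2 P (wh3_src P w) = cod2 P \<phi> \<Longrightarrow>
      wh3_ok P (T w) \<and> wh3_src P (T w) = t (wh3_src P w) \<and> wh3_tgt P (T w) = t (wh3_tgt P w)"
  shows "path3 P (t \<phi>) (map T ws)"
  using assms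
proof (induction ws arbitrary: \<phi>)
  case (Cons w ws)
  have w: "wh3_ok P w" "wh3_src P w = \<phi>" "path3 P (wh3_tgt P w) ws"
    using Cons.prems by auto
  note b = wh3_ok_bdry[OF w(1)]
  have "path3 P (t (wh3_tgt P w)) (map T ws)"
    by (rule Cons.IH[OF w(3) b(2)]) (use Cons.prems(3) b w in auto)
  then show ?case using Cons.prems(3)[OF w(1)] w by auto
qed simp

lemma wh3_ok_outer:
  assumes "wh3_ok P (Wh3 \<kappa> l A r \<rho>)"
  shows "dom1 (dom2 \<kappa>) = dom1 l" "dom1 (dom2 \<rho>) = dom1 l"
    "cod1 P (dom2 \<kappa>) = cod1 P r" "cod1 P (dom2 \<rho>) = cod1 P r"
proof -
  have k: "\<kappa> \<in> cells2 P" "\<rho> \<in> cells2 P" "cod2 P \<kappa> = l \<star>\<^sub>1\<^sub>1 dom2 (src3 P A) \<star>\<^sub>1\<^sub>1 r"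
    "dom2 \<rho> = l \<star>\<^sub>1\<^sub>1 cod2 P (src3 P A) \<star>\<^sub>1\<^sub>1 r" "cod1 P (dom2 (src3 P A)) = dom1 r" "A \<in> gen3 P"
    "cod1 P l = dom1 (dom2 (src3 P A))"
    using assms by auto
  show "dom1 (dom2 \<kappa>) = dom1 l" "cod1 P (dom2 \<kappa>) = cod1 P r"
    using cod2_cells(2,3)[OF P2 k(1)] k by auto
  show "dom1 (dom2 \<rho>) = dom1 l" "cod1 P (dom2 \<rho>) = cod1 P r"
    using k by auto
qed

lemma comp13_cells [simp]:
  assumes "f \<in> cells1 P" "F \<in> cells3 P" "cod1 P f = dom1 (dom2 (dom3 F))"
  shows "f \<star>\<^sub>1\<^sub>3 F \<in> cells3 P"
proof -
  have "path3 P (f \<star>\<^sub>1\<^sub>2 dom3 F) (map (\<lambda>w. case w of Wh3 \<kappa> l A r \<rho> \<Rightarrow>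
      Wh3 (f \<star>\<^sub>1\<^sub>2 \<kappa>) (f \<star>\<^sub>1\<^sub>1 l) A r (f \<star>\<^sub>1\<^sub>2 \<rho>)) (steps3 F))"
  proof (rule path3_map[where t = "\<lambda>\<chi>. f \<star>\<^sub>1\<^sub>2 \<chi>"], goal_cases)
    case (3 w)
    obtain \<kappa> l A r \<rho> where w: "w = Wh3 \<kappa> l A r \<rho>" by (cases w)
    show ?case
      using 3 wh3_ok_outer[of \<kappa> l A r \<rho>] assms unfolding w by simp
  qed (use assms in \<open>auto simp: cells3_path\<close>)
  then show ?thesis using assms by (simp add: cells3I comp13_def)
qed

lemma comp31_cells [simp]:
  assumes "g \<in> cells1 P" "F \<in> cells3 P" "cod1 P (dom2 (dom3 F)) = dom1 g"
  shows "F \<star>\<^sub>3\<^sub>1 g \<in> cells3 P"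
proof -
  have "path3 P (dom3 F \<star>\<^sub>2\<^sub>1 g) (map (\<lambda>w. case w of Wh3 \<kappa> l A r \<rho> \<Rightarrow>
      Wh3 (\<kappa> \<star>\<^sub>2\<^sub>1 g) l A (r \<star>\<^sub>1\<^sub>1 g) (\<rho> \<star>\<^sub>2\<^sub>1 g)) (steps3 F))"
  proof (rule path3_map[where t = "\<lambda>\<chi>. \<chi> \<star>\<^sub>2\<^sub>1 g"], goal_cases)
    case (3 w)
    obtain \<kappa> l A r \<rho> where w: "w = Wh3 \<kappa> l A r \<rho>" by (cases w)
    have e: "dom2 \<rho> = l \<star>\<^sub>1\<^sub>1 (cod2 P (src3 P A) \<star>\<^sub>1\<^sub>1 r)" using 3 w by simp
    have "l \<star>\<^sub>1\<^sub>1 (cod2 P (src3 P A) \<star>\<^sub>1\<^sub>1 (r \<star>\<^sub>1\<^sub>1 g)) = dom2 \<rho> \<star>\<^sub>1\<^sub>1 g"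
      unfolding e by simp
    then show ?case
      using 3 wh3_ok_outer[of \<kappa> l A r \<rho>] assms unfolding w by simp
  qed (use assms in \<open>auto simp: cells3_path\<close>)
  then show ?thesis using assms by (simp add: cells3I comp31_def)
qed

lemma comp23_cells [simp]:
  assumes "\<phi> \<in> cells2 P" "F \<in> cells3 P" "cod2 P \<phi> = dom2 (dom3 F)"
  shows "\<phi> \<star>\<^sub>2\<^sub>3 F \<in> cells3 P"
proof -
  have "path3 P (\<phi> \<star>\<^sub>2\<^sub>2 dom3 F) (map (\<lambda>w. case w of Wh3 \<kappa> l A r \<rho> \<Rightarrow>
      Wh3 (\<phi> \<star>\<^sub>2\<^sub>2 \<kappa>) l A r \<rho>) (steps3 F))"
  proof (rule path3_map[where t = "\<lambda>\<chi>. \<phi> \<star>\<^sub>2\<^sub>2 \<chi>"], goal_cases)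
    case (3 w)
    then show ?case
      using assms by (cases w) simp
  qed (use assms in \<open>auto simp: cells3_path\<close>)
  then show ?thesis using assms by (simp add: cells3I comp23_def)
qed

lemma comp32_cells [simp]:
  assumes "\<psi> \<in> cells2 P" "F \<in> cells3 P" "cod2 P (dom3 F) = dom2 \<psi>"
  shows "F \<star>\<^sub>3\<^sub>2 \<psi> \<in> cells3 P"
proof -
  have "path3 P (dom3 F \<star>\<^sub>2\<^sub>2 \<psi>) (map (\<lambda>w. case w of Wh3 \<kappa> l A r \<rho> \<Rightarrow>
      Wh3 \<kappa> l A r (\<rho> \<star>\<^sub>2\<^sub>2 \<psi>)) (steps3 F))"
  proof (rule path3_map[where t = "\<lambda>\<chi>. \<chi> \<star>\<^sub>2\<^sub>2 \<psi>"], goal_cases)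
    case (3 w)
    then show ?case
      using assms by (cases w) simp
  qed (use assms in \<open>auto simp: cells3_path\<close>)
  then show ?thesis using assms by (simp add: cells3I comp32_def)
qed

lemma comp13_id1 [simp]:
  assumes "F \<in> cells3 P" "dom1 (dom2 (dom3 F)) = x"
  shows "id1 x \<star>\<^sub>1\<^sub>3 F = F"
proof -
  have "(case w of Wh3 \<kappa> l A r \<rho> \<Rightarrow> Wh3 (id1 x \<star>\<^sub>1\<^sub>2 \<kappa>) (id1 x \<star>\<^sub>1\<^sub>1 l) A r (id1 x \<star>\<^sub>1\<^sub>2 \<rho>)) = w"
    if "w \<in> set (steps3 F)" for w
    using path3_globular[of "dom3 F" "steps3 F"] assms that
    by (cases w) (auto simp: cells3_path)
  then show ?thesis using assms dom3_cells[OF assms(1)] by (cases F) (auto simp: comp13_def intro!: map_idI)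
qed

lemma comp23_id2 [simp]:
  assumes "F \<in> cells3 P" "dom2 (dom3 F) = f"
  shows "id2 f \<star>\<^sub>2\<^sub>3 F = F"
proof -
  have "(case w of Wh3 \<kappa> l A r \<rho> \<Rightarrow> Wh3 (id2 f \<star>\<^sub>2\<^sub>2 \<kappa>) l A r \<rho>) = w"
    if "w \<in> set (steps3 F)" for w
    using path3_globular[of "dom3 F" "steps3 F"] assms that
    by (cases w) (auto simp: cells3_path)
  then show ?thesis using assms dom3_cells[OF assms(1)] by (cases F) (auto simp: comp23_def intro!: map_idI)
qed

lemma nat_cases3: "k \<in> {1..3} \<longleftrightarrow> k = 1 \<or> k = 2 \<or> k = (3::nat)"
  by auto

lemma free_precat_simps [simp]:
  "cells (free_precat P) 0 = C0 ` gen0 P" "cells (free_precat P) (Suc 0) = C1 ` cells1 P"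
  "cells (free_precat P) 2 = C2 ` cells2 P" "cells (free_precat P) 3 = C3 ` cells3 P"
  "bdry (free_precat P) e i = free_bdry P e" "idt (free_precat P) i = free_idt"
  "comp (free_precat P) i j = free_comp"
  by (simp_all add: free_precat_def)

lemma ibdry_numeral:
  "ibdry C e i (Suc 0) u = (if i \<le> 0 then bdry C e 0 u else u)"
  "ibdry C e i 2 u = (if i \<le> 1 then ibdry C e i 1 (bdry C e 1 u) else u)"
  "ibdry C e i 3 u = (if i \<le> 2 then ibdry C e i 2 (bdry C e 2 u) else u)"
  by (simp_all add: numeral_2_eq_2 numeral_3_eq_3)

lemma composable_free [simp]:
  "composable 3 (free_precat P) k l u v \<longleftrightarrow>
    k \<in> {1..3} \<and> l \<in> {1..3} \<and> u \<in> cells (free_precat P) k \<and> v \<in> cells (free_precat P) l \<and>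
     ibdry (free_precat P) Pos (min k l - 1) k u = ibdry (free_precat P) Neg (min k l - 1) l v"
  by (simp add: composable_def)

theorem precategory_free: "precategory 3 (free_precat P)"
proof -
  have less3: "i < 3 \<longleftrightarrow> i = 0 \<or> i = 1 \<or> i = (2::nat)" for i by auto
  have less2: "i < 2 \<longleftrightarrow> i = 0 \<or> i = (1::nat)" for i by auto
  have le3: "k \<le> 3 \<longleftrightarrow> k = 0 \<or> k = 1 \<or> k = 2 \<or> k = (3::nat)" for k by auto
  note [simp] = numeral_2_eq_2[symmetric] numeral_3_eq_3[symmetric] ibdry_numeral
  have *: "k = 1 \<and> (\<exists>f. u = C1 f) \<or> k = 2 \<and> (\<exists>\<phi>. u = C2 \<phi>) \<or> k = 3 \<and> (\<exists>F. u = C3 F)"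
    if "k \<in> {1..3}" "u \<in> cells (free_precat P) k" for k u
    using that unfolding nat_cases3 by auto
  have assoc: "free_comp (free_comp u v) w = free_comp u (free_comp v w)"
    if "min k l = min l m \<and> min (max k l) m = min k l \<and> min k (max l m) = min k l"
      "k \<in> {1..3}" "l \<in> {1..3}" "m \<in> {1..3}"
      "u \<in> cells (free_precat P) k" "v \<in> cells (free_precat P) l" "w \<in> cells (free_precat P) m"
    for k l m u v w
  proof -
    from *[OF that(2,5)] *[OF that(3,6)] *[OF that(4,7)] that(1) show ?thesis
      by (elim disjE conjE exE; hypsubst; simp)
  qed
  have distrib: "free_comp u (free_comp v w) = free_comp (free_comp u v) (free_comp u w) \<and>
      free_comp (free_comp v w) u = free_comp (free_comp v u) (free_comp w u)"
    if "i + 1 < min k l" "i + 1 \<in> {1..3}" "k \<in> {1..3}" "l \<in> {1..3}"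
      "u \<in> cells (free_precat P) (i + 1)" "v \<in> cells (free_precat P) k" "w \<in> cells (free_precat P) l"
    for i k l u v w
    using *[OF that(2,5)] *[OF that(3,6)] *[OF that(4,7)] that(1)
    by (elim disjE conjE exE; simp)
  show ?thesis
    unfolding precategory_def nat_cases3 composable_free
    apply (intro conjI allI)
    subgoal by (auto simp: less3)
    subgoal by (auto simp: less2)
    subgoal by (auto simp: less3)
    subgoal by auto
    subgoal by (auto simp: less3)
    subgoal by auto
    subgoal by (auto simp: less2 less3 le3)
    subgoal by (auto simp: less2 less3)
    subgoal by (auto simp: less2 less3)
    subgoal for k l m u v w
      apply (intro impI, elim conjE)
      apply (unfold free_precat_simps)
      apply (rule assoc[of k l m])
            apply (intro conjI; assumption)
           apply (assumption | unfold nat_cases3, assumption)+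
      done
    subgoal for i k l u v w
      apply (intro impI, elim conjE)
      apply (unfold free_precat_simps)
      apply (rule distrib[of i k l, THEN conjunct1])
            apply (assumption | unfold nat_cases3, assumption)+
      done
    subgoal for i k l u v w
      apply (intro impI, elim conjE)
      apply (unfold free_precat_simps)
      apply (rule distrib[of i k l, THEN conjunct2])
            apply (assumption | unfold nat_cases3, assumption)+
      done
    done
qed

end

declare gen2_cells [simp del] cod1_cells[simp del] cod2_cells[simp del] comp12_cells [simp del]
  comp21_cells[simp del] comp12_id1[simp del] gen3_cells[simp del] cod3_cells[simp del] comp13_cells[simp del]
  comp31_cells[simp del] comp23_cells[simp del] comp32_cells[simp del] comp13_id1[simp del] comp23_id2[simp del]


subsection \<open>The free precategory is free\<close>

locale precat_target =
  fixes D :: "('d, 'y) precat_scheme" and n :: nat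
  assumes D: "precategory n D"
begin

lemmas D_rules = D[unfolded precategory_def]

lemmas D_bdry = D_rules[THEN conjunct1, rule_format]
lemmas D_glob = D_rules[THEN conjunct2, THEN conjunct1, rule_format]
lemmas D_idt = D_rules[THEN conjunct2, THEN conjunct2, THEN conjunct1, rule_format]
lemmas D_comp = D_rules[THEN conjunct2, THEN conjunct2, THEN conjunct2, THEN conjunct1, rule_format]
lemmas D_bdry_idt = D_rules[THEN conjunct2, THEN conjunct2, THEN conjunct2, THEN conjunct2, THEN conjunct1, rule_format]
lemmas D_bdry_comp = D_rules[THEN conjunct2, THEN conjunct2, THEN conjunct2, THEN conjunct2, THEN conjunct2, THEN conjunct1, rule_format]
lemmas D_idlr = D_rules[THEN conjunct2, THEN conjunct2, THEN conjunct2, THEN conjunct2, THEN conjunct2, THEN conjunct2, THEN conjunct1, rule_format]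
lemmas D_comp_idl = D_rules[THEN conjunct2, THEN conjunct2, THEN conjunct2, THEN conjunct2, THEN conjunct2, THEN conjunct2, THEN conjunct2, THEN conjunct1, rule_format]
lemmas D_comp_idr = D_rules[THEN conjunct2, THEN conjunct2, THEN conjunct2, THEN conjunct2, THEN conjunct2, THEN conjunct2, THEN conjunct2, THEN conjunct2, THEN conjunct1, rule_format]
lemmas D_assoc = D_rules[THEN conjunct2, THEN conjunct2, THEN conjunct2, THEN conjunct2, THEN conjunct2, THEN conjunct2, THEN conjunct2, THEN conjunct2, THEN conjunct2, THEN conjunct1, rule_format]
lemmas D_distl = D_rules[THEN conjunct2, THEN conjunct2, THEN conjunct2, THEN conjunct2, THEN conjunct2, THEN conjunct2, THEN conjunct2, THEN conjunct2, THEN conjunct2, THEN conjunct2, THEN conjunct1, rule_format]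
lemmas D_distr = D_rules[THEN conjunct2, THEN conjunct2, THEN conjunct2, THEN conjunct2, THEN conjunct2, THEN conjunct2, THEN conjunct2, THEN conjunct2, THEN conjunct2, THEN conjunct2, THEN conjunct2, rule_format]

lemma ibdry_simps:
  "ibdry C e i (Suc 0) u = (if i \<le> 0 then bdry C e 0 u else u)"
  "ibdry C e i 2 u = (if i \<le> 1 then ibdry C e i 1 (bdry C e 1 u) else u)"
  "ibdry C e i 3 u = (if i \<le> 2 then ibdry C e i 2 (bdry C e 2 u) else u)"
  by (simp_all add: numeral_2_eq_2 numeral_3_eq_3)

lemmas nums = numeral_2_eq_2[symmetric] numeral_3_eq_3[symmetric]

lemma D1 [simp]: "1 \<le> n \<Longrightarrow> u \<in> cells D (Suc 0) \<Longrightarrow> bdry D e 0 u \<in> cells D 0"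
  "1 \<le> n \<Longrightarrow> x \<in> cells D 0 \<Longrightarrow> idt D 0 x \<in> cells D (Suc 0)"
  "1 \<le> n \<Longrightarrow> x \<in> cells D 0 \<Longrightarrow> bdry D e 0 (idt D 0 x) = x"
  using D_bdry[of 0 u e] D_idt[of 0 x] D_bdry_idt[of 0 x e] by simp_all

lemma D2 [simp]: "2 \<le> n \<Longrightarrow> u \<in> cells D 2 \<Longrightarrow> bdry D e (Suc 0) u \<in> cells D (Suc 0)"
  "2 \<le> n \<Longrightarrow> u \<in> cells D 2 \<Longrightarrow> bdry D e 0 (bdry D Pos (Suc 0) u) = bdry D e 0 (bdry D Neg (Suc 0) u)"
  "2 \<le> n \<Longrightarrow> x \<in> cells D (Suc 0) \<Longrightarrow> idt D (Suc 0) x \<in> cells D 2"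
  "2 \<le> n \<Longrightarrow> x \<in> cells D (Suc 0) \<Longrightarrow> bdry D e (Suc 0) (idt D (Suc 0) x) = x"
  using D_bdry[of 1 u e] D_idt[of 1 x] D_bdry_idt[of 1 x e] D_glob[of 0 u e] by (simp_all add: nums)

lemma D3 [simp]: "3 \<le> n \<Longrightarrow> u \<in> cells D 3 \<Longrightarrow> bdry D e 2 u \<in> cells D 2"
  "3 \<le> n \<Longrightarrow> u \<in> cells D 3 \<Longrightarrow> bdry D e (Suc 0) (bdry D Pos 2 u) = bdry D e (Suc 0) (bdry D Neg 2 u)"
  "3 \<le> n \<Longrightarrow> x \<in> cells D 2 \<Longrightarrow> idt D 2 x \<in> cells D 3"
  "3 \<le> n \<Longrightarrow> x \<in> cells D 2 \<Longrightarrow> bdry D e 2 (idt D 2 x) = x"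
  using D_bdry[of 2 u e] D_idt[of 2 x] D_bdry_idt[of 2 x e] D_glob[of 1 u e] by (simp_all add: nums)

abbreviation S0 where "S0 \<equiv> bdry D Neg 0"
abbreviation T0 where "T0 \<equiv> bdry D Pos 0"
abbreviation S1 where "S1 \<equiv> bdry D Neg (Suc 0)"
abbreviation T1 where "T1 \<equiv> bdry D Pos (Suc 0)"
abbreviation S2 where "S2 \<equiv> bdry D Neg 2"
abbreviation T2 where "T2 \<equiv> bdry D Pos 2"
abbreviation d11 where "d11 \<equiv> comp D (Suc 0) (Suc 0)"
abbreviation d12 where "d12 \<equiv> comp D (Suc 0) 2"
abbreviation d21 where "d21 \<equiv> comp D 2 (Suc 0)"
abbreviation d22 where "d22 \<equiv> comp D 2 2"
abbreviation d13 where "d13 \<equiv> comp D (Suc 0) 3"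
abbreviation d31 where "d31 \<equiv> comp D 3 (Suc 0)"
abbreviation d23 where "d23 \<equiv> comp D 2 3"
abbreviation d32 where "d32 \<equiv> comp D 3 2"
abbreviation d33 where "d33 \<equiv> comp D 3 3"

lemma composable_D:
  "composable n D (Suc 0) (Suc 0) u v \<longleftrightarrow> 1 \<le> n \<and> u \<in> cells D (Suc 0) \<and> v \<in> cells D (Suc 0) \<and> T0 u = S0 v"
  "composable n D (Suc 0) 2 u v \<longleftrightarrow> 2 \<le> n \<and> u \<in> cells D (Suc 0) \<and> v \<in> cells D 2 \<and> T0 u = S0 (S1 v)"
  "composable n D 2 (Suc 0) u v \<longleftrightarrow> 2 \<le> n \<and> u \<in> cells D 2 \<and> v \<in> cells D (Suc 0) \<and> T0 (S1 u) = S0 v"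
  "composable n D 2 2 u v \<longleftrightarrow> 2 \<le> n \<and> u \<in> cells D 2 \<and> v \<in> cells D 2 \<and> T1 u = S1 v"
  "composable n D (Suc 0) 3 u v \<longleftrightarrow> 3 \<le> n \<and> u \<in> cells D (Suc 0) \<and> v \<in> cells D 3 \<and> T0 u = S0 (S1 (S2 v))"
  "composable n D 3 (Suc 0) u v \<longleftrightarrow> 3 \<le> n \<and> u \<in> cells D 3 \<and> v \<in> cells D (Suc 0) \<and> T0 (S1 (S2 u)) = S0 v"
  "composable n D 2 3 u v \<longleftrightarrow> 3 \<le> n \<and> u \<in> cells D 2 \<and> v \<in> cells D 3 \<and> T1 u = S1 (S2 v)"
  "composable n D 3 2 u v \<longleftrightarrow> 3 \<le> n \<and> u \<in> cells D 3 \<and> v \<in> cells D 2 \<and> T1 (S2 u) = S1 v"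
  "composable n D 3 3 u v \<longleftrightarrow> 3 \<le> n \<and> u \<in> cells D 3 \<and> v \<in> cells D 3 \<and> T2 u = S2 v"
  by (auto simp: composable_def ibdry_simps)

lemma comp_D11 [simp]:
  assumes "1 \<le> n" "u \<in> cells D (Suc 0)" "v \<in> cells D (Suc 0)" "T0 u = S0 v"
  shows "d11 u v \<in> cells D (Suc 0)" "S0 (d11 u v) = S0 u" "T0 (d11 u v) = T0 v"
  using D_comp[of 1 1 u v] D_bdry_comp[of 1 1 u v Neg] D_bdry_comp[of 1 1 u v Pos] assms by (simp_all add: composable_D nums)

lemma comp_D12 [simp]:
  assumes "2 \<le> n" "u \<in> cells D (Suc 0)" "w \<in> cells D 2" "T0 u = S0 (S1 w)"
  shows "d12 u w \<in> cells D 2" "bdry D e (Suc 0) (d12 u w) = d11 u (bdry D e (Suc 0) w)"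
  using D_comp[of 1 2 u w] D_bdry_comp[of 1 2 u w e] assms by (simp_all add: composable_D nums)

lemma comp_D21 [simp]:
  assumes "2 \<le> n" "u \<in> cells D (Suc 0)" "w \<in> cells D 2" "T0 (S1 w) = S0 u"
  shows "d21 w u \<in> cells D 2" "bdry D e (Suc 0) (d21 w u) = d11 (bdry D e (Suc 0) w) u"
  using D_comp[of 2 1 w u] D_bdry_comp[of 2 1 w u e] assms by (simp_all add: composable_D nums)

lemma comp_D22 [simp]:
  assumes "2 \<le> n" "w \<in> cells D 2" "z \<in> cells D 2" "T1 w = S1 z"
  shows "d22 w z \<in> cells D 2" "S1 (d22 w z) = S1 w" "T1 (d22 w z) = T1 z"
  using D_comp[of 2 2 w z] D_bdry_comp[of 2 2 w z Neg] D_bdry_comp[of 2 2 w z Pos] assms by (simp_all add: composable_D nums)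

lemma comp_D13 [simp]:
  assumes "3 \<le> n" "u \<in> cells D (Suc 0)" "a \<in> cells D 3" "T0 u = S0 (S1 (S2 a))"
  shows "d13 u a \<in> cells D 3" "bdry D e 2 (d13 u a) = d12 u (bdry D e 2 a)"
  using D_comp[of 1 3 u a] D_bdry_comp[of 1 3 u a e] assms by (simp_all add: composable_D nums)

lemma comp_D31 [simp]:
  assumes "3 \<le> n" "u \<in> cells D (Suc 0)" "a \<in> cells D 3" "T0 (S1 (S2 a)) = S0 u"
  shows "d31 a u \<in> cells D 3" "bdry D e 2 (d31 a u) = d21 (bdry D e 2 a) u"
  using D_comp[of 3 1 a u] D_bdry_comp[of 3 1 a u e] assms by (simp_all add: composable_D nums)

lemma comp_D23 [simp]:
  assumes "3 \<le> n" "w \<in> cells D 2" "a \<in> cells D 3" "T1 w = S1 (S2 a)"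
  shows "d23 w a \<in> cells D 3" "bdry D e 2 (d23 w a) = d22 w (bdry D e 2 a)"
  using D_comp[of 2 3 w a] D_bdry_comp[of 2 3 w a e] assms by (simp_all add: composable_D nums)

lemma comp_D32 [simp]:
  assumes "3 \<le> n" "w \<in> cells D 2" "a \<in> cells D 3" "T1 (S2 a) = S1 w"
  shows "d32 a w \<in> cells D 3" "bdry D e 2 (d32 a w) = d22 (bdry D e 2 a) w"
  using D_comp[of 3 2 a w] D_bdry_comp[of 3 2 a w e] assms by (simp_all add: composable_D nums)

lemma comp_D33 [simp]:
  assumes "3 \<le> n" "a \<in> cells D 3" "b \<in> cells D 3" "T2 a = S2 b"
  shows "d33 a b \<in> cells D 3" "S2 (d33 a b) = S2 a" "T2 (d33 a b) = T2 b"
  using D_comp[of 3 3 a b] D_bdry_comp[of 3 3 a b Neg] D_bdry_comp[of 3 3 a b Pos] assms by (simp_all add: composable_D nums)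

lemma assoc_D111 [simp]:
  assumes "1 \<le> n" "u \<in> cells D (Suc 0)" "v \<in> cells D (Suc 0)" "w \<in> cells D (Suc 0)" "T0 (u) = S0 (v)" "T0 (v) = S0 (w)"
  shows "d11 (d11 (u) (v)) (w) = d11 (u) (d11 (v) (w))"
  using D_assoc[of 1 1 1 u v w] assms by (simp add: composable_D nums)

lemma assoc_D112 [simp]:
  assumes "2 \<le> n" "u \<in> cells D (Suc 0)" "v \<in> cells D (Suc 0)" "w \<in> cells D 2" "T0 (u) = S0 (v)" "T0 (v) = S0 (S1 (w))"
  shows "d12 (u) (d12 (v) (w)) = d12 (d11 (u) (v)) (w)"
  using D_assoc[of 1 1 2 u v w] assms by (simp add: composable_D nums)

lemma assoc_D211 [simp]:
  assumes "2 \<le> n" "u \<in> cells D 2" "v \<in> cells D (Suc 0)" "w \<in> cells D (Suc 0)" "T0 (S1 (u)) = S0 (v)" "T0 (v) = S0 (w)"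
  shows "d21 (d21 (u) (v)) (w) = d21 (u) (d11 (v) (w))"
  using D_assoc[of 2 1 1 u v w] assms by (simp add: composable_D nums)

lemma assoc_D121 [simp]:
  assumes "2 \<le> n" "u \<in> cells D (Suc 0)" "v \<in> cells D 2" "w \<in> cells D (Suc 0)" "T0 (u) = S0 (S1 (v))" "T0 (S1 (v)) = S0 (w)"
  shows "d12 (u) (d21 (v) (w)) = d21 (d12 (u) (v)) (w)"
  using D_assoc[of 1 2 1 u v w] assms by (simp add: composable_D nums)

lemma assoc_D222 [simp]:
  assumes "2 \<le> n" "u \<in> cells D 2" "v \<in> cells D 2" "w \<in> cells D 2" "T1 (u) = S1 (v)" "T1 (v) = S1 (w)"
  shows "d22 (d22 (u) (v)) (w) = d22 (u) (d22 (v) (w))"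
  using D_assoc[of 2 2 2 u v w] assms by (simp add: composable_D nums)

lemma assoc_D113 [simp]:
  assumes "3 \<le> n" "u \<in> cells D (Suc 0)" "v \<in> cells D (Suc 0)" "w \<in> cells D 3" "T0 (u) = S0 (v)" "T0 (v) = S0 (S1 (S2 (w)))"
  shows "d13 (u) (d13 (v) (w)) = d13 (d11 (u) (v)) (w)"
  using D_assoc[of 1 1 3 u v w] assms by (simp add: composable_D nums)

lemma assoc_D311 [simp]:
  assumes "3 \<le> n" "u \<in> cells D 3" "v \<in> cells D (Suc 0)" "w \<in> cells D (Suc 0)" "T0 (S1 (S2 (u))) = S0 (v)" "T0 (v) = S0 (w)"
  shows "d31 (d31 (u) (v)) (w) = d31 (u) (d11 (v) (w))"
  using D_assoc[of 3 1 1 u v w] assms by (simp add: composable_D nums)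

lemma assoc_D131 [simp]:
  assumes "3 \<le> n" "u \<in> cells D (Suc 0)" "v \<in> cells D 3" "w \<in> cells D (Suc 0)" "T0 (u) = S0 (S1 (S2 (v)))" "T0 (S1 (S2 (v))) = S0 (w)"
  shows "d13 (u) (d31 (v) (w)) = d31 (d13 (u) (v)) (w)"
  using D_assoc[of 1 3 1 u v w] assms by (simp add: composable_D nums)

lemma assoc_D223 [simp]:
  assumes "3 \<le> n" "u \<in> cells D 2" "v \<in> cells D 2" "w \<in> cells D 3" "T1 (u) = S1 (v)" "T1 (v) = S1 (S2 (w))"
  shows "d23 (u) (d23 (v) (w)) = d23 (d22 (u) (v)) (w)"
  using D_assoc[of 2 2 3 u v w] assms by (simp add: composable_D nums)

lemma assoc_D322 [simp]:
  assumes "3 \<le> n" "u \<in> cells D 3" "v \<in> cells D 2" "w \<in> cells D 2" "T1 (S2 (u)) = S1 (v)" "T1 (v) = S1 (w)"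
  shows "d32 (d32 (u) (v)) (w) = d32 (u) (d22 (v) (w))"
  using D_assoc[of 3 2 2 u v w] assms by (simp add: composable_D nums)

lemma assoc_D232 [simp]:
  assumes "3 \<le> n" "u \<in> cells D 2" "v \<in> cells D 3" "w \<in> cells D 2" "T1 (u) = S1 (S2 (v))" "T1 (S2 (v)) = S1 (w)"
  shows "d23 (u) (d32 (v) (w)) = d32 (d23 (u) (v)) (w)"
  using D_assoc[of 2 3 2 u v w] assms by (simp add: composable_D nums)

lemma assoc_D333 [simp]:
  assumes "3 \<le> n" "u \<in> cells D 3" "v \<in> cells D 3" "w \<in> cells D 3" "T2 (u) = S2 (v)" "T2 (v) = S2 (w)"
  shows "d33 (d33 (u) (v)) (w) = d33 (u) (d33 (v) (w))"
  using D_assoc[of 3 3 3 u v w] assms by (simp add: composable_D nums)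

lemma distl_D122 [simp]:
  assumes "2 \<le> n" "u \<in> cells D (Suc 0)" "v \<in> cells D 2" "w \<in> cells D 2" "T1 (v) = S1 (w)" "T0 (u) = S0 (S1 (v))"
  shows "d12 (u) (d22 (v) (w)) = d22 (d12 (u) (v)) (d12 (u) (w))"
  using D_distl[of 0 2 2 v w u] assms by (simp add: composable_D nums)

lemma distr_D122 [simp]:
  assumes "2 \<le> n" "u \<in> cells D (Suc 0)" "v \<in> cells D 2" "w \<in> cells D 2" "T1 (v) = S1 (w)" "T0 (S1 (v)) = S0 (u)"
  shows "d21 (d22 (v) (w)) (u) = d22 (d21 (v) (u)) (d21 (w) (u))"
  using D_distr[of 0 2 2 v w u] assms by (simp add: composable_D nums)

lemma distl_D123 [simp]:
  assumes "3 \<le> n" "u \<in> cells D (Suc 0)" "v \<in> cells D 2" "w \<in> cells D 3" "T1 (v) = S1 (S2 (w))" "T0 (u) = S0 (S1 (v))"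
  shows "d13 (u) (d23 (v) (w)) = d23 (d12 (u) (v)) (d13 (u) (w))"
  using D_distl[of 0 2 3 v w u] assms by (simp add: composable_D nums)

lemma distr_D123 [simp]:
  assumes "3 \<le> n" "u \<in> cells D (Suc 0)" "v \<in> cells D 2" "w \<in> cells D 3" "T1 (v) = S1 (S2 (w))" "T0 (S1 (v)) = S0 (u)"
  shows "d31 (d23 (v) (w)) (u) = d23 (d21 (v) (u)) (d31 (w) (u))"
  using D_distr[of 0 2 3 v w u] assms by (simp add: composable_D nums)

lemma distl_D132 [simp]:
  assumes "3 \<le> n" "u \<in> cells D (Suc 0)" "v \<in> cells D 3" "w \<in> cells D 2" "T1 (S2 (v)) = S1 (w)" "T0 (u) = S0 (S1 (S2 (v)))"
  shows "d13 (u) (d32 (v) (w)) = d32 (d13 (u) (v)) (d12 (u) (w))"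
  using D_distl[of 0 3 2 v w u] assms by (simp add: composable_D nums)

lemma distr_D132 [simp]:
  assumes "3 \<le> n" "u \<in> cells D (Suc 0)" "v \<in> cells D 3" "w \<in> cells D 2" "T1 (S2 (v)) = S1 (w)" "T0 (S1 (S2 (v))) = S0 (u)"
  shows "d31 (d32 (v) (w)) (u) = d32 (d31 (v) (u)) (d21 (w) (u))"
  using D_distr[of 0 3 2 v w u] assms by (simp add: composable_D nums)

lemma distl_D133 [simp]:
  assumes "3 \<le> n" "u \<in> cells D (Suc 0)" "v \<in> cells D 3" "w \<in> cells D 3" "T2 (v) = S2 (w)" "T0 (u) = S0 (S1 (S2 (v)))"
  shows "d13 (u) (d33 (v) (w)) = d33 (d13 (u) (v)) (d13 (u) (w))"
  using D_distl[of 0 3 3 v w u] assms by (simp add: composable_D nums)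

lemma distr_D133 [simp]:
  assumes "3 \<le> n" "u \<in> cells D (Suc 0)" "v \<in> cells D 3" "w \<in> cells D 3" "T2 (v) = S2 (w)" "T0 (S1 (S2 (v))) = S0 (u)"
  shows "d31 (d33 (v) (w)) (u) = d33 (d31 (v) (u)) (d31 (w) (u))"
  using D_distr[of 0 3 3 v w u] assms by (simp add: composable_D nums)

lemma distl_D233 [simp]:
  assumes "3 \<le> n" "u \<in> cells D 2" "v \<in> cells D 3" "w \<in> cells D 3" "T2 (v) = S2 (w)" "T1 (u) = S1 (S2 (v))"
  shows "d23 (u) (d33 (v) (w)) = d33 (d23 (u) (v)) (d23 (u) (w))"
  using D_distl[of 1 3 3 v w u] assms by (simp add: composable_D nums)

lemma distr_D233 [simp]:
  assumes "3 \<le> n" "u \<in> cells D 2" "v \<in> cells D 3" "w \<in> cells D 3" "T2 (v) = S2 (w)" "T1 (S2 (v)) = S1 (u)"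
  shows "d32 (d33 (v) (w)) (u) = d33 (d32 (v) (u)) (d32 (w) (u))"
  using D_distr[of 1 3 3 v w u] assms by (simp add: composable_D nums)

lemma idl_D01 [simp]:
  assumes "1 \<le> n" "u \<in> cells D (Suc 0)" "S0 (u) = x"
  shows "d11 (idt D 0 x) (u) = u"
  using D_idlr[of 0 1 u] assms by (simp add: ibdry_simps nums)

lemma idr_D01 [simp]:
  assumes "1 \<le> n" "u \<in> cells D (Suc 0)" "T0 (u) = x"
  shows "d11 (u) (idt D 0 x) = u"
  using D_idlr[of 0 1 u] assms by (simp add: ibdry_simps nums)

lemma idl_D02 [simp]:
  assumes "2 \<le> n" "u \<in> cells D 2" "S0 (S1 (u)) = x"
  shows "d12 (idt D 0 x) (u) = u"
  using D_idlr[of 0 2 u] assms by (simp add: ibdry_simps nums)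

lemma idr_D02 [simp]:
  assumes "2 \<le> n" "u \<in> cells D 2" "T0 (S1 (u)) = x"
  shows "d21 (u) (idt D 0 x) = u"
  using D_idlr[of 0 2 u] assms by (simp add: ibdry_simps nums)

lemma idl_D03 [simp]:
  assumes "3 \<le> n" "u \<in> cells D 3" "S0 (S1 (S2 (u))) = x"
  shows "d13 (idt D 0 x) (u) = u"
  using D_idlr[of 0 3 u] assms by (simp add: ibdry_simps nums)

lemma idr_D03 [simp]:
  assumes "3 \<le> n" "u \<in> cells D 3" "T0 (S1 (S2 (u))) = x"
  shows "d31 (u) (idt D 0 x) = u"
  using D_idlr[of 0 3 u] assms by (simp add: ibdry_simps nums)

lemma idl_D12 [simp]:
  assumes "2 \<le> n" "u \<in> cells D 2" "S1 (u) = x"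
  shows "d22 (idt D (Suc 0) x) (u) = u"
  using D_idlr[of 1 2 u] assms by (simp add: ibdry_simps nums)

lemma idr_D12 [simp]:
  assumes "2 \<le> n" "u \<in> cells D 2" "T1 (u) = x"
  shows "d22 (u) (idt D (Suc 0) x) = u"
  using D_idlr[of 1 2 u] assms by (simp add: ibdry_simps nums)

lemma idl_D13 [simp]:
  assumes "3 \<le> n" "u \<in> cells D 3" "S1 (S2 (u)) = x"
  shows "d23 (idt D (Suc 0) x) (u) = u"
  using D_idlr[of 1 3 u] assms by (simp add: ibdry_simps nums)

lemma idr_D13 [simp]:
  assumes "3 \<le> n" "u \<in> cells D 3" "T1 (S2 (u)) = x"
  shows "d32 (u) (idt D (Suc 0) x) = u"
  using D_idlr[of 1 3 u] assms by (simp add: ibdry_simps nums)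

lemma idl_D23 [simp]:
  assumes "3 \<le> n" "u \<in> cells D 3" "S2 (u) = x"
  shows "d33 (idt D 2 x) (u) = u"
  using D_idlr[of 2 3 u] assms by (simp add: ibdry_simps nums)

lemma idr_D23 [simp]:
  assumes "3 \<le> n" "u \<in> cells D 3" "T2 (u) = x"
  shows "d33 (u) (idt D 2 x) = u"
  using D_idlr[of 2 3 u] assms by (simp add: ibdry_simps nums)

lemma comp_id_D01 [simp]:
  assumes "2 \<le> n" "u \<in> cells D (Suc 0)" "v \<in> cells D (Suc 0)"
  shows "T0 (u) = S0 (v) \<Longrightarrow> d21 (idt D (Suc 0) u) (v) = idt D (Suc 0) (d11 (u) (v))"
    "T0 (v) = S0 (u) \<Longrightarrow> d12 (v) (idt D (Suc 0) u) = idt D (Suc 0) (d11 (v) (u))"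
  using D_comp_idl[of 0 1 u v] D_comp_idr[of 0 1 v u] assms by (simp_all add: composable_D nums)

lemma comp_id_D02 [simp]:
  assumes "3 \<le> n" "u \<in> cells D 2" "v \<in> cells D (Suc 0)"
  shows "T0 (S1 (u)) = S0 (v) \<Longrightarrow> d31 (idt D 2 u) (v) = idt D 2 (d21 (u) (v))"
    "T0 (v) = S0 (S1 (u)) \<Longrightarrow> d13 (v) (idt D 2 u) = idt D 2 (d12 (v) (u))"
  using D_comp_idl[of 0 2 u v] D_comp_idr[of 0 2 v u] assms by (simp_all add: composable_D nums)

lemma comp_id_D12 [simp]:
  assumes "3 \<le> n" "u \<in> cells D 2" "v \<in> cells D 2"
  shows "T1 (u) = S1 (v) \<Longrightarrow> d32 (idt D 2 u) (v) = idt D 2 (d22 (u) (v))"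
    "T1 (v) = S1 (u) \<Longrightarrow> d23 (v) (idt D 2 u) = idt D 2 (d22 (v) (u))"
  using D_comp_idl[of 1 2 u v] D_comp_idr[of 1 2 v u] assms by (simp_all add: composable_D nums)

end

fun eval1 ::
  "('o, 'a, 'b, 'z) prepoly2_scheme \<Rightarrow> ('d, 'y) precat_scheme \<Rightarrow> ('o \<Rightarrow> 'd) \<Rightarrow> ('a \<Rightarrow> 'd) \<Rightarrow> 'o \<Rightarrow> 'a list \<Rightarrow> 'd"
where
  "eval1 P D F g x [] = idt D 0 (F x)"
| "eval1 P D F g x (a # as) = comp D 1 1 (g a) (eval1 P D F g (tgt1 P a) as)"

fun eval_wh2 :: "('d, 'y) precat_scheme \<Rightarrow> (('o, 'a) cell1 \<Rightarrow> 'd) \<Rightarrow> ('b \<Rightarrow> 'd) \<Rightarrow> ('o, 'a, 'b) wh2 \<Rightarrow> 'd" where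
  "eval_wh2 D F g (Wh2 l \<alpha> r) = comp D 2 1 (comp D 1 2 (F l) (g \<alpha>)) (F r)"

fun eval2 ::
  "('o, 'a, 'b, 'z) prepoly2_scheme \<Rightarrow> ('d, 'y) precat_scheme \<Rightarrow> (('o, 'a) cell1 \<Rightarrow> 'd) \<Rightarrow> ('b \<Rightarrow> 'd) \<Rightarrow>
   ('o, 'a) cell1 \<Rightarrow> ('o, 'a, 'b) wh2 list \<Rightarrow> 'd"
where
  "eval2 P D F g f [] = idt D 1 (F f)"
| "eval2 P D F g f (w # ws) = comp D 2 2 (eval_wh2 D F g w) (eval2 P D F g (wh2_tgt P w) ws)"

fun eval_wh3 :: "('d, 'y) precat_scheme \<Rightarrow> (('o, 'a) cell1 \<Rightarrow> 'd) \<Rightarrow> (('o, 'a, 'b) cell2 \<Rightarrow> 'd) \<Rightarrow> ('c \<Rightarrow> 'd) \<Rightarrow>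
   ('o, 'a, 'b, 'c) wh3 \<Rightarrow> 'd" where
  "eval_wh3 D F1 F2 g (Wh3 \<kappa> l A r \<rho>) =
     comp D 3 2 (comp D 2 3 (F2 \<kappa>) (comp D 3 1 (comp D 1 3 (F1 l) (g A)) (F1 r))) (F2 \<rho>)"

fun eval3 ::
  "('o, 'a, 'b, 'c, 'z) prepoly3_scheme \<Rightarrow> ('d, 'y) precat_scheme \<Rightarrow> (('o, 'a) cell1 \<Rightarrow> 'd) \<Rightarrow>
   (('o, 'a, 'b) cell2 \<Rightarrow> 'd) \<Rightarrow> ('c \<Rightarrow> 'd) \<Rightarrow> ('o, 'a, 'b) cell2 \<Rightarrow> ('o, 'a, 'b, 'c) wh3 list \<Rightarrow> 'd"
where
  "eval3 P D F1 F2 g \<phi> [] = idt D 2 (F2 \<phi>)"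
| "eval3 P D F1 F2 g \<phi> (w # ws) =
     comp D 3 3 (eval_wh3 D F1 F2 g w) (eval3 P D F1 F2 g (wh3_tgt P w) ws)"


lemma all_nat_simps:
  "(\<forall>k::nat. k \<le> Suc 0 \<longrightarrow> Q k) \<longleftrightarrow> Q 0 \<and> Q (Suc 0)"
  "(\<forall>k::nat. k \<le> 2 \<longrightarrow> Q k) \<longleftrightarrow> Q 0 \<and> Q (Suc 0) \<and> Q 2"
  "(\<forall>k::nat. k \<le> 3 \<longrightarrow> Q k) \<longleftrightarrow> Q 0 \<and> Q (Suc 0) \<and> Q 2 \<and> Q 3"
  "(\<forall>k::nat. k < Suc 0 \<longrightarrow> Q k) \<longleftrightarrow> Q 0"
  "(\<forall>k::nat. k < 2 \<longrightarrow> Q k) \<longleftrightarrow> Q 0 \<and> Q (Suc 0)"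
  "(\<forall>k::nat. k < 3 \<longrightarrow> Q k) \<longleftrightarrow> Q 0 \<and> Q (Suc 0) \<and> Q 2"
  by (auto simp: le_Suc_eq less_Suc_eq numeral_2_eq_2 numeral_3_eq_3)

lemma precat_morphism_alt:
  "precat_morphism n C D F \<longleftrightarrow>
     (\<forall>k. k \<le> n \<longrightarrow> (\<forall>u \<in> cells C k. F k u \<in> cells D k)) \<and>
     (\<forall>k. k < n \<longrightarrow> (\<forall>u \<in> cells C (k + 1). \<forall>e. F k (bdry C e k u) = bdry D e k (F (k + 1) u))) \<and>
     (\<forall>k. k < n \<longrightarrow> (\<forall>u \<in> cells C k. F (k + 1) (idt C k u) = idt D k (F k u))) \<and>
     (\<forall>k \<in> {1..n}. \<forall>l \<in> {1..n}. \<forall>u \<in> cells C k. \<forall>v \<in> cells C l. composable n C k l u v \<longrightarrow>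
        F (max k l) (comp C k l u v) = comp D k l (F k u) (F l v))"
  unfolding precat_morphism_def composable_def by auto

lemma atLeastAtMost_nums: "{Suc 0..2} = {Suc 0, 2}" "{Suc 0..3} = {Suc 0, 2, 3::nat}"
  by auto

lemma ball_image_pcell: "(\<forall>u \<in> f ` A. Q u) \<longleftrightarrow> (\<forall>x \<in> A. Q (f x))" by simp

lemma all_sign: "(\<forall>e. Q e) \<longleftrightarrow> Q Neg \<and> Q Pos"
  by (metis sign.exhaust)

locale extension_context = precat_target D n for D :: "('d, 'y) precat_scheme" and n +
  fixes P :: "('o, 'a, 'b, 'c, 'z) prepoly3_scheme" and F :: "nat \<Rightarrow> ('o, 'a, 'b, 'c) pcell \<Rightarrow> 'd"
  assumes P3: "prepolygraph3 P"
begin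

lemmas P2 = P2[OF P3]
lemmas [simp] = gen2_cells[OF P2] cod1_cells[OF P2] cod2_cells[OF P2] comp12_cells[OF P2]
  comp21_cells[OF P2] comp12_id1[OF P2] gen3_cells[OF P3] cod3_cells[OF P3] comp13_cells[OF P3]
  comp31_cells[OF P3] comp23_cells[OF P3] comp32_cells[OF P3] comp13_id1[OF P3] comp23_id2[OF P3]
  free_precat_simps[OF P3]

lemma composable_P:
  "composable (Suc 0) (free_precat P) (Suc 0) (Suc 0) (C1 f) (C1 f') \<longleftrightarrow> f \<in> cells1 P \<and> f' \<in> cells1 P \<and> cod1 P f = dom1 f'"
  by (auto simp: composable_def ibdry_simps)

lemma morphism1_iff:
  "precat_morphism 1 (free_precat P) D H \<longleftrightarrow>
    (\<forall>x \<in> gen0 P. H 0 (C0 x) \<in> cells D 0 \<and> H 1 (C1 (id1 x)) = idt D 0 (H 0 (C0 x))) \<and>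
    (\<forall>f \<in> cells1 P. H 1 (C1 f) \<in> cells D 1 \<and> bdry D Neg 0 (H 1 (C1 f)) = H 0 (C0 (dom1 f)) \<and>
       bdry D Pos 0 (H 1 (C1 f)) = H 0 (C0 (cod1 P f))) \<and>
    (\<forall>f \<in> cells1 P. \<forall>f' \<in> cells1 P. cod1 P f = dom1 f' \<longrightarrow> H 1 (C1 (f \<star>\<^sub>1\<^sub>1 f')) = comp D 1 1 (H 1 (C1 f)) (H 1 (C1 f')))"
  unfolding precat_morphism_alt
  by (auto simp: all_nat_simps ball_image_pcell all_sign composable_P)

lemma composable_P2:
  "composable 2 (free_precat P) (Suc 0) (Suc 0) (C1 f) (C1 f') \<longleftrightarrow> f \<in> cells1 P \<and> f' \<in> cells1 P \<and> cod1 P f = dom1 f'"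
  "composable 2 (free_precat P) (Suc 0) 2 (C1 f) (C2 \<phi>) \<longleftrightarrow> f \<in> cells1 P \<and> \<phi> \<in> cells2 P \<and> cod1 P f = dom1 (dom2 \<phi>)"
  "composable 2 (free_precat P) 2 (Suc 0) (C2 \<phi>) (C1 f) \<longleftrightarrow> \<phi> \<in> cells2 P \<and> f \<in> cells1 P \<and> cod1 P (dom2 \<phi>) = dom1 f"
  "composable 2 (free_precat P) 2 2 (C2 \<phi>) (C2 \<psi>) \<longleftrightarrow> \<phi> \<in> cells2 P \<and> \<psi> \<in> cells2 P \<and> cod2 P \<phi> = dom2 \<psi>"
  by (auto simp: composable_def ibdry_simps)

lemma morphism2_iff:
  "precat_morphism 2 (free_precat P) D H \<longleftrightarrow> precat_morphism 1 (free_precat P) D H \<and>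
    (\<forall>f \<in> cells1 P. H 2 (C2 (id2 f)) = idt D 1 (H 1 (C1 f))) \<and>
    (\<forall>\<phi> \<in> cells2 P. H 2 (C2 \<phi>) \<in> cells D 2 \<and> bdry D Neg 1 (H 2 (C2 \<phi>)) = H 1 (C1 (dom2 \<phi>)) \<and>
       bdry D Pos 1 (H 2 (C2 \<phi>)) = H 1 (C1 (cod2 P \<phi>))) \<and>
    (\<forall>f \<in> cells1 P. \<forall>\<phi> \<in> cells2 P. cod1 P f = dom1 (dom2 \<phi>) \<longrightarrow>
       H 2 (C2 (f \<star>\<^sub>1\<^sub>2 \<phi>)) = comp D 1 2 (H 1 (C1 f)) (H 2 (C2 \<phi>))) \<and>
    (\<forall>f \<in> cells1 P. \<forall>\<phi> \<in> cells2 P. cod1 P (dom2 \<phi>) = dom1 f \<longrightarrow>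
       H 2 (C2 (\<phi> \<star>\<^sub>2\<^sub>1 f)) = comp D 2 1 (H 2 (C2 \<phi>)) (H 1 (C1 f))) \<and>
    (\<forall>\<phi> \<in> cells2 P. \<forall>\<psi> \<in> cells2 P. cod2 P \<phi> = dom2 \<psi> \<longrightarrow>
       H 2 (C2 (\<phi> \<star>\<^sub>2\<^sub>2 \<psi>)) = comp D 2 2 (H 2 (C2 \<phi>)) (H 2 (C2 \<psi>)))"
  unfolding morphism1_iff
  unfolding precat_morphism_alt
  by (simp add: all_nat_simps ball_image_pcell all_sign composable_P2 atLeastAtMost_nums nums)
    (rule iffI; elim conjE; intro conjI ballI impI; simp)

lemma composable_P3:
  "composable 3 (free_precat P) (Suc 0) (Suc 0) (C1 f) (C1 f') \<longleftrightarrow> f \<in> cells1 P \<and> f' \<in> cells1 P \<and> cod1 P f = dom1 f'"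
  "composable 3 (free_precat P) (Suc 0) 2 (C1 f) (C2 \<phi>) \<longleftrightarrow> f \<in> cells1 P \<and> \<phi> \<in> cells2 P \<and> cod1 P f = dom1 (dom2 \<phi>)"
  "composable 3 (free_precat P) 2 (Suc 0) (C2 \<phi>) (C1 f) \<longleftrightarrow> \<phi> \<in> cells2 P \<and> f \<in> cells1 P \<and> cod1 P (dom2 \<phi>) = dom1 f"
  "composable 3 (free_precat P) 2 2 (C2 \<phi>) (C2 \<psi>) \<longleftrightarrow> \<phi> \<in> cells2 P \<and> \<psi> \<in> cells2 P \<and> cod2 P \<phi> = dom2 \<psi>"
  "composable 3 (free_precat P) (Suc 0) 3 (C1 f) (C3 A) \<longleftrightarrow> f \<in> cells1 P \<and> A \<in> cells3 P \<and> cod1 P f = dom1 (dom2 (dom3 A))"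
  "composable 3 (free_precat P) 3 (Suc 0) (C3 A) (C1 f) \<longleftrightarrow> A \<in> cells3 P \<and> f \<in> cells1 P \<and> cod1 P (dom2 (dom3 A)) = dom1 f"
  "composable 3 (free_precat P) 2 3 (C2 \<phi>) (C3 A) \<longleftrightarrow> \<phi> \<in> cells2 P \<and> A \<in> cells3 P \<and> cod2 P \<phi> = dom2 (dom3 A)"
  "composable 3 (free_precat P) 3 2 (C3 A) (C2 \<phi>) \<longleftrightarrow> A \<in> cells3 P \<and> \<phi> \<in> cells2 P \<and> cod2 P (dom3 A) = dom2 \<phi>"
  "composable 3 (free_precat P) 3 3 (C3 A) (C3 B) \<longleftrightarrow> A \<in> cells3 P \<and> B \<in> cells3 P \<and> cod3 P A = dom3 B"
  by (auto simp: composable_def ibdry_simps)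

lemma morphism3_iff:
  "precat_morphism 3 (free_precat P) D H \<longleftrightarrow> precat_morphism 2 (free_precat P) D H \<and>
    (\<forall>\<phi> \<in> cells2 P. H 3 (C3 (id3 \<phi>)) = idt D 2 (H 2 (C2 \<phi>))) \<and>
    (\<forall>A \<in> cells3 P. H 3 (C3 A) \<in> cells D 3 \<and> bdry D Neg 2 (H 3 (C3 A)) = H 2 (C2 (dom3 A)) \<and>
       bdry D Pos 2 (H 3 (C3 A)) = H 2 (C2 (cod3 P A))) \<and>
    (\<forall>f \<in> cells1 P. \<forall>A \<in> cells3 P. cod1 P f = dom1 (dom2 (dom3 A)) \<longrightarrow>
       H 3 (C3 (f \<star>\<^sub>1\<^sub>3 A)) = comp D 1 3 (H 1 (C1 f)) (H 3 (C3 A))) \<and>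
    (\<forall>f \<in> cells1 P. \<forall>A \<in> cells3 P. cod1 P (dom2 (dom3 A)) = dom1 f \<longrightarrow>
       H 3 (C3 (A \<star>\<^sub>3\<^sub>1 f)) = comp D 3 1 (H 3 (C3 A)) (H 1 (C1 f))) \<and>
    (\<forall>\<phi> \<in> cells2 P. \<forall>A \<in> cells3 P. cod2 P \<phi> = dom2 (dom3 A) \<longrightarrow>
       H 3 (C3 (\<phi> \<star>\<^sub>2\<^sub>3 A)) = comp D 2 3 (H 2 (C2 \<phi>)) (H 3 (C3 A))) \<and>
    (\<forall>\<phi> \<in> cells2 P. \<forall>A \<in> cells3 P. cod2 P (dom3 A) = dom2 \<phi> \<longrightarrow>
       H 3 (C3 (A \<star>\<^sub>3\<^sub>2 \<phi>)) = comp D 3 2 (H 3 (C3 A)) (H 2 (C2 \<phi>))) \<and>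
    (\<forall>A \<in> cells3 P. \<forall>B \<in> cells3 P. cod3 P A = dom3 B \<longrightarrow>
       H 3 (C3 (A \<star>\<^sub>3\<^sub>3 B)) = comp D 3 3 (H 3 (C3 A)) (H 3 (C3 B)))"
  unfolding morphism2_iff morphism1_iff
  unfolding precat_morphism_alt
  by (simp add: all_nat_simps ball_image_pcell all_sign composable_P3 atLeastAtMost_nums nums)
    (rule iffI; elim conjE; intro conjI ballI impI; simp)

end

locale extension_context1 = extension_context D n P F for D :: "('d, 'y) precat_scheme" and n
    and P :: "('o, 'a, 'b, 'c, 'z) prepoly3_scheme" and F +
  fixes g
  assumes n: "1 \<le> n"
    and F: "precat_morphism 0 (free_precat P) D F"
    and g: "\<And>a. a \<in> gen1 P \<Longrightarrow> g a \<in> cells D 1 \<and> bdry D Neg 0 (g a) = F 0 (C0 (src1 P a)) \<and>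
              bdry D Pos 0 (g a) = F 0 (C0 (tgt1 P a))"
begin

abbreviation "E1 \<equiv> eval1 P D (\<lambda>x. F 0 (C0 x)) g"

lemma F0 [simp]: "x \<in> gen0 P \<Longrightarrow> F 0 (C0 x) \<in> cells D 0"
  using F by (auto simp: precat_morphism_def)

lemma E1 [simp]:
  assumes "x \<in> gen0 P" "path1 P x as"
  shows "E1 x as \<in> cells D (Suc 0)" "S0 (E1 x as) = F 0 (C0 x)"
    "T0 (E1 x as) = F 0 (C0 (cod1 P (Cell1 x as)))"
proof -
  have "E1 x as \<in> cells D (Suc 0) \<and> S0 (E1 x as) = F 0 (C0 x) \<and>
    T0 (E1 x as) = F 0 (C0 (cod1 P (Cell1 x as)))"
    using assms
  proof (induction as arbitrary: x)
    case Nil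
    then show ?case using n by (simp add: cod1_def)
  next
    case (Cons a as)
    have a: "a \<in> gen1 P" "src1 P a = x" "path1 P (tgt1 P a) as" using Cons.prems by auto
    have e: "cod1 P (Cell1 x (a # as)) = cod1 P (Cell1 (tgt1 P a) as)" by (simp add: cod1_def)
    show ?case using Cons.IH[OF tgt1_gen0[OF P2 a(1)] a(3)] n a g[OF a(1)] unfolding e by simp
  qed
  then show "E1 x as \<in> cells D (Suc 0)" "S0 (E1 x as) = F 0 (C0 x)"
    "T0 (E1 x as) = F 0 (C0 (cod1 P (Cell1 x as)))" by auto
qed

lemma E1_append:
  assumes "x \<in> gen0 P" "path1 P x (as @ bs)"
  shows "E1 x (as @ bs) = d11 (E1 x as) (E1 (cod1 P (Cell1 x as)) bs)"
  using assms
proof (induction as arbitrary: x)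
  case Nil
  then show ?case using n by (simp add: cod1_def)
next
  case (Cons a as)
  have a: "a \<in> gen1 P" "src1 P a = x" "path1 P (tgt1 P a) (as @ bs)" using Cons.prems by auto
  have e: "cod1 P (Cell1 x (a # as)) = cod1 P (Cell1 (tgt1 P a) as)" by (simp add: cod1_def)
  note t = tgt1_gen0[OF P2 a(1)]
  have "cod1 P (Cell1 (tgt1 P a) as) \<in> gen0 P"
    using t a(3) by (intro cod1_cells[OF P2] cells1I) (simp_all add: path1_append)
  then show ?case using Cons.IH[OF t a(3)] n a g[OF a(1)] t unfolding e by (simp add: path1_append)
qed

theorem extension1:
  "\<exists>F'. precat_morphism 1 (free_precat P) D F' \<and> (\<forall>x \<in> gen0 P. F' 0 (C0 x) = F 0 (C0 x)) \<and>
     (\<forall>a \<in> gen1 P. F' 1 (C1 (gcell1 P a)) = g a)"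
proof -
  define F' where "F' = F(1 := \<lambda>u. case u of C1 f \<Rightarrow> E1 (dom1 f) (steps1 f) | _ \<Rightarrow> undefined)"
  have [simp]: "F' 0 = F 0" "F' (Suc 0) (C1 f) = E1 (dom1 f) (steps1 f)" for f
    by (simp_all add: F'_def)
  have "E1 (dom1 f) (steps1 f @ steps1 f') = d11 (E1 (dom1 f) (steps1 f)) (E1 (dom1 f') (steps1 f'))"
    if "f \<in> cells1 P" "f' \<in> cells1 P" "cod1 P f = dom1 f'" for f f'
    using E1_append[of "dom1 f" "steps1 f" "steps1 f'"] cells1_path[OF that(1)] cells1_path[OF that(2)]
      that by (simp add: path1_append)
  then have "precat_morphism 1 (free_precat P) D F'"
    unfolding morphism1_iff using n E1[OF dom1_cells cells1_path]
    by (simp add: id1_def comp11_def)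
  moreover have "F' 1 (C1 (gcell1 P a)) = g a" if "a \<in> gen1 P" for a
    using g[OF that] n tgt1_gen0[OF P2 that] by (simp add: gcell1_def)
  ultimately show ?thesis by (intro exI[of _ F']) simp
qed

theorem unique1:
  assumes "precat_morphism 1 (free_precat P) D F'" "\<forall>x \<in> gen0 P. F' 0 (C0 x) = F 0 (C0 x)"
    "\<forall>a \<in> gen1 P. F' 1 (C1 (gcell1 P a)) = g a" "f \<in> cells1 P"
  shows "F' 1 (C1 f) = E1 (dom1 f) (steps1 f)"
proof -
  have "F' 1 (C1 (Cell1 x as)) = E1 x as" if "x \<in> gen0 P" "path1 P x as" for x as
    using that
  proof (induction as arbitrary: x)
    case Nil
    then show ?case using assms(1,2) unfolding morphism1_iff by (simp add: id1_def)
  next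
    case (Cons a as)
    have a: "a \<in> gen1 P" "src1 P a = x" "path1 P (tgt1 P a) as" using Cons.prems by auto
    note t = tgt1_gen0[OF P2 a(1)]
    have e: "Cell1 x (a # as) = gcell1 P a \<star>\<^sub>1\<^sub>1 Cell1 (tgt1 P a) as"
      using a by (simp add: gcell1_def comp11_def)
    have "gcell1 P a \<in> cells1 P" "cod1 P (gcell1 P a) = tgt1 P a"
      using a Cons.prems(1) by (auto simp: gcell1_def cod1_def intro!: cells1I)
    then have "F' 1 (C1 (Cell1 x (a # as))) = d11 (F' 1 (C1 (gcell1 P a))) (F' 1 (C1 (Cell1 (tgt1 P a) as)))"
      using assms(1) cells1I[OF t a(3)] unfolding e morphism1_iff by simp
    then show ?case using Cons.IH[OF t a(3)] assms(3) a(1) by simp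
  qed
  from this[OF dom1_cells cells1_path] show ?thesis using assms(4) by (cases f) auto
qed

end


locale extension_context2 = extension_context D n P F for D :: "('d, 'y) precat_scheme" and n
    and P :: "('o, 'a, 'b, 'c, 'z) prepoly3_scheme" and F +
  fixes g
  assumes n [simp]: "2 \<le> n"
    and F: "precat_morphism 1 (free_precat P) D F"
    and g: "\<And>\<alpha>. \<alpha> \<in> gen2 P \<Longrightarrow> g \<alpha> \<in> cells D 2 \<and> bdry D Neg 1 (g \<alpha>) = F 1 (C1 (src2 P \<alpha>)) \<and>
              bdry D Pos 1 (g \<alpha>) = F 1 (C1 (tgt2 P \<alpha>))"
begin

lemma n1 [simp]: "Suc 0 \<le> n" using n by linarith

abbreviation "F1 f \<equiv> F (Suc 0) (C1 f)"
abbreviation "W \<equiv> eval_wh2 D F1 g"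
abbreviation "E2 \<equiv> eval2 P D F1 g"

lemma F1 [simp]: "f \<in> cells1 P \<Longrightarrow> F1 f \<in> cells D (Suc 0)" "f \<in> cells1 P \<Longrightarrow> S0 (F1 f) = F 0 (C0 (dom1 f))"
  "f \<in> cells1 P \<Longrightarrow> T0 (F1 f) = F 0 (C0 (cod1 P f))"
  "f \<in> cells1 P \<Longrightarrow> f' \<in> cells1 P \<Longrightarrow> cod1 P f = dom1 f' \<Longrightarrow> F1 (f \<star>\<^sub>1\<^sub>1 f') = d11 (F1 f) (F1 f')"
  "x \<in> gen0 P \<Longrightarrow> F1 (id1 x) = idt D 0 (F 0 (C0 x))"
  using F unfolding morphism1_iff by auto

lemma g' [simp]: "\<alpha> \<in> gen2 P \<Longrightarrow> g \<alpha> \<in> cells D 2" "\<alpha> \<in> gen2 P \<Longrightarrow> S1 (g \<alpha>) = F1 (src2 P \<alpha>)"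
  "\<alpha> \<in> gen2 P \<Longrightarrow> T1 (g \<alpha>) = F1 (tgt2 P \<alpha>)"
  using g by auto

lemma W [simp]:
  assumes "wh2_ok P w"
  shows "W w \<in> cells D 2" "S1 (W w) = F1 (wh2_src P w)" "T1 (W w) = F1 (wh2_tgt P w)"
  using assms by (cases w; simp)+

lemma W_map:
  assumes "wh2_ok P (Wh2 l \<alpha> r)" "f \<in> cells1 P"
  shows "cod1 P f = dom1 l \<Longrightarrow> W (Wh2 (f \<star>\<^sub>1\<^sub>1 l) \<alpha> r) = d12 (F1 f) (W (Wh2 l \<alpha> r))"
    "cod1 P r = dom1 f \<Longrightarrow> W (Wh2 l \<alpha> (r \<star>\<^sub>1\<^sub>1 f)) = d21 (W (Wh2 l \<alpha> r)) (F1 f)"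
  using assms by simp_all

lemma E2 [simp]:
  assumes "f \<in> cells1 P" "path2 P f ws"
  shows "E2 f ws \<in> cells D 2" "S1 (E2 f ws) = F1 f" "T1 (E2 f ws) = F1 (cod2 P (Cell2 f ws))"
proof -
  have "E2 f ws \<in> cells D 2 \<and> S1 (E2 f ws) = F1 f \<and> T1 (E2 f ws) = F1 (cod2 P (Cell2 f ws))"
    using assms
  proof (induction ws arbitrary: f)
    case Nil
    then show ?case by (simp add: cod2_def)
  next
    case (Cons w ws)
    have w: "wh2_ok P w" "wh2_src P w = f" "path2 P (wh2_tgt P w) ws" using Cons.prems by auto
    have e: "cod2 P (Cell2 f (w # ws)) = cod2 P (Cell2 (wh2_tgt P w) ws)" by (simp add: cod2_def)
    show ?case using Cons.IH[OF wh2_ok_bdry(2)[OF P2 w(1)] w(3)] w unfolding e by simp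
  qed
  then show "E2 f ws \<in> cells D 2" "S1 (E2 f ws) = F1 f" "T1 (E2 f ws) = F1 (cod2 P (Cell2 f ws))" by auto
qed

lemma E2_append:
  assumes "f \<in> cells1 P" "path2 P f (vs @ ws)"
  shows "E2 f (vs @ ws) = d22 (E2 f vs) (E2 (cod2 P (Cell2 f vs)) ws)"
  using assms
proof (induction vs arbitrary: f)
  case Nil
  then show ?case by (simp add: cod2_def)
next
  case (Cons w vs)
  have w: "wh2_ok P w" "wh2_src P w = f" "path2 P (wh2_tgt P w) vs"
    "path2 P (cod2 P (Cell2 (wh2_tgt P w) vs)) ws" using Cons.prems by (auto simp: path2_append cod2_def split: if_splits)
  have e: "cod2 P (Cell2 f (w # vs)) = cod2 P (Cell2 (wh2_tgt P w) vs)" by (simp add: cod2_def)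
  note t = wh2_ok_bdry(2)[OF P2 w(1)]
  have c: "cod2 P (Cell2 (wh2_tgt P w) vs) \<in> cells1 P"
    using t w(3) by (intro cod2_cells[OF P2] cells2I)
  have "E2 (wh2_tgt P w) (vs @ ws) = d22 (E2 (wh2_tgt P w) vs) (E2 (cod2 P (Cell2 (wh2_tgt P w) vs)) ws)"
    using Cons.IH[OF t] w by (simp add: path2_append)
  then show ?case using w t c unfolding e by simp
qed

lemma E2_comp12:
  assumes "f \<in> cells1 P" "h \<in> cells1 P" "cod1 P f = dom1 h" "path2 P h ws"
  shows "E2 (f \<star>\<^sub>1\<^sub>1 h) (map (\<lambda>w. case w of Wh2 l \<alpha> r \<Rightarrow> Wh2 (f \<star>\<^sub>1\<^sub>1 l) \<alpha> r) ws) = d12 (F1 f) (E2 h ws)"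
  using assms
proof (induction ws arbitrary: h)
  case (Cons w ws)
  obtain l \<alpha> r where ww: "w = Wh2 l \<alpha> r" by (cases w)
  have w: "wh2_ok P w" "wh2_src P w = h" "path2 P (wh2_tgt P w) ws" using Cons.prems by auto
  note t = wh2_ok_bdry[OF P2 w(1)]
  have l: "cod1 P f = dom1 l" using Cons.prems(3) w(2) ww by auto
  have ih: "E2 (f \<star>\<^sub>1\<^sub>1 wh2_tgt P w) (map (\<lambda>w. case w of Wh2 l \<alpha> r \<Rightarrow> Wh2 (f \<star>\<^sub>1\<^sub>1 l) \<alpha> r) ws) =
    d12 (F1 f) (E2 (wh2_tgt P w) ws)"
    using w t Cons.prems by (intro Cons.IH) simp_all
  have "E2 (f \<star>\<^sub>1\<^sub>1 h) (map (\<lambda>w. case w of Wh2 l \<alpha> r \<Rightarrow> Wh2 (f \<star>\<^sub>1\<^sub>1 l) \<alpha> r) (w # ws)) =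
     d22 (W (Wh2 (f \<star>\<^sub>1\<^sub>1 l) \<alpha> r)) (d12 (F1 f) (E2 (wh2_tgt P w) ws))"
    unfolding ih[symmetric] by (simp add: ww)
  also have "\<dots> = d22 (d12 (F1 f) (W w)) (d12 (F1 f) (E2 (wh2_tgt P w) ws))"
    using W_map(1)[of l \<alpha> r f] w(1) Cons.prems(1) l ww by simp
  also have "\<dots> = d12 (F1 f) (d22 (W w) (E2 (wh2_tgt P w) ws))"
    using w t Cons.prems by (intro distl_D122[symmetric]) simp_all
  finally show ?case by simp
qed simp

lemma E2_comp21:
  assumes "f \<in> cells1 P" "h \<in> cells1 P" "cod1 P h = dom1 f" "path2 P h ws"
  shows "E2 (h \<star>\<^sub>1\<^sub>1 f) (map (\<lambda>w. case w of Wh2 l \<alpha> r \<Rightarrow> Wh2 l \<alpha> (r \<star>\<^sub>1\<^sub>1 f)) ws) = d21 (E2 h ws) (F1 f)"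
  using assms
proof (induction ws arbitrary: h)
  case (Cons w ws)
  obtain l \<alpha> r where ww: "w = Wh2 l \<alpha> r" by (cases w)
  have w: "wh2_ok P w" "wh2_src P w = h" "path2 P (wh2_tgt P w) ws" using Cons.prems by auto
  note t = wh2_ok_bdry[OF P2 w(1)]
  have l: "cod1 P r = dom1 f" using Cons.prems(3) w(1,2) ww by auto
  have ih: "E2 (wh2_tgt P w \<star>\<^sub>1\<^sub>1 f) (map (\<lambda>w. case w of Wh2 l \<alpha> r \<Rightarrow> Wh2 l \<alpha> (r \<star>\<^sub>1\<^sub>1 f)) ws) =
    d21 (E2 (wh2_tgt P w) ws) (F1 f)"
    using w t Cons.prems by (intro Cons.IH) simp_all
  have "E2 (h \<star>\<^sub>1\<^sub>1 f) (map (\<lambda>w. case w of Wh2 l \<alpha> r \<Rightarrow> Wh2 l \<alpha> (r \<star>\<^sub>1\<^sub>1 f)) (w # ws)) =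
     d22 (W (Wh2 l \<alpha> (r \<star>\<^sub>1\<^sub>1 f))) (d21 (E2 (wh2_tgt P w) ws) (F1 f))"
    unfolding ih[symmetric] by (simp add: ww)
  also have "\<dots> = d22 (d21 (W w) (F1 f)) (d21 (E2 (wh2_tgt P w) ws) (F1 f))"
    using W_map(2)[of l \<alpha> r f] w(1) Cons.prems(1) l ww by simp
  also have "\<dots> = d21 (d22 (W w) (E2 (wh2_tgt P w) ws)) (F1 f)"
    using w t Cons.prems by (intro distr_D122[symmetric]) simp_all
  finally show ?case by simp
qed simp

theorem extension2:
  "\<exists>F'. precat_morphism 2 (free_precat P) D F' \<and>
     (\<forall>k < 2. \<forall>u \<in> cells (free_precat P) k. F' k u = F k u) \<and>
     (\<forall>\<alpha> \<in> gen2 P. F' 2 (C2 (gcell2 P \<alpha>)) = g \<alpha>)"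
proof -
  define F' where "F' = F(2 := \<lambda>u. case u of C2 \<phi> \<Rightarrow> E2 (dom2 \<phi>) (steps2 \<phi>) | _ \<Rightarrow> undefined)"
  have [simp]: "F' 0 = F 0" "F' (Suc 0) = F (Suc 0)" "F' 2 (C2 \<phi>) = E2 (dom2 \<phi>) (steps2 \<phi>)" for \<phi>
    by (simp_all add: F'_def)
  have a: "E2 (dom2 \<phi>) (steps2 \<phi> @ steps2 \<psi>) = d22 (E2 (dom2 \<phi>) (steps2 \<phi>)) (E2 (dom2 \<psi>) (steps2 \<psi>))"
    if "\<phi> \<in> cells2 P" "\<psi> \<in> cells2 P" "cod2 P \<phi> = dom2 \<psi>" for \<phi> \<psi>
    using E2_append[of "dom2 \<phi>" "steps2 \<phi>" "steps2 \<psi>"] cells2_path[OF that(1)] cells2_path[OF that(2)]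
      that by (simp add: path2_append)
  have "precat_morphism 1 (free_precat P) D F'"
    using F unfolding morphism1_iff by simp
  then have "precat_morphism 2 (free_precat P) D F'"
    unfolding morphism2_iff using E2[OF dom2_cells cells2_path] a
      E2_comp12[OF _ dom2_cells _ cells2_path] E2_comp21[OF _ dom2_cells _ cells2_path]
    by (simp add: id2_def comp12_def comp21_def comp22_def)
  moreover have "F' 2 (C2 (gcell2 P \<alpha>)) = g \<alpha>" if "\<alpha> \<in> gen2 P" for \<alpha>
    using that by (simp add: gcell2_def)
  ultimately show ?thesis by (intro exI[of _ F']) (simp add: F'_def)
qed

theorem unique2:
  assumes "precat_morphism 2 (free_precat P) D F'"
    "\<forall>k < 2. \<forall>u \<in> cells (free_precat P) k. F' k u = F k u"
    "\<forall>\<alpha> \<in> gen2 P. F' 2 (C2 (gcell2 P \<alpha>)) = g \<alpha>" "\<phi> \<in> cells2 P"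
  shows "F' 2 (C2 \<phi>) = E2 (dom2 \<phi>) (steps2 \<phi>)"
proof -
  have l: "F' (Suc 0) (C1 f) = F1 f" if "f \<in> cells1 P" for f
    using assms(2) that by (simp add: all_nat_simps)
  have "F' 2 (C2 (Cell2 f ws)) = E2 f ws" if "f \<in> cells1 P" "path2 P f ws" for f ws
    using that
  proof (induction ws arbitrary: f)
    case Nil
    then show ?case using assms(1) l unfolding morphism2_iff by (simp add: id2_def)
  next
    case (Cons w ws)
    obtain l' \<alpha> r where ww: "w = Wh2 l' \<alpha> r" by (cases w)
    have w: "wh2_ok P w" "wh2_src P w = f" "path2 P (wh2_tgt P w) ws" using Cons.prems by auto
    note t = wh2_ok_bdry(2)[OF P2 w(1)]
    have e: "Cell2 f (w # ws) = (l' \<star>\<^sub>1\<^sub>2 gcell2 P \<alpha> \<star>\<^sub>2\<^sub>1 r) \<star>\<^sub>2\<^sub>2 Cell2 (wh2_tgt P w) ws"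
      using w ww by (auto simp: gcell2_def comp22_def comp12_def comp21_def)
    have c: "gcell2 P \<alpha> \<in> cells2 P" "cod2 P (gcell2 P \<alpha>) = tgt2 P \<alpha>" "dom2 (gcell2 P \<alpha>) = src2 P \<alpha>"
      using w(1) ww by (auto simp: gcell2_def cod2_def intro!: cells2I)
    have "F' 2 (C2 (l' \<star>\<^sub>1\<^sub>2 gcell2 P \<alpha> \<star>\<^sub>2\<^sub>1 r)) = W w"
      using assms(1) l c w(1) ww assms(3) unfolding morphism2_iff by simp
    moreover have "F' 2 (C2 (Cell2 f (w # ws))) = d22 (F' 2 (C2 (l' \<star>\<^sub>1\<^sub>2 gcell2 P \<alpha> \<star>\<^sub>2\<^sub>1 r))) (F' 2 (C2 (Cell2 (wh2_tgt P w) ws)))"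
      using assms(1) cells2I[OF t w(3)] c w(1) ww unfolding e morphism2_iff by simp
    ultimately show ?case using Cons.IH[OF t w(3)] by simp
  qed
  from this[OF dom2_cells cells2_path] show ?thesis using assms(4) by (cases \<phi>) auto
qed

end

locale extension_context3 = extension_context D n P F for D :: "('d, 'y) precat_scheme" and n
    and P :: "('o, 'a, 'b, 'c, 'z) prepoly3_scheme" and F +
  fixes g
  assumes n [simp]: "3 \<le> n"
    and F: "precat_morphism 2 (free_precat P) D F"
    and g: "\<And>A. A \<in> gen3 P \<Longrightarrow> g A \<in> cells D 3 \<and> bdry D Neg 2 (g A) = F 2 (C2 (src3 P A)) \<and>
              bdry D Pos 2 (g A) = F 2 (C2 (tgt3 P A))"
begin

lemma n12 [simp]: "Suc 0 \<le> n" "2 \<le> n" using n by linarith+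

abbreviation "F1 f \<equiv> F (Suc 0) (C1 f)"
abbreviation "F2 \<phi> \<equiv> F 2 (C2 \<phi>)"
abbreviation "W \<equiv> eval_wh3 D F1 F2 g"
abbreviation "E3 \<equiv> eval3 P D F1 F2 g"

lemma F12 [simp]: "f \<in> cells1 P \<Longrightarrow> F1 f \<in> cells D (Suc 0)" "f \<in> cells1 P \<Longrightarrow> S0 (F1 f) = F 0 (C0 (dom1 f))"
  "f \<in> cells1 P \<Longrightarrow> T0 (F1 f) = F 0 (C0 (cod1 P f))"
  "f \<in> cells1 P \<Longrightarrow> f' \<in> cells1 P \<Longrightarrow> cod1 P f = dom1 f' \<Longrightarrow> F1 (f \<star>\<^sub>1\<^sub>1 f') = d11 (F1 f) (F1 f')"
  "x \<in> gen0 P \<Longrightarrow> F1 (id1 x) = idt D 0 (F 0 (C0 x))"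
  "\<phi> \<in> cells2 P \<Longrightarrow> F2 \<phi> \<in> cells D 2" "\<phi> \<in> cells2 P \<Longrightarrow> S1 (F2 \<phi>) = F1 (dom2 \<phi>)"
  "\<phi> \<in> cells2 P \<Longrightarrow> T1 (F2 \<phi>) = F1 (cod2 P \<phi>)"
  "f \<in> cells1 P \<Longrightarrow> F2 (id2 f) = idt D (Suc 0) (F1 f)"
  "f \<in> cells1 P \<Longrightarrow> \<phi> \<in> cells2 P \<Longrightarrow> cod1 P f = dom1 (dom2 \<phi>) \<Longrightarrow> F2 (f \<star>\<^sub>1\<^sub>2 \<phi>) = d12 (F1 f) (F2 \<phi>)"
  "f \<in> cells1 P \<Longrightarrow> \<phi> \<in> cells2 P \<Longrightarrow> cod1 P (dom2 \<phi>) = dom1 f \<Longrightarrow> F2 (\<phi> \<star>\<^sub>2\<^sub>1 f) = d21 (F2 \<phi>) (F1 f)"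
  "\<phi> \<in> cells2 P \<Longrightarrow> \<psi> \<in> cells2 P \<Longrightarrow> cod2 P \<phi> = dom2 \<psi> \<Longrightarrow> F2 (\<phi> \<star>\<^sub>2\<^sub>2 \<psi>) = d22 (F2 \<phi>) (F2 \<psi>)"
  using F unfolding morphism2_iff morphism1_iff by simp_all

lemma g' [simp]: "A \<in> gen3 P \<Longrightarrow> g A \<in> cells D 3" "A \<in> gen3 P \<Longrightarrow> S2 (g A) = F2 (src3 P A)"
  "A \<in> gen3 P \<Longrightarrow> T2 (g A) = F2 (tgt3 P A)"
  using g by auto

lemma W [simp]:
  assumes "wh3_ok P w"
  shows "W w \<in> cells D 3" "S2 (W w) = F2 (wh3_src P w)" "T2 (W w) = F2 (wh3_tgt P w)"
proof -
  obtain \<kappa> l A r \<rho> where w: "w = Wh3 \<kappa> l A r \<rho>" by (cases w)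
  have k: "\<kappa> \<in> cells2 P" "\<rho> \<in> cells2 P" "cod2 P \<kappa> = l \<star>\<^sub>1\<^sub>1 dom2 (src3 P A) \<star>\<^sub>1\<^sub>1 r" "l \<in> cells1 P" "r \<in> cells1 P" "A \<in> gen3 P"
    "dom2 \<rho> = l \<star>\<^sub>1\<^sub>1 cod2 P (src3 P A) \<star>\<^sub>1\<^sub>1 r" "cod1 P l = dom1 (dom2 (src3 P A))" "cod1 P (dom2 (src3 P A)) = dom1 r"
    using assms unfolding w by auto
  show "W w \<in> cells D 3" "S2 (W w) = F2 (wh3_src P w)" "T2 (W w) = F2 (wh3_tgt P w)"
    unfolding w using k by simp_all
qed

lemma E3 [simp]:
  assumes "\<phi> \<in> cells2 P" "path3 P \<phi> ws"
  shows "E3 \<phi> ws \<in> cells D 3" "S2 (E3 \<phi> ws) = F2 \<phi>" "T2 (E3 \<phi> ws) = F2 (cod3 P (Cell3 \<phi> ws))"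
proof -
  have "E3 \<phi> ws \<in> cells D 3 \<and> S2 (E3 \<phi> ws) = F2 \<phi> \<and> T2 (E3 \<phi> ws) = F2 (cod3 P (Cell3 \<phi> ws))"
    using assms
  proof (induction ws arbitrary: \<phi>)
    case Nil
    then show ?case by (simp add: cod3_def)
  next
    case (Cons w ws)
    have w: "wh3_ok P w" "wh3_src P w = \<phi>" "path3 P (wh3_tgt P w) ws" using Cons.prems by auto
    have e: "cod3 P (Cell3 \<phi> (w # ws)) = cod3 P (Cell3 (wh3_tgt P w) ws)" by (simp add: cod3_def)
    show ?case using Cons.IH[OF wh3_ok_bdry(2)[OF P3 w(1)] w(3)] w unfolding e by simp
  qed
  then show "E3 \<phi> ws \<in> cells D 3" "S2 (E3 \<phi> ws) = F2 \<phi>" "T2 (E3 \<phi> ws) = F2 (cod3 P (Cell3 \<phi> ws))" by auto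
qed

lemma E3_append:
  assumes "\<phi> \<in> cells2 P" "path3 P \<phi> (vs @ ws)"
  shows "E3 \<phi> (vs @ ws) = d33 (E3 \<phi> vs) (E3 (cod3 P (Cell3 \<phi> vs)) ws)"
  using assms
proof (induction vs arbitrary: \<phi>)
  case Nil
  then show ?case by (simp add: cod3_def)
next
  case (Cons w vs)
  have w: "wh3_ok P w" "wh3_src P w = \<phi>" "path3 P (wh3_tgt P w) vs"
    "path3 P (cod3 P (Cell3 (wh3_tgt P w) vs)) ws" using Cons.prems by (auto simp: path3_append cod3_def split: if_splits)
  have e: "cod3 P (Cell3 \<phi> (w # vs)) = cod3 P (Cell3 (wh3_tgt P w) vs)" by (simp add: cod3_def)
  note t = wh3_ok_bdry(2)[OF P3 w(1)]
  have c: "cod3 P (Cell3 (wh3_tgt P w) vs) \<in> cells2 P"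
    using t w(3) by (intro cod3_cells[OF P3] cells3I)
  have "E3 (wh3_tgt P w) (vs @ ws) = d33 (E3 (wh3_tgt P w) vs) (E3 (cod3 P (Cell3 (wh3_tgt P w) vs)) ws)"
    using Cons.IH[OF t] w by (simp add: path3_append)
  then show ?case using w t c unfolding e by simp
qed

lemma E3_map:
  assumes "path3 P \<phi> ws" "\<phi> \<in> cells2 P"
    and T: "\<And>w. wh3_ok P w \<Longrightarrow> dom2 (wh3_src P w) = dom2 \<phi> \<Longrightarrow> cod2 P (wh3_src P w) = cod2 P \<phi> \<Longrightarrow>
      wh3_tgt P (T w) = t (wh3_tgt P w) \<and> W (T w) = \<delta> (W w)"
    and \<delta>: "\<And>a b \<chi>. \<chi> \<in> cells2 P \<Longrightarrow> dom2 \<chi> = dom2 \<phi> \<Longrightarrow> cod2 P \<chi> = cod2 P \<phi> \<Longrightarrow> a \<in> cells D 3 \<Longrightarrow> b \<in> cells D 3 \<Longrightarrow>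
       S2 a = F2 \<chi> \<Longrightarrow> T2 a = S2 b \<Longrightarrow> \<delta> (d33 a b) = d33 (\<delta> a) (\<delta> b)"
    and i: "\<And>\<chi>. \<chi> \<in> cells2 P \<Longrightarrow> dom2 \<chi> = dom2 \<phi> \<Longrightarrow> cod2 P \<chi> = cod2 P \<phi> \<Longrightarrow> idt D 2 (F2 (t \<chi>)) = \<delta> (idt D 2 (F2 \<chi>))"
  shows "E3 (t \<phi>) (map T ws) = \<delta> (E3 \<phi> ws)"
  using assms
proof (induction ws arbitrary: \<phi>)
  case (Cons w ws)
  have w: "wh3_ok P w" "wh3_src P w = \<phi>" "path3 P (wh3_tgt P w) ws"
    using Cons.prems by auto
  note b = wh3_ok_bdry[OF P3 w(1)]
  have "E3 (t (wh3_tgt P w)) (map T ws) = \<delta> (E3 (wh3_tgt P w) ws)"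
    by (rule Cons.IH[OF w(3) b(2)]; (intro Cons.prems)?) (use b w in simp_all)
  moreover have "wh3_tgt P (T w) = t (wh3_tgt P w) \<and> W (T w) = \<delta> (W w)"
    using w by (intro Cons.prems(3)) auto
  moreover have "\<delta> (d33 (W w) (E3 (wh3_tgt P w) ws)) = d33 (\<delta> (W w)) (\<delta> (E3 (wh3_tgt P w) ws))"
    using w b by (intro Cons.prems(4)[of \<phi>]) auto
  ultimately show ?case by simp
qed simp

lemma E3_comp13:
  assumes "f \<in> cells1 P" "cod1 P f = dom1 (dom2 \<phi>)" "\<phi> \<in> cells2 P" "path3 P \<phi> ws"
  shows "E3 (f \<star>\<^sub>1\<^sub>2 \<phi>) (map (\<lambda>w. case w of Wh3 \<kappa> l A r \<rho> \<Rightarrow> Wh3 (f \<star>\<^sub>1\<^sub>2 \<kappa>) (f \<star>\<^sub>1\<^sub>1 l) A r (f \<star>\<^sub>1\<^sub>2 \<rho>)) ws) = d13 (F1 f) (E3 \<phi> ws)"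
proof (rule E3_map[where t = "\<lambda>\<chi>. f \<star>\<^sub>1\<^sub>2 \<chi>" and \<delta> = "\<lambda>a. d13 (F1 f) a"], goal_cases)
  case (3 w)
  obtain \<kappa> l A r \<rho> where w: "w = Wh3 \<kappa> l A r \<rho>" by (cases w)
  have k: "\<kappa> \<in> cells2 P" "\<rho> \<in> cells2 P" "cod2 P \<kappa> = l \<star>\<^sub>1\<^sub>1 dom2 (src3 P A) \<star>\<^sub>1\<^sub>1 r" "l \<in> cells1 P" "r \<in> cells1 P" "A \<in> gen3 P"
    "dom2 \<rho> = l \<star>\<^sub>1\<^sub>1 cod2 P (src3 P A) \<star>\<^sub>1\<^sub>1 r" "cod1 P l = dom1 (dom2 (src3 P A))" "cod1 P (dom2 (src3 P A)) = dom1 r"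
    using 3(1) unfolding w by auto
  have d: "dom2 \<kappa> = dom2 \<phi>" "cod2 P \<rho> = cod2 P \<phi>" using 3 k unfolding w by auto
  note o = wh3_ok_outer[OF P3 3(1)[unfolded w]]
  have o': "dom1 (dom2 \<phi>) = dom1 l" "cod1 P (dom2 \<phi>) = cod1 P r" using o unfolding d by auto
  show ?case unfolding w using k d o' assms by simp
qed (use assms in simp_all)

lemma E3_comp31:
  assumes "f \<in> cells1 P" "cod1 P (dom2 \<phi>) = dom1 f" "\<phi> \<in> cells2 P" "path3 P \<phi> ws"
  shows "E3 ( \<phi> \<star>\<^sub>2\<^sub>1 f) (map (\<lambda>w. case w of Wh3 \<kappa> l A r \<rho> \<Rightarrow> Wh3 (\<kappa> \<star>\<^sub>2\<^sub>1 f) l A (r \<star>\<^sub>1\<^sub>1 f) (\<rho> \<star>\<^sub>2\<^sub>1 f)) ws) = d31 (E3 \<phi> ws) (F1 f)"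
proof (rule E3_map[where t = "\<lambda>\<chi>.  \<chi> \<star>\<^sub>2\<^sub>1 f" and \<delta> = "\<lambda>a. d31 a (F1 f)"], goal_cases)
  case (3 w)
  obtain \<kappa> l A r \<rho> where w: "w = Wh3 \<kappa> l A r \<rho>" by (cases w)
  have k: "\<kappa> \<in> cells2 P" "\<rho> \<in> cells2 P" "cod2 P \<kappa> = l \<star>\<^sub>1\<^sub>1 dom2 (src3 P A) \<star>\<^sub>1\<^sub>1 r" "l \<in> cells1 P" "r \<in> cells1 P" "A \<in> gen3 P"
    "dom2 \<rho> = l \<star>\<^sub>1\<^sub>1 cod2 P (src3 P A) \<star>\<^sub>1\<^sub>1 r" "cod1 P l = dom1 (dom2 (src3 P A))" "cod1 P (dom2 (src3 P A)) = dom1 r"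
    using 3(1) unfolding w by auto
  have d: "dom2 \<kappa> = dom2 \<phi>" "cod2 P \<rho> = cod2 P \<phi>" using 3 k unfolding w by auto
  note o = wh3_ok_outer[OF P3 3(1)[unfolded w]]
  have o': "dom1 (dom2 \<phi>) = dom1 l" "cod1 P (dom2 \<phi>) = cod1 P r" using o unfolding d by auto
  show ?case unfolding w using k d o' assms by simp
qed (use assms in simp_all)

lemma E3_comp23:
  assumes "\<psi> \<in> cells2 P" "cod2 P \<psi> = dom2 \<phi>" "\<phi> \<in> cells2 P" "path3 P \<phi> ws"
  shows "E3 (\<psi> \<star>\<^sub>2\<^sub>2 \<phi>) (map (\<lambda>w. case w of Wh3 \<kappa> l A r \<rho> \<Rightarrow> Wh3 (\<psi> \<star>\<^sub>2\<^sub>2 \<kappa>) l A r \<rho>) ws) = d23 (F2 \<psi>) (E3 \<phi> ws)"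
proof (rule E3_map[where t = "\<lambda>\<chi>. \<psi> \<star>\<^sub>2\<^sub>2 \<chi>" and \<delta> = "\<lambda>a. d23 (F2 \<psi>) a"], goal_cases)
  case (3 w)
  obtain \<kappa> l A r \<rho> where w: "w = Wh3 \<kappa> l A r \<rho>" by (cases w)
  have k: "\<kappa> \<in> cells2 P" "\<rho> \<in> cells2 P" "cod2 P \<kappa> = l \<star>\<^sub>1\<^sub>1 dom2 (src3 P A) \<star>\<^sub>1\<^sub>1 r" "l \<in> cells1 P" "r \<in> cells1 P" "A \<in> gen3 P"
    "dom2 \<rho> = l \<star>\<^sub>1\<^sub>1 cod2 P (src3 P A) \<star>\<^sub>1\<^sub>1 r" "cod1 P l = dom1 (dom2 (src3 P A))" "cod1 P (dom2 (src3 P A)) = dom1 r"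
    using 3(1) unfolding w by auto
  have d: "dom2 \<kappa> = dom2 \<phi>" "cod2 P \<rho> = cod2 P \<phi>" using 3 k unfolding w by auto
  note o = wh3_ok_outer[OF P3 3(1)[unfolded w]]
  have o': "dom1 (dom2 \<phi>) = dom1 l" "cod1 P (dom2 \<phi>) = cod1 P r" using o unfolding d by auto
  show ?case unfolding w using k d o' assms by simp
qed (use assms in simp_all)

lemma E3_comp32:
  assumes "\<psi> \<in> cells2 P" "cod2 P \<phi> = dom2 \<psi>" "\<phi> \<in> cells2 P" "path3 P \<phi> ws"
  shows "E3 ( \<phi> \<star>\<^sub>2\<^sub>2 \<psi>) (map (\<lambda>w. case w of Wh3 \<kappa> l A r \<rho> \<Rightarrow> Wh3 \<kappa> l A r (\<rho> \<star>\<^sub>2\<^sub>2 \<psi>)) ws) = d32 (E3 \<phi> ws) (F2 \<psi>)"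
proof (rule E3_map[where t = "\<lambda>\<chi>.  \<chi> \<star>\<^sub>2\<^sub>2 \<psi>" and \<delta> = "\<lambda>a. d32 a (F2 \<psi>)"], goal_cases)
  case (3 w)
  obtain \<kappa> l A r \<rho> where w: "w = Wh3 \<kappa> l A r \<rho>" by (cases w)
  have k: "\<kappa> \<in> cells2 P" "\<rho> \<in> cells2 P" "cod2 P \<kappa> = l \<star>\<^sub>1\<^sub>1 dom2 (src3 P A) \<star>\<^sub>1\<^sub>1 r" "l \<in> cells1 P" "r \<in> cells1 P" "A \<in> gen3 P"
    "dom2 \<rho> = l \<star>\<^sub>1\<^sub>1 cod2 P (src3 P A) \<star>\<^sub>1\<^sub>1 r" "cod1 P l = dom1 (dom2 (src3 P A))" "cod1 P (dom2 (src3 P A)) = dom1 r"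
    using 3(1) unfolding w by auto
  have d: "dom2 \<kappa> = dom2 \<phi>" "cod2 P \<rho> = cod2 P \<phi>" using 3 k unfolding w by auto
  note o = wh3_ok_outer[OF P3 3(1)[unfolded w]]
  have o': "dom1 (dom2 \<phi>) = dom1 l" "cod1 P (dom2 \<phi>) = cod1 P r" using o unfolding d by auto
  show ?case unfolding w using k d o' assms by simp
qed (use assms in simp_all)


theorem extension3:
  "\<exists>F'. precat_morphism 3 (free_precat P) D F' \<and>
     (\<forall>k < 3. \<forall>u \<in> cells (free_precat P) k. F' k u = F k u) \<and>
     (\<forall>A \<in> gen3 P. F' 3 (C3 (gcell3 P A)) = g A)"
proof -
  define F' where "F' = F(3 := \<lambda>u. case u of C3 A \<Rightarrow> E3 (dom3 A) (steps3 A) | _ \<Rightarrow> undefined)"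
  have [simp]: "F' 0 = F 0" "F' (Suc 0) = F (Suc 0)" "F' 2 = F 2" "F' 3 (C3 A) = E3 (dom3 A) (steps3 A)" for A
    by (simp_all add: F'_def)
  have a: "E3 (dom3 A) (steps3 A @ steps3 B) = d33 (E3 (dom3 A) (steps3 A)) (E3 (dom3 B) (steps3 B))"
    if "A \<in> cells3 P" "B \<in> cells3 P" "cod3 P A = dom3 B" for A B
    using E3_append[of "dom3 A" "steps3 A" "steps3 B"] cells3_path[OF that(1)] cells3_path[OF that(2)]
      that by (simp add: path3_append)
  have "precat_morphism 2 (free_precat P) D F'"
    using F unfolding morphism2_iff morphism1_iff by simp
  then have "precat_morphism 3 (free_precat P) D F'"
    unfolding morphism3_iff using E3[OF dom3_cells cells3_path] a
      E3_comp13[OF _ _ dom3_cells cells3_path] E3_comp31[OF _ _ dom3_cells cells3_path]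
      E3_comp23[OF _ _ dom3_cells cells3_path] E3_comp32[OF _ _ dom3_cells cells3_path]
    by (simp add: id3_def comp13_def comp31_def comp23_def comp32_def comp33_def)
  moreover have "F' 3 (C3 (gcell3 P A)) = g A" if "A \<in> gen3 P" for A
    using that by (simp add: gcell3_def)
  ultimately show ?thesis by (intro exI[of _ F']) (simp add: F'_def)
qed

theorem unique3:
  assumes "precat_morphism 3 (free_precat P) D F'"
    "\<forall>k < 3. \<forall>u \<in> cells (free_precat P) k. F' k u = F k u"
    "\<forall>A \<in> gen3 P. F' 3 (C3 (gcell3 P A)) = g A" "G \<in> cells3 P"
  shows "F' 3 (C3 G) = E3 (dom3 G) (steps3 G)"
proof -
  have l: "f \<in> cells1 P \<Longrightarrow> F' (Suc 0) (C1 f) = F1 f" "\<phi> \<in> cells2 P \<Longrightarrow> F' 2 (C2 \<phi>) = F2 \<phi>" for f \<phi>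
    using assms(2) by (simp_all add: all_nat_simps)
  have "F' 3 (C3 (Cell3 \<phi> ws)) = E3 \<phi> ws" if "\<phi> \<in> cells2 P" "path3 P \<phi> ws" for \<phi> ws
    using that
  proof (induction ws arbitrary: \<phi>)
    case Nil
    then show ?case using assms(1) l unfolding morphism3_iff by (simp add: id3_def)
  next
    case (Cons w ws)
    obtain \<kappa> l' A r \<rho> where ww: "w = Wh3 \<kappa> l' A r \<rho>" by (cases w)
    have w: "wh3_ok P w" "wh3_src P w = \<phi>" "path3 P (wh3_tgt P w) ws" using Cons.prems by auto
    have k: "\<kappa> \<in> cells2 P" "\<rho> \<in> cells2 P" "cod2 P \<kappa> = l' \<star>\<^sub>1\<^sub>1 dom2 (src3 P A) \<star>\<^sub>1\<^sub>1 r" "l' \<in> cells1 P" "r \<in> cells1 P" "A \<in> gen3 P"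
      "dom2 \<rho> = l' \<star>\<^sub>1\<^sub>1 cod2 P (src3 P A) \<star>\<^sub>1\<^sub>1 r" "cod1 P l' = dom1 (dom2 (src3 P A))" "cod1 P (dom2 (src3 P A)) = dom1 r"
      using w(1) unfolding ww by auto
    note t = wh3_ok_bdry(2)[OF P3 w(1)]
    let ?v = "\<kappa> \<star>\<^sub>2\<^sub>3 (l' \<star>\<^sub>1\<^sub>3 gcell3 P A \<star>\<^sub>3\<^sub>1 r) \<star>\<^sub>3\<^sub>2 \<rho>"
    have e: "Cell3 \<phi> (w # ws) = ?v \<star>\<^sub>3\<^sub>3 Cell3 (wh3_tgt P w) ws"
      using w(2) k unfolding ww by (auto simp: gcell3_def comp33_def comp32_def comp23_def comp31_def comp13_def)
    have c: "gcell3 P A \<in> cells3 P" "cod3 P (gcell3 P A) = tgt3 P A" "dom3 (gcell3 P A) = src3 P A"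
      using k(6) by (auto simp: gcell3_def cod3_def intro!: cells3I)
    have "F' 3 (C3 ?v) = W w"
      using assms(1) l c k assms(3) unfolding ww morphism3_iff by simp
    moreover have "F' 3 (C3 (Cell3 \<phi> (w # ws))) = d33 (F' 3 (C3 ?v)) (F' 3 (C3 (Cell3 (wh3_tgt P w) ws)))"
      using assms(1) cells3I[OF t w(3)] c k ww unfolding e morphism3_iff by simp
    ultimately show ?case using Cons.IH[OF t w(3)] by simp
  qed
  from this[OF dom3_cells cells3_path] show ?thesis using assms(4) by (cases G) auto
qed

end

text \<open>
  The universal properties: a morphism defined in dimensions below \<open>k\<close>, together with a compatible
  assignment on the k-generators, extends uniquely to dimension \<open>k\<close>.
\<close>

definition extends ::
  "nat \<Rightarrow> ('c, 'x) precat_scheme \<Rightarrow> ('d, 'y) precat_scheme \<Rightarrow> (nat \<Rightarrow> 'c \<Rightarrow> 'd) \<Rightarrow>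
   'g set \<Rightarrow> ('g \<Rightarrow> 'c) \<Rightarrow> ('g \<Rightarrow> 'd) \<Rightarrow> (nat \<Rightarrow> 'c \<Rightarrow> 'd) \<Rightarrow> bool" where
  "extends k C D F G \<iota> g F' \<longleftrightarrow> precat_morphism k C D F' \<and>
     (\<forall>j < k. \<forall>u \<in> cells C j. F' j u = F j u) \<and> (\<forall>x \<in> G. F' k (\<iota> x) = g x)"

definition unique_extension ::
  "nat \<Rightarrow> ('c, 'x) precat_scheme \<Rightarrow> ('d, 'y) precat_scheme \<Rightarrow> (nat \<Rightarrow> 'c \<Rightarrow> 'd) \<Rightarrow>
   'g set \<Rightarrow> ('g \<Rightarrow> 'c) \<Rightarrow> ('g \<Rightarrow> 'd) \<Rightarrow> bool" where
  "unique_extension k C D F G \<iota> g \<longleftrightarrow>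
     (\<exists>F'. extends k C D F G \<iota> g F' \<and>
        (\<forall>F''. extends k C D F G \<iota> g F'' \<longrightarrow> (\<forall>u \<in> cells C k. F'' k u = F' k u)))"

lemma unique_extensionI:
  assumes "extends k C D F G \<iota> g F'"
    and "\<And>F'' u. extends k C D F G \<iota> g F'' \<Longrightarrow> u \<in> cells C k \<Longrightarrow> F'' k u = E u"
  shows "unique_extension k C D F G \<iota> g"
  unfolding unique_extension_def using assms by metis

theorem free_extension1:
  assumes "prepolygraph3 P" "precategory n D" "1 \<le> n" "precat_morphism 0 (free_precat P) D F"
    and "\<And>a. a \<in> gen1 P \<Longrightarrow> g a \<in> cells D 1 \<and> bdry D Neg 0 (g a) = F 0 (C0 (src1 P a)) \<and>
           bdry D Pos 0 (g a) = F 0 (C0 (tgt1 P a))"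
  shows "unique_extension 1 (free_precat P) D F (gen1 P) (\<lambda>a. C1 (gcell1 P a)) g"
proof -
  interpret extension_context1 D n P F g
    by unfold_locales (use assms in auto)
  note s = free_precat_simps[OF assms(1)]
  obtain F' where "extends 1 (free_precat P) D F (gen1 P) (\<lambda>a. C1 (gcell1 P a)) g F'"
    using extension1 by (auto simp: extends_def s)
  then show ?thesis
    by (rule unique_extensionI[where E = "\<lambda>u. case u of C1 f \<Rightarrow> E1 (dom1 f) (steps1 f) | _ \<Rightarrow> undefined"])
      (use unique1 in \<open>auto simp: extends_def s\<close>)
qed

theorem free_extension2:
  assumes "prepolygraph3 P" "precategory n D" "2 \<le> n" "precat_morphism 1 (free_precat P) D F"
    and "\<And>\<alpha>. \<alpha> \<in> gen2 P \<Longrightarrow> g \<alpha> \<in> cells D 2 \<and> bdry D Neg 1 (g \<alpha>) = F 1 (C1 (src2 P \<alpha>)) \<and>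
           bdry D Pos 1 (g \<alpha>) = F 1 (C1 (tgt2 P \<alpha>))"
  shows "unique_extension 2 (free_precat P) D F (gen2 P) (\<lambda>\<alpha>. C2 (gcell2 P \<alpha>)) g"
proof -
  interpret extension_context2 D n P F g
    by unfold_locales (use assms in auto)
  note s = free_precat_simps[OF assms(1)]
  obtain F' where "extends 2 (free_precat P) D F (gen2 P) (\<lambda>\<alpha>. C2 (gcell2 P \<alpha>)) g F'"
    using extension2 by (auto simp: extends_def)
  then show ?thesis
    by (rule unique_extensionI[where E = "\<lambda>u. case u of C2 \<phi> \<Rightarrow> E2 (dom2 \<phi>) (steps2 \<phi>) | _ \<Rightarrow> undefined"])
      (use unique2 in \<open>auto simp: extends_def s\<close>)
qed

theorem free_extension3:
  assumes "prepolygraph3 P" "precategory n D" "3 \<le> n" "precat_morphism 2 (free_precat P) D F"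
    and "\<And>A. A \<in> gen3 P \<Longrightarrow> g A \<in> cells D 3 \<and> bdry D Neg 2 (g A) = F 2 (C2 (src3 P A)) \<and>
           bdry D Pos 2 (g A) = F 2 (C2 (tgt3 P A))"
  shows "unique_extension 3 (free_precat P) D F (gen3 P) (\<lambda>A. C3 (gcell3 P A)) g"
proof -
  interpret extension_context3 D n P F g
    by unfold_locales (use assms in auto)
  note s = free_precat_simps[OF assms(1)]
  obtain F' where "extends 3 (free_precat P) D F (gen3 P) (\<lambda>A. C3 (gcell3 P A)) g F'"
    using extension3 by (auto simp: extends_def)
  then show ?thesis
    by (rule unique_extensionI[where E = "\<lambda>u. case u of C3 A \<Rightarrow> E3 (dom3 A) (steps3 A) | _ \<Rightarrow> undefined"])
      (use unique3 in \<open>auto simp: extends_def s\<close>)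
qed


subsection \<open>Presented precategories and coherence\<close>

definition presented_precat ::
  "('o, 'a, 'b, 'c, 'd, 'z) prepoly4_scheme \<Rightarrow> ('o, 'a, 'b, 'c) pcell set precat" where
  "presented_precat P =
     quotient_precat 3 (free_precat P)
       (generated_congruence 3 (free_precat P) {(C3 (src4 P G), C3 (tgt4 P G)) | G. G \<in> gen4 P})"

definition coherent :: "('o, 'a, 'b, 'c, 'd, 'z) prepoly4_scheme \<Rightarrow> bool" where
  "coherent P \<longleftrightarrow>
     (let L = localization 3 (presented_precat P)
      in \<forall>F \<in> cells L 3. \<forall>G \<in> cells L 3. parallel L 3 F G \<longrightarrow> F = G)"


section \<open>Gray presentations\<close>

text \<open>
  The 3-cells \<open>X\<^bsub>\<phi>,\<psi>\<^esub>\<close>, for a given choice \<open>X\<close> of interchange generators. \<open>swap1\<close> treats two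
  whiskers, \<open>swap2\<close> moves one whisker past a composite of whiskers with source \<open>h\<close>, and \<open>swap3\<close>
  treats a composite of whiskers with source \<open>f\<close>: all but the first one are moved first.
\<close>

fun swap1 ::
  "('o, 'a, 'b, 'c, 'z) prepoly3_scheme \<Rightarrow> ('b \<Rightarrow> ('o, 'a) cell1 \<Rightarrow> 'b \<Rightarrow> 'c) \<Rightarrow>
   ('o, 'a, 'b) wh2 \<Rightarrow> ('o, 'a, 'b) wh2 \<Rightarrow> ('o, 'a, 'b, 'c) cell3" where
  "swap1 P X (Wh2 f \<alpha> g) (Wh2 f' \<beta> g') = f \<star>\<^sub>1\<^sub>3 gcell3 P (X \<alpha> (g \<star>\<^sub>1\<^sub>1 f') \<beta>) \<star>\<^sub>3\<^sub>1 g'"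

fun swap2 ::
  "('o, 'a, 'b, 'c, 'z) prepoly3_scheme \<Rightarrow> ('b \<Rightarrow> ('o, 'a) cell1 \<Rightarrow> 'b \<Rightarrow> 'c) \<Rightarrow>
   ('o, 'a, 'b) wh2 \<Rightarrow> ('o, 'a) cell1 \<Rightarrow> ('o, 'a, 'b) wh2 list \<Rightarrow> ('o, 'a, 'b, 'c) cell3" where
  "swap2 P X w h [] = id3 (wcell2 P w \<star>\<^sub>2\<^sub>1 h)"
| "swap2 P X w h (v # vs) =
     swap1 P X w v \<star>\<^sub>3\<^sub>2 (wh2_tgt P w \<star>\<^sub>1\<^sub>2 Cell2 (wh2_tgt P v) vs)
     \<star>\<^sub>3\<^sub>3 (wh2_src P w \<star>\<^sub>1\<^sub>2 wcell2 P v) \<star>\<^sub>2\<^sub>3 swap2 P X w (wh2_tgt P v) vs"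

fun swap3 ::
  "('o, 'a, 'b, 'c, 'z) prepoly3_scheme \<Rightarrow> ('b \<Rightarrow> ('o, 'a) cell1 \<Rightarrow> 'b \<Rightarrow> 'c) \<Rightarrow>
   ('o, 'a) cell1 \<Rightarrow> ('o, 'a, 'b) wh2 list \<Rightarrow> ('o, 'a, 'b) cell2 \<Rightarrow> ('o, 'a, 'b, 'c) cell3" where
  "swap3 P X f [] \<psi> = id3 (f \<star>\<^sub>1\<^sub>2 \<psi>)"
| "swap3 P X f (w # ws) \<psi> =
     (wcell2 P w \<star>\<^sub>2\<^sub>1 dom2 \<psi>) \<star>\<^sub>2\<^sub>3 swap3 P X (wh2_tgt P w) ws \<psi>
     \<star>\<^sub>3\<^sub>3 swap2 P X w (dom2 \<psi>) (steps2 \<psi>) \<star>\<^sub>3\<^sub>2 (Cell2 (wh2_tgt P w) ws \<star>\<^sub>2\<^sub>1 cod2 P \<psi>)"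

definition interchange ::
  "('o, 'a, 'b, 'c, 'z) prepoly3_scheme \<Rightarrow> ('b \<Rightarrow> ('o, 'a) cell1 \<Rightarrow> 'b \<Rightarrow> 'c) \<Rightarrow>
   ('o, 'a, 'b) cell2 \<Rightarrow> ('o, 'a, 'b) cell2 \<Rightarrow> ('o, 'a, 'b, 'c) cell3" where
  "interchange P X \<phi> \<psi> = swap3 P X (dom2 \<phi>) (steps2 \<phi>) \<psi>"

definition interchange_src ::
  "('o, 'a, 'b, 'z) prepoly2_scheme \<Rightarrow> 'b \<Rightarrow> ('o, 'a) cell1 \<Rightarrow> 'b \<Rightarrow> ('o, 'a, 'b) cell2" where
  "interchange_src P \<alpha> g \<beta> =
     (gcell2 P \<alpha> \<star>\<^sub>2\<^sub>1 g \<star>\<^sub>2\<^sub>1 src2 P \<beta>) \<star>\<^sub>2\<^sub>2 (tgt2 P \<alpha> \<star>\<^sub>1\<^sub>1 g \<star>\<^sub>1\<^sub>2 gcell2 P \<beta>)"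

definition interchange_tgt ::
  "('o, 'a, 'b, 'z) prepoly2_scheme \<Rightarrow> 'b \<Rightarrow> ('o, 'a) cell1 \<Rightarrow> 'b \<Rightarrow> ('o, 'a, 'b) cell2" where
  "interchange_tgt P \<alpha> g \<beta> =
     (src2 P \<alpha> \<star>\<^sub>1\<^sub>1 g \<star>\<^sub>1\<^sub>2 gcell2 P \<beta>) \<star>\<^sub>2\<^sub>2 (gcell2 P \<alpha> \<star>\<^sub>2\<^sub>1 g \<star>\<^sub>2\<^sub>1 tgt2 P \<beta>)"

definition independence_src ::
  "('o, 'a, 'b, 'c, 'z) prepoly3_scheme \<Rightarrow> 'c \<Rightarrow> 'c \<Rightarrow> ('o, 'a) cell1 \<Rightarrow> ('o, 'a) cell1 \<Rightarrow>
   ('o, 'a, 'b) cell2 \<Rightarrow> ('o, 'a) cell1 \<Rightarrow> ('o, 'a) cell1 \<Rightarrow> ('o, 'a, 'b, 'c) cell3" where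
  "independence_src P A B e h \<chi> e' h' =
     ((e \<star>\<^sub>1\<^sub>3 gcell3 P A \<star>\<^sub>3\<^sub>1 h) \<star>\<^sub>3\<^sub>2 \<chi> \<star>\<^sub>3\<^sub>2 (e' \<star>\<^sub>1\<^sub>2 src3 P B \<star>\<^sub>2\<^sub>1 h')) \<star>\<^sub>3\<^sub>3
     ((e \<star>\<^sub>1\<^sub>2 tgt3 P A \<star>\<^sub>2\<^sub>1 h) \<star>\<^sub>2\<^sub>2 \<chi> \<star>\<^sub>2\<^sub>3 (e' \<star>\<^sub>1\<^sub>3 gcell3 P B \<star>\<^sub>3\<^sub>1 h'))"

definition independence_tgt ::
  "('o, 'a, 'b, 'c, 'z) prepoly3_scheme \<Rightarrow> 'c \<Rightarrow> 'c \<Rightarrow> ('o, 'a) cell1 \<Rightarrow> ('o, 'a) cell1 \<Rightarrow>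
   ('o, 'a, 'b) cell2 \<Rightarrow> ('o, 'a) cell1 \<Rightarrow> ('o, 'a) cell1 \<Rightarrow> ('o, 'a, 'b, 'c) cell3" where
  "independence_tgt P A B e h \<chi> e' h' =
     ((e \<star>\<^sub>1\<^sub>2 src3 P A \<star>\<^sub>2\<^sub>1 h) \<star>\<^sub>2\<^sub>2 \<chi> \<star>\<^sub>2\<^sub>3 (e' \<star>\<^sub>1\<^sub>3 gcell3 P B \<star>\<^sub>3\<^sub>1 h')) \<star>\<^sub>3\<^sub>3
     ((e \<star>\<^sub>1\<^sub>3 gcell3 P A \<star>\<^sub>3\<^sub>1 h) \<star>\<^sub>3\<^sub>2 \<chi> \<star>\<^sub>3\<^sub>2 (e' \<star>\<^sub>1\<^sub>2 tgt3 P B \<star>\<^sub>2\<^sub>1 h'))"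

definition naturality1_src ::
  "('o, 'a, 'b, 'c, 'z) prepoly3_scheme \<Rightarrow> ('b \<Rightarrow> ('o, 'a) cell1 \<Rightarrow> 'b \<Rightarrow> 'c) \<Rightarrow>
   'c \<Rightarrow> ('o, 'a) cell1 \<Rightarrow> 'b \<Rightarrow> ('o, 'a, 'b, 'c) cell3" where
  "naturality1_src P X A g \<beta> =
     ((gcell3 P A \<star>\<^sub>3\<^sub>1 g \<star>\<^sub>3\<^sub>1 src2 P \<beta>) \<star>\<^sub>3\<^sub>2 (cod2 P (src3 P A) \<star>\<^sub>1\<^sub>1 g \<star>\<^sub>1\<^sub>2 gcell2 P \<beta>)) \<star>\<^sub>3\<^sub>3
     interchange P X (tgt3 P A) (g \<star>\<^sub>1\<^sub>2 gcell2 P \<beta>)"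

definition naturality1_tgt ::
  "('o, 'a, 'b, 'c, 'z) prepoly3_scheme \<Rightarrow> ('b \<Rightarrow> ('o, 'a) cell1 \<Rightarrow> 'b \<Rightarrow> 'c) \<Rightarrow>
   'c \<Rightarrow> ('o, 'a) cell1 \<Rightarrow> 'b \<Rightarrow> ('o, 'a, 'b, 'c) cell3" where
  "naturality1_tgt P X A g \<beta> =
     interchange P X (src3 P A) (g \<star>\<^sub>1\<^sub>2 gcell2 P \<beta>) \<star>\<^sub>3\<^sub>3
     ((dom2 (src3 P A) \<star>\<^sub>1\<^sub>1 g \<star>\<^sub>1\<^sub>2 gcell2 P \<beta>) \<star>\<^sub>2\<^sub>3 (gcell3 P A \<star>\<^sub>3\<^sub>1 g \<star>\<^sub>3\<^sub>1 tgt2 P \<beta>))"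

definition naturality2_src ::
  "('o, 'a, 'b, 'c, 'z) prepoly3_scheme \<Rightarrow> ('b \<Rightarrow> ('o, 'a) cell1 \<Rightarrow> 'b \<Rightarrow> 'c) \<Rightarrow>
   'b \<Rightarrow> ('o, 'a) cell1 \<Rightarrow> 'c \<Rightarrow> ('o, 'a, 'b, 'c) cell3" where
  "naturality2_src P X \<alpha> g B =
     ((gcell2 P \<alpha> \<star>\<^sub>2\<^sub>1 g \<star>\<^sub>2\<^sub>1 dom2 (src3 P B)) \<star>\<^sub>2\<^sub>3 (tgt2 P \<alpha> \<star>\<^sub>1\<^sub>1 g \<star>\<^sub>1\<^sub>3 gcell3 P B)) \<star>\<^sub>3\<^sub>3
     interchange P X (gcell2 P \<alpha> \<star>\<^sub>2\<^sub>1 g) (tgt3 P B)"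

definition naturality2_tgt ::
  "('o, 'a, 'b, 'c, 'z) prepoly3_scheme \<Rightarrow> ('b \<Rightarrow> ('o, 'a) cell1 \<Rightarrow> 'b \<Rightarrow> 'c) \<Rightarrow>
   'b \<Rightarrow> ('o, 'a) cell1 \<Rightarrow> 'c \<Rightarrow> ('o, 'a, 'b, 'c) cell3" where
  "naturality2_tgt P X \<alpha> g B =
     interchange P X (gcell2 P \<alpha> \<star>\<^sub>2\<^sub>1 g) (src3 P B) \<star>\<^sub>3\<^sub>3
     ((src2 P \<alpha> \<star>\<^sub>1\<^sub>1 g \<star>\<^sub>1\<^sub>3 gcell3 P B) \<star>\<^sub>3\<^sub>2 (gcell2 P \<alpha> \<star>\<^sub>2\<^sub>1 g \<star>\<^sub>2\<^sub>1 cod2 P (src3 P B)))"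

text \<open>The condition that \<open>(e *\<^sub>0 \<phi> *\<^sub>0 h) *\<^sub>1 \<chi> *\<^sub>1 (e' *\<^sub>0 \<psi> *\<^sub>0 h')\<close> is defined.\<close>

definition independence_defined ::
  "('o, 'a, 'b, 'z) prepoly2_scheme \<Rightarrow> ('o, 'a, 'b) cell2 \<Rightarrow> ('o, 'a, 'b) cell2 \<Rightarrow>
   ('o, 'a) cell1 \<Rightarrow> ('o, 'a) cell1 \<Rightarrow> ('o, 'a, 'b) cell2 \<Rightarrow>
   ('o, 'a) cell1 \<Rightarrow> ('o, 'a) cell1 \<Rightarrow> bool" where
  "independence_defined P \<phi> \<psi> e h \<chi> e' h' \<longleftrightarrow>
     cod1 P e = dom1 (dom2 \<phi>) \<and> cod1 P (dom2 \<phi>) = dom1 h \<and>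
     cod1 P e' = dom1 (dom2 \<psi>) \<and> cod1 P (dom2 \<psi>) = dom1 h' \<and>
     e \<star>\<^sub>1\<^sub>1 cod2 P \<phi> \<star>\<^sub>1\<^sub>1 h = dom2 \<chi> \<and> cod2 P \<chi> = e' \<star>\<^sub>1\<^sub>1 dom2 \<psi> \<star>\<^sub>1\<^sub>1 h'"

text \<open>
  A Gray presentation carries the families of distinguished generators as structure; the values
  of \<open>ichg\<close>, \<open>indep\<close>, \<open>nat1\<close>, \<open>nat2\<close> are irrelevant outside the composable indices.
\<close>

record ('o, 'a, 'b, 'c, 'd) gray = "('o, 'a, 'b, 'c, 'd) prepoly4" +
  ichg :: "'b \<Rightarrow> ('o, 'a) cell1 \<Rightarrow> 'b \<Rightarrow> 'c"
  indep :: "'c \<Rightarrow> 'c \<Rightarrow> ('o, 'a) cell1 \<Rightarrow> ('o, 'a) cell1 \<Rightarrow> ('o, 'a, 'b) cell2 \<Rightarrow>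
    ('o, 'a) cell1 \<Rightarrow> ('o, 'a) cell1 \<Rightarrow> 'd"
  nat1 :: "'c \<Rightarrow> ('o, 'a) cell1 \<Rightarrow> 'b \<Rightarrow> 'd"
  nat2 :: "'b \<Rightarrow> ('o, 'a) cell1 \<Rightarrow> 'c \<Rightarrow> 'd"

definition gray_presentation :: "('o, 'a, 'b, 'c, 'd, 'z) gray_scheme \<Rightarrow> bool" where
  "gray_presentation P \<longleftrightarrow> prepolygraph4 P \<and>
     (\<forall>\<alpha> \<in> gen2 P. \<forall>g \<in> cells1 P. \<forall>\<beta> \<in> gen2 P.
        cod1 P (src2 P \<alpha>) = dom1 g \<longrightarrow> cod1 P g = dom1 (src2 P \<beta>) \<longrightarrow>
        ichg P \<alpha> g \<beta> \<in> gen3 P \<and>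
        src3 P (ichg P \<alpha> g \<beta>) = interchange_src P \<alpha> g \<beta> \<and>
        tgt3 P (ichg P \<alpha> g \<beta>) = interchange_tgt P \<alpha> g \<beta>) \<and>
     (\<forall>A \<in> gen3 P. \<forall>B \<in> gen3 P. \<forall>e \<in> cells1 P. \<forall>h \<in> cells1 P. \<forall>\<chi> \<in> cells2 P.
      \<forall>e' \<in> cells1 P. \<forall>h' \<in> cells1 P.
        independence_defined P (src3 P A) (src3 P B) e h \<chi> e' h' \<longrightarrow>
        indep P A B e h \<chi> e' h' \<in> gen4 P \<and>
        src4 P (indep P A B e h \<chi> e' h') = independence_src P A B e h \<chi> e' h' \<and>
        tgt4 P (indep P A B e h \<chi> e' h') = independence_tgt P A B e h \<chi> e' h') \<and>
     (\<forall>A \<in> gen3 P. \<forall>g \<in> cells1 P. \<forall>\<beta> \<in> gen2 P.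
        cod1 P (dom2 (src3 P A)) = dom1 g \<longrightarrow> cod1 P g = dom1 (src2 P \<beta>) \<longrightarrow>
        nat1 P A g \<beta> \<in> gen4 P \<and>
        src4 P (nat1 P A g \<beta>) = naturality1_src P (ichg P) A g \<beta> \<and>
        tgt4 P (nat1 P A g \<beta>) = naturality1_tgt P (ichg P) A g \<beta>) \<and>
     (\<forall>\<alpha> \<in> gen2 P. \<forall>g \<in> cells1 P. \<forall>B \<in> gen3 P.
        cod1 P (src2 P \<alpha>) = dom1 g \<longrightarrow> cod1 P g = dom1 (dom2 (src3 P B)) \<longrightarrow>
        nat2 P \<alpha> g B \<in> gen4 P \<and>
        src4 P (nat2 P \<alpha> g B) = naturality2_src P (ichg P) \<alpha> g B \<and>
        tgt4 P (nat2 P \<alpha> g B) = naturality2_tgt P (ichg P) \<alpha> g B)"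


section \<open>The Gray presentation of pseudomonoids\<close>

datatype pm0 = Obj_x
datatype pm1 = Gen_a
datatype pm2 = Mu | Eta

text \<open>As every 1-cell is some \<open>bar n\<close>, the 1-cells indexing generators are given by their length.\<close>

datatype pm3 = Assoc | LUnit | RUnit | Ichg pm2 nat pm2

datatype pm4 =
    Indep pm3 pm3 nat nat "(pm0, pm1, pm2) cell2" nat nat
  | Nat1 pm3 nat pm2
  | Nat2 pm2 nat pm3
  | Coh1 | Coh2 | Coh3 | Coh4 | Coh5

definition bar :: "nat \<Rightarrow> (pm0, pm1) cell1" where
  "bar n = Cell1 Obj_x (replicate n Gen_a)"

definition len :: "(pm0, pm1) cell1 \<Rightarrow> nat" where
  "len f = length (steps1 f)"

fun pm_src2 :: "pm2 \<Rightarrow> (pm0, pm1) cell1" where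
  "pm_src2 Mu = bar 2"
| "pm_src2 Eta = bar 0"

definition PMon2 :: "(pm0, pm1, pm2) prepoly2" where
  "PMon2 = \<lparr>
     gen0 = UNIV,
     gen1 = UNIV, src1 = (\<lambda>_. Obj_x), tgt1 = (\<lambda>_. Obj_x),
     gen2 = UNIV, src2 = pm_src2, tgt2 = (\<lambda>_. bar 1) \<rparr>"

abbreviation \<mu> :: "(pm0, pm1, pm2) cell2" where "\<mu> \<equiv> gcell2 PMon2 Mu"
abbreviation \<eta> :: "(pm0, pm1, pm2) cell2" where "\<eta> \<equiv> gcell2 PMon2 Eta"

fun pm_src3 :: "pm3 \<Rightarrow> (pm0, pm1, pm2) cell2" where
  "pm_src3 Assoc = \<mu> \<star>\<^sub>2\<^sub>1 bar 1 \<star>\<^sub>2\<^sub>2 \<mu>"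
| "pm_src3 LUnit = \<eta> \<star>\<^sub>2\<^sub>1 bar 1 \<star>\<^sub>2\<^sub>2 \<mu>"
| "pm_src3 RUnit = bar 1 \<star>\<^sub>1\<^sub>2 \<eta> \<star>\<^sub>2\<^sub>2 \<mu>"
| "pm_src3 (Ichg \<alpha> n \<beta>) = interchange_src PMon2 \<alpha> (bar n) \<beta>"

fun pm_tgt3 :: "pm3 \<Rightarrow> (pm0, pm1, pm2) cell2" where
  "pm_tgt3 Assoc = bar 1 \<star>\<^sub>1\<^sub>2 \<mu> \<star>\<^sub>2\<^sub>2 \<mu>"
| "pm_tgt3 LUnit = id2 (bar 1)"
| "pm_tgt3 RUnit = id2 (bar 1)"
| "pm_tgt3 (Ichg \<alpha> n \<beta>) = interchange_tgt PMon2 \<alpha> (bar n) \<beta>"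

definition PMon3 :: "(pm0, pm1, pm2, pm3) prepoly3" where
  "PMon3 = \<lparr>
     gen0 = UNIV,
     gen1 = UNIV, src1 = (\<lambda>_. Obj_x), tgt1 = (\<lambda>_. Obj_x),
     gen2 = UNIV, src2 = pm_src2, tgt2 = (\<lambda>_. bar 1),
     gen3 = UNIV, src3 = pm_src3, tgt3 = pm_tgt3 \<rparr>"

abbreviation AA :: "(pm0, pm1, pm2, pm3) cell3" where "AA \<equiv> gcell3 PMon3 Assoc"
abbreviation LL :: "(pm0, pm1, pm2, pm3) cell3" where "LL \<equiv> gcell3 PMon3 LUnit"
abbreviation RR :: "(pm0, pm1, pm2, pm3) cell3" where "RR \<equiv> gcell3 PMon3 RUnit"

abbreviation XX :: "pm2 \<Rightarrow> nat \<Rightarrow> pm2 \<Rightarrow> (pm0, pm1, pm2, pm3) cell3" where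
  "XX \<alpha> n \<beta> \<equiv> gcell3 PMon3 (Ichg \<alpha> n \<beta>)"

definition pm_ichg :: "pm2 \<Rightarrow> (pm0, pm1) cell1 \<Rightarrow> pm2 \<Rightarrow> pm3" where
  "pm_ichg \<alpha> g \<beta> = Ichg \<alpha> (len g) \<beta>"

fun pm_src4 :: "pm4 \<Rightarrow> (pm0, pm1, pm2, pm3) cell3" where
  "pm_src4 (Indep A B m n \<chi> m' n') =
     independence_src PMon3 A B (bar m) (bar n) \<chi> (bar m') (bar n')"
| "pm_src4 (Nat1 A n \<beta>) = naturality1_src PMon3 pm_ichg A (bar n) \<beta>"
| "pm_src4 (Nat2 \<alpha> n B) = naturality2_src PMon3 pm_ichg \<alpha> (bar n) B"
| "pm_src4 Coh1 =
     (AA \<star>\<^sub>3\<^sub>1 bar 1 \<star>\<^sub>3\<^sub>2 \<mu>) \<star>\<^sub>3\<^sub>3 (bar 1 \<star>\<^sub>1\<^sub>2 \<mu> \<star>\<^sub>2\<^sub>1 bar 1 \<star>\<^sub>2\<^sub>3 AA) \<star>\<^sub>3\<^sub>3 (bar 1 \<star>\<^sub>1\<^sub>3 AA \<star>\<^sub>3\<^sub>2 \<mu>)"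
| "pm_src4 Coh2 = LL \<star>\<^sub>3\<^sub>1 bar 1 \<star>\<^sub>3\<^sub>2 \<mu>"
| "pm_src4 Coh3 = \<mu> \<star>\<^sub>2\<^sub>3 RR"
| "pm_src4 Coh4 = RR \<star>\<^sub>3\<^sub>1 bar 1 \<star>\<^sub>3\<^sub>2 \<mu>"
| "pm_src4 Coh5 = \<eta> \<star>\<^sub>2\<^sub>3 RR"

fun pm_tgt4 :: "pm4 \<Rightarrow> (pm0, pm1, pm2, pm3) cell3" where
  "pm_tgt4 (Indep A B m n \<chi> m' n') =
     independence_tgt PMon3 A B (bar m) (bar n) \<chi> (bar m') (bar n')"
| "pm_tgt4 (Nat1 A n \<beta>) = naturality1_tgt PMon3 pm_ichg A (bar n) \<beta>"
| "pm_tgt4 (Nat2 \<alpha> n B) = naturality2_tgt PMon3 pm_ichg \<alpha> (bar n) B"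
| "pm_tgt4 Coh1 =
     (\<mu> \<star>\<^sub>2\<^sub>1 bar 2 \<star>\<^sub>2\<^sub>3 AA) \<star>\<^sub>3\<^sub>3 (XX Mu 0 Mu \<star>\<^sub>3\<^sub>2 \<mu>) \<star>\<^sub>3\<^sub>3 (bar 2 \<star>\<^sub>1\<^sub>2 \<mu> \<star>\<^sub>2\<^sub>3 AA)"
| "pm_tgt4 Coh2 =
     (\<eta> \<star>\<^sub>2\<^sub>1 bar 2 \<star>\<^sub>2\<^sub>3 AA) \<star>\<^sub>3\<^sub>3 (XX Eta 0 Mu \<star>\<^sub>3\<^sub>2 \<mu>) \<star>\<^sub>3\<^sub>3 (\<mu> \<star>\<^sub>2\<^sub>3 LL)"
| "pm_tgt4 Coh3 =
     (XX Mu 0 Eta \<star>\<^sub>3\<^sub>2 \<mu>) \<star>\<^sub>3\<^sub>3 (bar 2 \<star>\<^sub>1\<^sub>2 \<eta> \<star>\<^sub>2\<^sub>3 AA) \<star>\<^sub>3\<^sub>3 (bar 1 \<star>\<^sub>1\<^sub>3 RR \<star>\<^sub>3\<^sub>2 \<mu>)"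
| "pm_tgt4 Coh4 =
     (bar 1 \<star>\<^sub>1\<^sub>2 \<eta> \<star>\<^sub>2\<^sub>1 bar 1 \<star>\<^sub>2\<^sub>3 AA) \<star>\<^sub>3\<^sub>3 (bar 1 \<star>\<^sub>1\<^sub>3 LL \<star>\<^sub>3\<^sub>2 \<mu>)"
| "pm_tgt4 Coh5 = (XX Eta 0 Eta \<star>\<^sub>3\<^sub>2 \<mu>) \<star>\<^sub>3\<^sub>3 (\<eta> \<star>\<^sub>2\<^sub>3 LL)"

definition PMon :: "(pm0, pm1, pm2, pm3, pm4) gray" where
  "PMon = \<lparr>
     gen0 = UNIV,
     gen1 = UNIV, src1 = (\<lambda>_. Obj_x), tgt1 = (\<lambda>_. Obj_x),
     gen2 = UNIV, src2 = pm_src2, tgt2 = (\<lambda>_. bar 1),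
     gen3 = UNIV, src3 = pm_src3, tgt3 = pm_tgt3,
     gen4 = {Indep A B m n \<chi> m' n' | A B m n \<chi> m' n'. \<chi> \<in> cells2 PMon3 \<and>
               independence_defined PMon3 (pm_src3 A) (pm_src3 B) (bar m) (bar n) \<chi> (bar m') (bar n')}
            \<union> range (\<lambda>(A, n, \<beta>). Nat1 A n \<beta>) \<union> range (\<lambda>(\<alpha>, n, B). Nat2 \<alpha> n B)
            \<union> {Coh1, Coh2, Coh3, Coh4, Coh5},
     src4 = pm_src4, tgt4 = pm_tgt4,
     ichg = pm_ichg,
     indep = (\<lambda>A B e h \<chi> e' h'. Indep A B (len e) (len h) \<chi> (len e') (len h')),
     nat1 = (\<lambda>A g \<beta>. Nat1 A (len g) \<beta>),
     nat2 = (\<lambda>\<alpha> g B. Nat2 \<alpha> (len g) B) \<rparr>"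

end

theory Submission
  imports Defs
begin

text \<open>
  Squier's argument. Interchangers, associators and unitors, read as rewriting rules on 2-cells,
  terminate, and each overlap of two redexes is closed by a 4-generator: disjoint redexes by
  independence, overlaps with an interchanger by interchange naturality, and the remaining five
  by the five coherence generators. By Newman's lemma carried out modulo the congruence, any two
  rewriting paths from a 2-cell to its normal form are congruent. Hence, writing \<open>N \<phi>\<close> for such a
  path, every 3-cell of the localization from \<open>\<phi>\<close> to \<open>\<psi>\<close> equals \<open>N \<phi>\<close> followed by the
  inverse of \<open>N \<psi>\<close>.
\<close>

section \<open>Generated congruences\<close>

text \<open>The shape of the branchings is dictated by the list normal forms. The source of every
  3-generator is a list of exactly two whiskers, so two redexes in one list coincide, share exactly
  one whisker, or are disjoint, possibly with a segment between them. If one whisker is shared, it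
  ends the first redex and begins the second. An associator or unitor ends in a multiplication:
  followed by an associator it gives \<open>Coh1\<close>, \<open>Coh2\<close>, \<open>Coh4\<close>.
  Any redex followed by an interchanger gives naturality in the first argument. An interchanger
  followed by an associator or a unitor gives naturality in the second argument, with one exception:
  before \<open>RUnit\<close> at distance 0 the swapped 2-generator feeds the multiplication that
  the right unitor removes. This exception accounts for \<open>Coh3\<close> and \<open>Coh5\<close>.
  2-cells are not identified up to interchange, so the termination measure must order nodes that are
  independent of each other. Interchangers and associators also preserve the number of nodes, hence
  the measure counts nodes to the left of each node.\<close>

lemma congruence_Inter:
  assumes "\<R> \<noteq> {}" "\<And>R. R \<in> \<R> \<Longrightarrow> congruence n C R"
  shows "congruence n C (\<Inter> \<R>)"
  unfolding congruence_def
proof (intro conjI)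
  show "equiv (cells C n) (\<Inter> \<R>)"
  proof (rule equivI)
    show "\<Inter> \<R> \<subseteq> cells C n \<times> cells C n" "refl_on (cells C n) (\<Inter> \<R>)"
      using assms by (fastforce simp: congruence_def equiv_def refl_on_def)+
    show "sym (\<Inter> \<R>)"
      using assms by (auto simp: congruence_def equiv_def sym_def)
    show "trans (\<Inter> \<R>)"
      using assms(2) by (intro transI) (meson InterE InterI congruence_def equiv_def transD)
  qed
  show "\<forall>(u, u') \<in> \<Inter> \<R>. parallel C n u u'"
    using assms by (fastforce simp: congruence_def)
  show "\<forall>(u, u') \<in> \<Inter> \<R>. \<forall>i < n. \<forall>v \<in> cells C (i + 1). \<forall>w \<in> cells C (i + 1).
        composable n C (i + 1) n v u \<longrightarrow> composable n C n (i + 1) (comp C (i + 1) n v u) w \<longrightarrow>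
        (comp C n (i + 1) (comp C (i + 1) n v u) w,
         comp C n (i + 1) (comp C (i + 1) n v u') w) \<in> \<Inter> \<R>"
    using assms(2) unfolding congruence_def by fast
qed

text \<open>The witness \<open>R\<close> guards against the empty family, whose intersection is the
  universal relation and in general not a congruence.\<close>

lemma congruence_generated:
  assumes "congruence n C R" "S \<subseteq> R"
  shows "congruence n C (generated_congruence n C S)"
  unfolding generated_congruence_def using assms by (intro congruence_Inter) auto

lemma generated_congruence_incl: "S \<subseteq> generated_congruence n C S"
  by (auto simp: generated_congruence_def)


section \<open>The congruence presented by a prepolygraph\<close>

locale presentation =
  fixes P :: "('o, 'a, 'b, 'c, 'd, 'z) prepoly4_scheme"
  assumes P4: "prepolygraph4 P"
begin

lemma P3: "prepolygraph3 P"
  using P4 by (simp add: prepolygraph4_def)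

lemmas P2 = P2[OF P3]

lemmas [simp] = gen2_cells[OF P2] cod1_cells[OF P2] cod2_cells[OF P2] comp12_cells[OF P2]
  comp21_cells[OF P2] comp12_id1[OF P2] gen3_cells[OF P3] cod3_cells[OF P3] comp13_cells[OF P3]
  comp31_cells[OF P3] comp23_cells[OF P3] comp32_cells[OF P3] comp13_id1[OF P3] comp23_id2[OF P3]
  free_precat_simps[OF P3]

abbreviation "C \<equiv> free_precat P"

definition R :: "('o, 'a, 'b, 'c) pcell rel" where
  "R = generated_congruence 3 C {(C3 (src4 P G), C3 (tgt4 P G)) | G. G \<in> gen4 P}"

definition equiv3 :: "('o, 'a, 'b, 'c) cell3 \<Rightarrow> ('o, 'a, 'b, 'c) cell3 \<Rightarrow> bool" (infix "\<approx>" 50) where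
  "F \<approx> G \<longleftrightarrow> (C3 F, C3 G) \<in> R"

lemma composable_free_iff: "composable 3 C k l u v \<longleftrightarrow>
    k \<in> {1..3} \<and> l \<in> {1..3} \<and> u \<in> cells C k \<and> v \<in> cells C l \<and>
    ibdry C Pos (min k l - 1) k u = ibdry C Neg (min k l - 1) l v"
  by (simp add: composable_def)

text \<open>This is the largest congruence. It contains the pairs of sides of 4-generators, so it is
  the witness that makes \<open>R\<close> a congruence, and it bounds \<open>R\<close> from above,
  which yields \<open>equiv3_cells\<close>.\<close>

lemma congruence_parallel:
  "congruence 3 C {(C3 F, C3 G) | F G. F \<in> cells3 P \<and> G \<in> cells3 P \<and>
     dom3 F = dom3 G \<and> cod3 P F = cod3 P G}"
proof -
  note [simp] = numeral_2_eq_2[symmetric] numeral_3_eq_3[symmetric] ibdry_numeral[OF P3]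
  have less3: "i < 3 \<longleftrightarrow> i = 0 \<or> i = 1 \<or> i = (2::nat)" for i by auto
  show ?thesis
    unfolding congruence_def composable_free_iff less3
    apply (intro conjI)
    subgoal by (rule equivI) (auto simp: refl_on_def sym_def trans_def)
    subgoal by (auto simp: parallel_def elim: sign.exhaust)
    subgoal by auto
    done
qed

lemma congruence_R: "congruence 3 C R"
  unfolding R_def
  by (rule congruence_generated[OF congruence_parallel]) (use P4 in \<open>auto simp: prepolygraph4_def\<close>)

lemma equiv3_cells:
  assumes "F \<approx> G"
  shows "F \<in> cells3 P" "G \<in> cells3 P" "dom3 F = dom3 G" "cod3 P F = cod3 P G"
proof -
  have "R \<subseteq> {(C3 F, C3 G) | F G. F \<in> cells3 P \<and> G \<in> cells3 P \<and> dom3 F = dom3 G \<and> cod3 P F = cod3 P G}"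
    unfolding R_def generated_congruence_def
    by (rule Inter_lower) (use congruence_parallel P4 in \<open>auto simp: prepolygraph4_def\<close>)
  then show "F \<in> cells3 P" "G \<in> cells3 P" "dom3 F = dom3 G" "cod3 P F = cod3 P G"
    using assms by (auto simp: equiv3_def)
qed

lemma equiv_R: "equiv (C3 ` cells3 P) R"
  using congruence_R by (simp add: congruence_def)

lemma equiv3_refl: "F \<in> cells3 P \<Longrightarrow> F \<approx> F"
  using equiv_R by (auto simp: equiv3_def equiv_def refl_on_def)

lemma equiv3_sym: "F \<approx> G \<Longrightarrow> G \<approx> F"
  using equiv_R by (auto simp: equiv3_def equiv_def sym_def)

lemma equiv3_trans [trans]: "F \<approx> G \<Longrightarrow> G \<approx> H \<Longrightarrow> F \<approx> H"
  using equiv_R unfolding equiv3_def equiv_def by (meson transD)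

lemma equiv3_gen4: "G \<in> gen4 P \<Longrightarrow> src4 P G \<approx> tgt4 P G"
  using generated_congruence_incl unfolding equiv3_def R_def by fast

lemma R_whisker:
  assumes "F \<approx> F'" "i < 3" "v \<in> cells C (i + 1)" "w \<in> cells C (i + 1)"
    "composable 3 C (i + 1) 3 v (C3 F)" "composable 3 C 3 (i + 1) (comp C (i + 1) 3 v (C3 F)) w"
  shows "(comp C 3 (i + 1) (comp C (i + 1) 3 v (C3 F)) w,
    comp C 3 (i + 1) (comp C (i + 1) 3 v (C3 F')) w) \<in> R"
  using congruence_R assms unfolding congruence_def equiv3_def by fast

lemma equiv3_whisker1:
  assumes "F \<approx> F'" "l \<in> cells1 P" "r \<in> cells1 P"
    "cod1 P l = dom1 (dom2 (dom3 F))" "cod1 P (dom2 (dom3 F)) = dom1 r"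
  shows "l \<star>\<^sub>1\<^sub>3 F \<star>\<^sub>3\<^sub>1 r \<approx> l \<star>\<^sub>1\<^sub>3 F' \<star>\<^sub>3\<^sub>1 r"
  using R_whisker[OF assms(1), of 0 "C1 l" "C1 r"] assms equiv3_cells(1)[OF assms(1)]
  by (simp add: equiv3_def composable_free_iff ibdry_numeral[OF P3])

lemma equiv3_whisker2:
  assumes "F \<approx> F'" "\<kappa> \<in> cells2 P" "\<rho> \<in> cells2 P"
    "cod2 P \<kappa> = dom2 (dom3 F)" "cod2 P (dom3 F) = dom2 \<rho>"
  shows "\<kappa> \<star>\<^sub>2\<^sub>3 F \<star>\<^sub>3\<^sub>2 \<rho> \<approx> \<kappa> \<star>\<^sub>2\<^sub>3 F' \<star>\<^sub>3\<^sub>2 \<rho>"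
  using R_whisker[OF assms(1), of 1 "C2 \<kappa>" "C2 \<rho>"] assms equiv3_cells(1)[OF assms(1)]
  by (simp add: equiv3_def composable_free_iff ibdry_numeral[OF P3] numeral_2_eq_2[symmetric])

lemma equiv3_whisker3:
  assumes "F \<approx> F'" "G \<in> cells3 P" "H \<in> cells3 P" "cod3 P G = dom3 F" "cod3 P F = dom3 H"
  shows "G \<star>\<^sub>3\<^sub>3 F \<star>\<^sub>3\<^sub>3 H \<approx> G \<star>\<^sub>3\<^sub>3 F' \<star>\<^sub>3\<^sub>3 H"
  using R_whisker[OF assms(1), of 2 "C3 G" "C3 H"] assms equiv3_cells(1)[OF assms(1)]
  by (simp add: equiv3_def composable_free_iff ibdry_numeral[OF P3] numeral_3_eq_3[symmetric])

lemma equiv3_comp_left: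
  assumes "F \<approx> F'" "G \<in> cells3 P" "cod3 P G = dom3 F"
  shows "G \<star>\<^sub>3\<^sub>3 F \<approx> G \<star>\<^sub>3\<^sub>3 F'"
  using equiv3_whisker3[OF assms(1,2), of "id3 (cod3 P F)"] assms equiv3_cells[OF assms(1)] by simp

lemma equiv3_comp_right:
  assumes "F \<approx> F'" "H \<in> cells3 P" "cod3 P F = dom3 H"
  shows "F \<star>\<^sub>3\<^sub>3 H \<approx> F' \<star>\<^sub>3\<^sub>3 H"
  using equiv3_whisker3[OF assms(1) _ assms(2), of "id3 (dom3 F)"] assms equiv3_cells[OF assms(1)] by simp


subsection \<open>Zigzags in the localization\<close>

abbreviation "Q \<equiv> presented_precat P"

definition cls :: "('o, 'a, 'b, 'c) cell3 \<Rightarrow> ('o, 'a, 'b, 'c) pcell set" where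
  "cls F = R `` {C3 F}"

lemma cls_eq: "F \<approx> G \<Longrightarrow> cls F = cls G"
  using equiv_class_eq[OF equiv_R] by (simp add: cls_def equiv3_def)

text \<open>Operations of the quotient act on a chosen element of a class, which is only known to be
  congruent to \<open>F\<close>.\<close>

lemma representative_cls:
  assumes "F \<in> cells3 P"
  obtains F' where "representative (cls F) = C3 F'" "F \<approx> F'"
proof -
  have "C3 F \<in> cls F"
    using equiv3_refl[OF assms] by (simp add: cls_def equiv3_def)
  then have "representative (cls F) \<in> cls F"
    unfolding representative_def by (rule someI)
  then have "(C3 F, representative (cls F)) \<in> R"
    by (simp add: cls_def)
  moreover from this have "representative (cls F) \<in> C3 ` cells3 P"
    using equiv_R by (auto simp: equiv_def)
  ultimately show thesis
    using that by (auto simp: equiv3_def)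
qed

lemma representative_singleton [simp]: "representative {u} = u"
  by (simp add: representative_def)

lemma presented_eq: "Q = quotient_precat 3 C R"
  by (simp add: presented_precat_def R_def)

lemma cells_Q: "cells Q 2 = (\<lambda>\<phi>. {C2 \<phi>}) ` cells2 P" "cells Q 3 = cls ` cells3 P"
  by (auto simp: presented_eq quotient_precat_def quotient_class_def cls_def)

lemma bdry_Q [simp]:
  assumes "F \<in> cells3 P"
  shows "bdry Q Neg 2 (cls F) = {C2 (dom3 F)}" "bdry Q Pos 2 (cls F) = {C2 (cod3 P F)}"
proof -
  from assms obtain F' where "representative (cls F) = C3 F'" "F \<approx> F'"
    by (rule representative_cls)
  then show "bdry Q Neg 2 (cls F) = {C2 (dom3 F)}" "bdry Q Pos 2 (cls F) = {C2 (cod3 P F)}"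
    using equiv3_cells[OF \<open>F \<approx> F'\<close>] by (simp_all add: presented_eq quotient_precat_def quotient_class_def)
qed

lemma comp_Q:
  assumes "F \<in> cells3 P" "G \<in> cells3 P" "cod3 P F = dom3 G"
  shows "comp Q 3 3 (cls F) (cls G) = cls (F \<star>\<^sub>3\<^sub>3 G)"
proof -
  obtain F' where F': "representative (cls F) = C3 F'" "F \<approx> F'"
    using assms(1) by (rule representative_cls)
  obtain G' where G': "representative (cls G) = C3 G'" "G \<approx> G'"
    using assms(2) by (rule representative_cls)
  have "F \<star>\<^sub>3\<^sub>3 G \<approx> F' \<star>\<^sub>3\<^sub>3 G"
    using equiv3_comp_right F' assms by blast
  also have "F' \<star>\<^sub>3\<^sub>3 G \<approx> F' \<star>\<^sub>3\<^sub>3 G'"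
    using equiv3_comp_left[OF G'(2)] equiv3_cells[OF F'(2)] assms by simp
  finally show ?thesis
    using F'(1) G'(1) cls_eq
    by (simp add: presented_eq quotient_precat_def quotient_class_def cls_def[symmetric])
qed

lemma composable_Q:
  assumes "F \<in> cells3 P" "G \<in> cells3 P" "cod3 P F = dom3 G"
  shows "composable 3 Q 3 3 (cls F) (cls G)"
  using assms by (simp add: composable_def cells_Q numeral_2_eq_2[symmetric] numeral_3_eq_3[symmetric] ibdry_numeral[OF P3])

abbreviation "Z \<equiv> zigzag_precat 3 Q"

lemma cells_Z: "cells Z 3 = {Zig {C2 \<phi>} zs | \<phi> zs. \<phi> \<in> cells2 P \<and> zchain 3 Q {C2 \<phi>} zs}"
  by (auto simp: zigzag_precat_def cells_Q)

lemma zchain_Cons_cls: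
  assumes "zchain 3 Q {C2 \<phi>} (z # zs)"
  obtains F where "F \<in> cells3 P" "z = (Pos, cls F)" "dom3 F = \<phi>" "zchain 3 Q {C2 (cod3 P F)} zs"
  | F where "F \<in> cells3 P" "z = (Neg, cls F)" "cod3 P F = \<phi>" "zchain 3 Q {C2 (dom3 F)} zs"
  using assms by (cases z; cases "fst z") (auto simp: cells_Q)

definition zend :: "('o, 'a, 'b, 'c) pcell set \<Rightarrow> (sign \<times> ('o, 'a, 'b, 'c) pcell set) list \<Rightarrow>
    ('o, 'a, 'b, 'c) pcell set" where
  "zend U zs = ztarget 3 Q (Zig U zs)"

lemma zend_simps [simp]: "zend U [] = U" "zend U (z # zs) = zend (zbdry 3 Q Pos z) zs"
  by (simp_all add: zend_def)

lemma zchain_append: "zchain 3 Q U (zs @ zs') \<longleftrightarrow> zchain 3 Q U zs \<and> zchain 3 Q (zend U zs) zs'"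
  by (induction zs arbitrary: U) auto

lemma zend_append: "zend U (zs @ zs') = zend (zend U zs) zs'"
  by (induction zs arbitrary: U) auto

lemma zend_cells:
  assumes "\<phi> \<in> cells2 P" "zchain 3 Q {C2 \<phi>} zs"
  obtains \<psi> where "\<psi> \<in> cells2 P" "zend {C2 \<phi>} zs = {C2 \<psi>}"
proof -
  have "\<exists>\<psi> \<in> cells2 P. zend {C2 \<phi>} zs = {C2 \<psi>}"
    using assms
  proof (induction zs arbitrary: \<phi>)
    case (Cons z zs)
    from Cons.prems(2) show ?case
      by (cases rule: zchain_Cons_cls) (use Cons.IH in auto)
  qed auto
  then show thesis using that by blast
qed

text \<open>
  It suffices to relate cells in every admissible congruence \<open>T\<close>; that such a \<open>T\<close> exists is
  irrelevant, because the intersection of the empty family relates everything.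
\<close>

context
  fixes T
  assumes T: "congruence 3 Z T" and rels: "localization_relations 3 Q \<subseteq> T"
begin

lemma equiv_T: "equiv (cells Z 3) T"
  using T by (simp add: congruence_def)

lemma T_sym: "(x, y) \<in> T \<Longrightarrow> (y, x) \<in> T"
  using equiv_T by (auto simp: equiv_def sym_def)

lemma T_trans [trans]: "(x, y) \<in> T \<Longrightarrow> (y, z) \<in> T \<Longrightarrow> (x, z) \<in> T"
  using equiv_T unfolding equiv_def by (meson transD)

lemma T_refl: "\<phi> \<in> cells2 P \<Longrightarrow> zchain 3 Q {C2 \<phi>} zs \<Longrightarrow> (Zig {C2 \<phi>} zs, Zig {C2 \<phi>} zs) \<in> T"
  using equiv_T by (auto simp: equiv_def refl_on_def cells_Z)

text \<open>Composition of zigzags along 2-cells is concatenation, so stability of \<open>T\<close>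
  under whiskering with 3-cells (\<open>i = 2\<close>) allows a segment to be replaced inside a
  zigzag.\<close>

lemma T_context:
  assumes "\<phi> \<in> cells2 P" "zchain 3 Q {C2 \<phi>} (zs @ us @ zs')" "zend {C2 \<phi>} zs = U"
    "(Zig U us, Zig U us') \<in> T"
  shows "(Zig {C2 \<phi>} (zs @ us @ zs'), Zig {C2 \<phi>} (zs @ us' @ zs')) \<in> T"
proof -
  obtain \<psi> where \<psi>: "\<psi> \<in> cells2 P" "U = {C2 \<psi>}"
    using zend_cells assms zchain_append by metis
  obtain \<psi>' where \<psi>': "\<psi>' \<in> cells2 P" "zend {C2 \<psi>} us = {C2 \<psi>'}"
    using zend_cells assms zchain_append \<psi> by metis
  have b: "bdry Z Pos 2 (Zig V vs) = Low (zend V vs)" "bdry Z Neg 2 (Zig V vs) = Low V" for V vs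
    by (simp_all add: zigzag_precat_def zend_def)
  have c: "comp Z 3 3 (Zig V vs) (Zig V' vs') = Zig V (vs @ vs')" for V vs V' vs'
    by (simp add: zigzag_precat_def)
  have whisker: "\<forall>i < 3. \<forall>v \<in> cells Z (i + 1). \<forall>w \<in> cells Z (i + 1).
      composable 3 Z (i + 1) 3 v (Zig U us) \<longrightarrow>
      composable 3 Z 3 (i + 1) (comp Z (i + 1) 3 v (Zig U us)) w \<longrightarrow>
      (comp Z 3 (i + 1) (comp Z (i + 1) 3 v (Zig U us)) w,
       comp Z 3 (i + 1) (comp Z (i + 1) 3 v (Zig U us')) w) \<in> T"
    using T assms(4) unfolding congruence_def by fast
  have "composable 3 Z 3 3 (Zig {C2 \<phi>} zs) (Zig U us)"
    "composable 3 Z 3 3 (Zig {C2 \<phi>} (zs @ us)) (Zig {C2 \<psi>'} zs')"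
    "Zig {C2 \<phi>} zs \<in> cells Z 3" "Zig {C2 \<psi>'} zs' \<in> cells Z 3"
    using assms(1-3) \<psi> \<psi>' 
    by (auto simp: composable_def cells_Z b zchain_append zend_append numeral_2_eq_2[symmetric] numeral_3_eq_3[symmetric] ibdry_numeral[OF P3])
  then have "(comp Z 3 3 (comp Z 3 3 (Zig {C2 \<phi>} zs) (Zig U us)) (Zig {C2 \<psi>'} zs'),
      comp Z 3 3 (comp Z 3 3 (Zig {C2 \<phi>} zs) (Zig U us')) (Zig {C2 \<psi>'} zs')) \<in> T"
    using whisker[rule_format, of 2 "Zig {C2 \<phi>} zs" "Zig {C2 \<psi>'} zs'"]
    by (simp add: c numeral_3_eq_3[symmetric])
  then show ?thesis by (simp add: c)
qed

lemma T_comp: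
  assumes "F \<in> cells3 P" "G \<in> cells3 P" "cod3 P F = dom3 G"
  shows "(Zig {C2 (dom3 F)} [(Pos, cls F), (Pos, cls G)], Zig {C2 (dom3 F)} [(Pos, cls (F \<star>\<^sub>3\<^sub>3 G))]) \<in> T"
proof -
  have "(Zig (bdry Q Neg (3 - 1) (cls F)) [(Pos, cls F), (Pos, cls G)],
     Zig (bdry Q Neg (3 - 1) (cls F)) [(Pos, comp Q 3 3 (cls F) (cls G))]) \<in> T"
    using rels composable_Q[OF assms] unfolding localization_relations_def by blast
  then show ?thesis using assms by (simp add: comp_Q)
qed

lemma T_inverse:
  assumes "F \<in> cells3 P"
  shows "(Zig {C2 (dom3 F)} [(Pos, cls F), (Neg, cls F)], Zig {C2 (dom3 F)} []) \<in> T"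
    "(Zig {C2 (cod3 P F)} [(Neg, cls F), (Pos, cls F)], Zig {C2 (cod3 P F)} []) \<in> T"
proof -
  have "cls F \<in> cells Q 3" using assms by (simp add: cells_Q)
  then have "(Zig (bdry Q Neg (3 - 1) (cls F)) [(Pos, cls F), (Neg, cls F)],
      Zig (bdry Q Neg (3 - 1) (cls F)) []) \<in> T"
    "(Zig (bdry Q Pos (3 - 1) (cls F)) [(Neg, cls F), (Pos, cls F)],
      Zig (bdry Q Pos (3 - 1) (cls F)) []) \<in> T"
    using rels unfolding localization_relations_def by blast+
  then show "(Zig {C2 (dom3 F)} [(Pos, cls F), (Neg, cls F)], Zig {C2 (dom3 F)} []) \<in> T"
    "(Zig {C2 (cod3 P F)} [(Neg, cls F), (Pos, cls F)], Zig {C2 (cod3 P F)} []) \<in> T"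
    using assms by simp_all
qed

text \<open>A factor \<open>F\<close> is absorbed by \<open>step\<close>. A formal inverse of
  \<open>F\<close> ends at \<open>dom3 F\<close>; there \<open>step\<close>, read backwards,
  replaces \<open>N (dom3 F)\<close> by \<open>F\<close> followed by \<open>N (cod3 P F)\<close>,
  and \<open>F\<close> cancels against its inverse.\<close>

lemma zigzags_to_normal_form:
  assumes N: "\<And>\<phi>. \<phi> \<in> cells2 P \<Longrightarrow> N \<phi> \<in> cells3 P \<and> dom3 (N \<phi>) = \<phi>"
    and step: "\<And>F. F \<in> cells3 P \<Longrightarrow> F \<star>\<^sub>3\<^sub>3 N (cod3 P F) \<approx> N (dom3 F)"
    and "\<phi> \<in> cells2 P" "\<psi> \<in> cells2 P" "zchain 3 Q {C2 \<phi>} zs" "zend {C2 \<phi>} zs = {C2 \<psi>}"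
  shows "(Zig {C2 \<phi>} (zs @ [(Pos, cls (N \<psi>))]), Zig {C2 \<phi>} [(Pos, cls (N \<phi>))]) \<in> T"
  using assms(3-6)
proof (induction zs arbitrary: \<phi>)
  case Nil
  then show ?case using N[of \<phi>] by (simp add: T_refl cells_Q)
next
  case (Cons z zs)
  have post: "cls (N \<chi>) \<in> cells Q 3" if "\<chi> \<in> cells2 P" for \<chi>
    using N[OF that] by (simp add: cells_Q)
  have ch: "zchain 3 Q {C2 \<phi>} ((z # zs) @ [(Pos, cls (N \<psi>))])"
    using Cons.prems N post unfolding zchain_append by simp
  have comp_step: "(Zig {C2 (dom3 F)} [(Pos, cls F), (Pos, cls (N (cod3 P F)))],
      Zig {C2 (dom3 F)} [(Pos, cls (N (dom3 F)))]) \<in> T" if "F \<in> cells3 P" for F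
    using T_comp[OF that, of "N (cod3 P F)"] N that cls_eq[OF step[OF that]] by simp
  from Cons.prems(3) show ?case
  proof (cases rule: zchain_Cons_cls)
    case a: (1 F)
    have "(Zig {C2 \<phi>} ([z] @ (zs @ [(Pos, cls (N \<psi>))]) @ []), Zig {C2 \<phi>} ([z] @ [(Pos, cls (N (cod3 P F)))] @ [])) \<in> T"
      by (rule T_context) (use ch Cons a in auto)
    also have "(Zig {C2 \<phi>} ([z] @ [(Pos, cls (N (cod3 P F)))] @ []), Zig {C2 \<phi>} [(Pos, cls (N \<phi>))]) \<in> T"
      using comp_step a by auto
    finally show ?thesis by simp
  next
    case a: (2 F)
    let ?n = "\<lambda>\<chi>. (Pos, cls (N \<chi>))"
    have 1: "(Zig {C2 \<phi>} ([z] @ (zs @ [?n \<psi>]) @ []), Zig {C2 \<phi>} ([z] @ [?n (dom3 F)] @ [])) \<in> T"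
      by (rule T_context) (use ch Cons a in auto)
    have 2: "(Zig {C2 \<phi>} ([z] @ [?n (dom3 F)] @ []), Zig {C2 \<phi>} ([z] @ [(Pos, cls F), ?n \<phi>] @ [])) \<in> T"
      by (rule T_context) (use ch Cons a N post T_sym[OF comp_step] in \<open>auto simp: cells_Q\<close>)
    have 3: "(Zig {C2 \<phi>} ([] @ [z, (Pos, cls F)] @ [?n \<phi>]), Zig {C2 \<phi>} ([] @ [] @ [?n \<phi>])) \<in> T"
      by (rule T_context) (use ch Cons a N post T_inverse in \<open>auto simp: cells_Q\<close>)
    show ?thesis using T_trans[OF T_trans[OF 1 2]] 3 by simp
  qed
qed

lemma parallel_zigzags:
  assumes N: "\<And>\<phi>. \<phi> \<in> cells2 P \<Longrightarrow> N \<phi> \<in> cells3 P \<and> dom3 (N \<phi>) = \<phi>"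
    and step: "\<And>F. F \<in> cells3 P \<Longrightarrow> F \<star>\<^sub>3\<^sub>3 N (cod3 P F) \<approx> N (dom3 F)"
    and "x \<in> cells Z 3" "y \<in> cells Z 3" "zsource x = zsource y" "ztarget 3 Q x = ztarget 3 Q y"
  shows "(x, y) \<in> T"
proof -
  obtain \<phi> zs zs' where x: "x = Zig {C2 \<phi>} zs" and y: "y = Zig {C2 \<phi>} zs'" and \<phi>: "\<phi> \<in> cells2 P"
    and ch: "zchain 3 Q {C2 \<phi>} zs" "zchain 3 Q {C2 \<phi>} zs'"
    using assms(3-5) by (auto simp: cells_Z)
  obtain \<psi> where \<psi>: "\<psi> \<in> cells2 P" and e: "zend {C2 \<phi>} zs = {C2 \<psi>}"
    using zend_cells[OF \<phi> ch(1)] .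
  have e': "zend {C2 \<phi>} zs' = {C2 \<psi>}"
    using e assms(6) x y by (simp add: zend_def)
  let ?p = "(Pos, cls (N \<psi>))" and ?n = "(Neg, cls (N \<psi>))"
  have *: "(Zig {C2 \<phi>} us, Zig {C2 \<phi>} [(Pos, cls (N \<phi>)), ?n]) \<in> T"
    if us: "zchain 3 Q {C2 \<phi>} us" "zend {C2 \<phi>} us = {C2 \<psi>}" for us
  proof -
    \<comment> \<open>Append \<open>N \<psi>\<close> and its formal inverse; the zigzag together
      with \<open>N \<psi>\<close> then collapses to \<open>N \<phi>\<close>.\<close>
    have 1: "(Zig {C2 \<phi>} (us @ [?p, ?n] @ []), Zig {C2 \<phi>} (us @ [] @ [])) \<in> T"
      by (rule T_context) (use us \<phi> \<psi> N T_inverse(1)[of "N \<psi>"] in \<open>auto simp: cells_Q zchain_append\<close>)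
    have 2: "(Zig {C2 \<phi>} ([] @ (us @ [?p]) @ [?n]), Zig {C2 \<phi>} ([] @ [(Pos, cls (N \<phi>))] @ [?n])) \<in> T"
      by (rule T_context)
        (use us \<phi> \<psi> N zigzags_to_normal_form[of N, OF N step \<phi> \<psi> us] in
          \<open>auto simp: cells_Q zchain_append zend_append\<close>)
    show ?thesis using T_trans[OF T_sym[OF 1]] 2 by simp
  qed
  show ?thesis
    unfolding x y by (rule T_trans[OF *[OF ch(1) e] T_sym[OF *[OF ch(2) e']]])
qed

end

text \<open>The second hypothesis makes \<open>N\<close> a cone: congruent 3-cells have equal
  targets, so \<open>N\<close> ends at the same 2-cell from both ends of every 3-cell.\<close>

lemma coherentI:
  assumes N: "\<And>\<phi>. \<phi> \<in> cells2 P \<Longrightarrow> N \<phi> \<in> cells3 P \<and> dom3 (N \<phi>) = \<phi>"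
    and step: "\<And>F. F \<in> cells3 P \<Longrightarrow> F \<star>\<^sub>3\<^sub>3 N (cod3 P F) \<approx> N (dom3 F)"
  shows "coherent P"
proof -
  define S where "S = generated_congruence 3 Z (localization_relations 3 Q)"
  let ?L = "quotient_precat 3 Z S"
  have S: "(x, y) \<in> S" if "x \<in> cells Z 3" "y \<in> cells Z 3" "zsource x = zsource y"
    "ztarget 3 Q x = ztarget 3 Q y" for x y
    unfolding S_def generated_congruence_def
    using parallel_zigzags[of _ N, OF _ _ N step] that by blast
  have "F = G" if F: "F \<in> cells ?L 3" and G: "G \<in> cells ?L 3" and par: "parallel ?L 3 F G" for F G
  proof (cases "\<exists>T. congruence 3 Z T \<and> localization_relations 3 Q \<subseteq> T")
    case False
    \<comment> \<open>All classes are then \<open>UNIV\<close>, so the localization has a single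
      3-cell.\<close>
    then have "S = UNIV" by (auto simp: S_def generated_congruence_def)
    then show ?thesis using F G by (auto simp: quotient_precat_def quotient_class_def)
  next
    case True
    have cells_L: "cells ?L 3 = (\<lambda>x. S `` {x}) ` cells Z 3"
      by (simp add: quotient_precat_def quotient_class_def)
    from True have "congruence 3 Z S"
      unfolding S_def using congruence_generated by blast
    then have eqS: "equiv (cells Z 3) S"
      unfolding congruence_def by (rule conjunct1)
    have rep: "representative H \<in> cells Z 3" "S `` {representative H} = H" if H: "H \<in> cells ?L 3" for H
    proof -
      obtain x where x: "H = S `` {x}" "x \<in> cells Z 3"
        using H[unfolded cells_L] by (rule imageE)
      have "(x, x) \<in> S" using eqS x(2) by (simp add: equiv_def refl_on_def)
      then have "x \<in> H" using x(1) by simp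
      then have "representative H \<in> H" unfolding representative_def by (rule someI)
      then have r: "(x, representative H) \<in> S" using x by simp
      then show "representative H \<in> cells Z 3" using eqS by (auto simp: equiv_def)
      show "S `` {representative H} = H" using x(1) equiv_class_eq[OF eqS r] by simp
    qed
    \<comment> \<open>In the quotient, 2-cells are singletons, so being parallel there transfers to
      the chosen zigzags.\<close>
    have "bdry Z e 2 (representative F) = bdry Z e 2 (representative G)" for e
      using par by (simp add: parallel_def quotient_precat_def quotient_class_def)
    moreover obtain \<phi> zs where f: "representative F = Zig {C2 \<phi>} zs"
      using rep(1)[OF F] unfolding cells_Z by blast
    moreover obtain \<psi> zs' where g: "representative G = Zig {C2 \<psi>} zs'"
      using rep(1)[OF G] unfolding cells_Z by blast
    ultimately have b: "bdry Z e 2 (Zig {C2 \<phi>} zs) = bdry Z e 2 (Zig {C2 \<psi>} zs')" for e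
      by simp
    have "(representative F, representative G) \<in> S"
      by (rule S) (use rep(1)[OF F] rep(1)[OF G] f g b[of Neg] b[of Pos] in \<open>simp_all add: zigzag_precat_def\<close>)
    from equiv_class_eq[OF eqS this] rep(2)[OF F] rep(2)[OF G] show ?thesis by simp
  qed
  then show ?thesis
    by (auto simp: coherent_def localization_def S_def Let_def)
qed


subsection \<open>Termination and local confluence imply coherence\<close>

definition normal :: "('o, 'a, 'b) cell2 \<Rightarrow> bool" where
  "normal \<phi> \<longleftrightarrow> (\<forall>w. wh3_ok P w \<longrightarrow> wh3_src P w \<noteq> \<phi>)"

lemma Cell3_Cons_cells:
  assumes "Cell3 \<phi> (w # ws) \<in> cells3 P"
  shows "wh3_ok P w" "wh3_src P w = \<phi>" "Cell3 \<phi> [w] \<in> cells3 P" "Cell3 (wh3_tgt P w) ws \<in> cells3 P"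
    "Cell3 \<phi> (w # ws) = Cell3 \<phi> [w] \<star>\<^sub>3\<^sub>3 Cell3 (wh3_tgt P w) ws"
    "cod3 P (Cell3 \<phi> [w]) = wh3_tgt P w" "cod3 P (Cell3 (wh3_tgt P w) ws) = cod3 P (Cell3 \<phi> (w # ws))"
proof -
  have *: "\<phi> \<in> cells2 P" "wh3_ok P w" "wh3_src P w = \<phi>" "path3 P (wh3_tgt P w) ws"
    using assms unfolding cells3_def by simp_all
  then show "wh3_ok P w" "wh3_src P w = \<phi>" "Cell3 \<phi> [w] \<in> cells3 P" "Cell3 (wh3_tgt P w) ws \<in> cells3 P"
    using wh3_ok_bdry(2)[OF P3 *(2)] unfolding cells3_def by simp_all
qed (simp_all add: comp33_def cod3_def)

text \<open>Local confluence is demanded for the 3-cells themselves: the two completions must be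
  congruent, which includes that they end at the same 2-cell.\<close>

theorem squier:
  fixes m :: "('o, 'a, 'b) cell2 \<Rightarrow> nat"
  assumes decreasing: "\<And>w. wh3_ok P w \<Longrightarrow> m (wh3_tgt P w) < m (wh3_src P w)"
    and confluent: "\<And>w w'. wh3_ok P w \<Longrightarrow> wh3_ok P w' \<Longrightarrow> wh3_src P w = wh3_src P w' \<Longrightarrow>
      \<exists>vs vs'. Cell3 (wh3_src P w) (w # vs) \<approx> Cell3 (wh3_src P w) (w' # vs')"
  shows "coherent P"
proof -
  have ex: "\<exists>F \<in> cells3 P. dom3 F = \<phi> \<and> normal (cod3 P F)" if "\<phi> \<in> cells2 P" for \<phi>
    using that
  proof (induction "m \<phi>" arbitrary: \<phi> rule: less_induct)
    case less
    show ?case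
    proof (cases "normal \<phi>")
      case True
      then show ?thesis using less.prems by (intro bexI[of _ "id3 \<phi>"]) auto
    next
      case False
      then obtain w where w: "wh3_ok P w" "wh3_src P w = \<phi>" by (auto simp: normal_def)
      then obtain F where F: "F \<in> cells3 P" "dom3 F = wh3_tgt P w" "normal (cod3 P F)"
        using less.hyps[of "wh3_tgt P w"] decreasing wh3_ok_bdry[OF P3] by blast
      have "Cell3 \<phi> [w] \<in> cells3 P" "cod3 P (Cell3 \<phi> [w]) = dom3 F"
        using w F less.prems unfolding cells3_def cod3_def by simp_all
      then show ?thesis using F by (intro bexI[of _ "Cell3 \<phi> [w] \<star>\<^sub>3\<^sub>3 F"]) auto
    qed
  qed
  \<comment> \<open>The targets are not assumed equal; that they agree is part of the
    conclusion.\<close>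
  have unique: "F \<approx> G" if "F \<in> cells3 P" "G \<in> cells3 P" "dom3 F = \<phi>" "dom3 G = \<phi>"
    "normal (cod3 P F)" "normal (cod3 P G)" for F G \<phi>
    using that
  proof (induction "m \<phi>" arbitrary: \<phi> F G rule: less_induct)
    case less
    obtain fs gs where FG: "F = Cell3 \<phi> fs" "G = Cell3 \<phi> gs"
      using less.prems(3,4) by (cases F; cases G) auto
    have trivial: "\<not> normal \<phi>" if "Cell3 \<phi> (w # ws) \<in> cells3 P" for w ws
      using Cell3_Cons_cells(1,2)[OF that] by (auto simp: normal_def)
    show ?case
    proof (cases "fs = [] \<or> gs = []")
      case True
      then have "normal \<phi>"
        using less.prems(5,6) FG by (auto simp: cod3_def)
      then have "fs = []" "gs = []"
        using trivial less.prems(1,2) FG by (cases fs; cases gs; blast)+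
      then show ?thesis using FG less.prems(1) equiv3_refl by simp
    next
      case False
      then obtain w ws w' ws' where s: "F = Cell3 \<phi> (w # ws)" "G = Cell3 \<phi> (w' # ws')"
        using FG by (cases fs; cases gs) auto
      note F = Cell3_Cons_cells[OF less.prems(1)[unfolded s]]
      note G = Cell3_Cons_cells[OF less.prems(2)[unfolded s]]
      obtain vs vs' where c: "Cell3 \<phi> (w # vs) \<approx> Cell3 \<phi> (w' # vs')"
        using confluent[OF F(1) G(1)] F(2) G(2) by auto
      note V = Cell3_Cons_cells[OF equiv3_cells(1)[OF c]]
      note V' = Cell3_Cons_cells[OF equiv3_cells(2)[OF c]]
      \<comment> \<open>\<open>H\<close> extends the common target of the two completions to a
        normal form, so the induction hypothesis compares the rest of \<open>F\<close> with
        \<open>vs\<close> followed by \<open>H\<close>, and the rest of \<open>G\<close> with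
        \<open>vs'\<close> followed by \<open>H\<close>.\<close>
      obtain H where H: "H \<in> cells3 P" "dom3 H = cod3 P (Cell3 \<phi> (w # vs))" "normal (cod3 P H)"
        using ex[OF cod3_cells(1)[OF P3 equiv3_cells(1)[OF c]]] by blast
      have H': "dom3 H = cod3 P (Cell3 \<phi> (w' # vs'))"
        using H equiv3_cells(4)[OF c] by simp
      have 1: "Cell3 (wh3_tgt P w) ws \<approx> Cell3 (wh3_tgt P w) vs \<star>\<^sub>3\<^sub>3 H"
        by (rule less.hyps[OF decreasing[OF F(1), unfolded F(2)]])
          (use F V H less.prems(5) s in simp_all)
      have 2: "Cell3 (wh3_tgt P w') ws' \<approx> Cell3 (wh3_tgt P w') vs' \<star>\<^sub>3\<^sub>3 H"
        by (rule less.hyps[OF decreasing[OF G(1), unfolded G(2)]])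
          (use G V' H H' less.prems(6) s in simp_all)
      have "F = Cell3 \<phi> [w] \<star>\<^sub>3\<^sub>3 Cell3 (wh3_tgt P w) ws"
        using s F(5) by simp
      also have "\<dots> \<approx> Cell3 \<phi> [w] \<star>\<^sub>3\<^sub>3 (Cell3 (wh3_tgt P w) vs \<star>\<^sub>3\<^sub>3 H)"
        by (rule equiv3_comp_left[OF 1 F(3)]) (simp add: F(6))
      also have "\<dots> = Cell3 \<phi> (w # vs) \<star>\<^sub>3\<^sub>3 H"
        by (simp add: comp33_def)
      also have "\<dots> \<approx> Cell3 \<phi> (w' # vs') \<star>\<^sub>3\<^sub>3 H"
        by (rule equiv3_comp_right[OF c H(1)]) (simp add: H)
      also have "\<dots> = Cell3 \<phi> [w'] \<star>\<^sub>3\<^sub>3 (Cell3 (wh3_tgt P w') vs' \<star>\<^sub>3\<^sub>3 H)"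
        by (simp add: comp33_def)
      also have "\<dots> \<approx> Cell3 \<phi> [w'] \<star>\<^sub>3\<^sub>3 Cell3 (wh3_tgt P w') ws'"
        by (rule equiv3_comp_left[OF equiv3_sym[OF 2] G(3)]) (simp add: G(6))
      also have "\<dots> = G" using s G(5) by simp
      finally show ?thesis .
    qed
  qed
  define N where "N \<phi> = (SOME F. F \<in> cells3 P \<and> dom3 F = \<phi> \<and> normal (cod3 P F))" for \<phi>
  have N: "N \<phi> \<in> cells3 P \<and> dom3 (N \<phi>) = \<phi> \<and> normal (cod3 P (N \<phi>))" if "\<phi> \<in> cells2 P" for \<phi>
    unfolding N_def by (rule someI_ex) (use ex[OF that] in blast)
  show ?thesis
  proof (rule coherentI[of N])
    fix F assume F: "F \<in> cells3 P"
    \<comment> \<open>Both sides lead from \<open>dom3 F\<close> to a normal 2-cell.\<close>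
    show "F \<star>\<^sub>3\<^sub>3 N (cod3 P F) \<approx> N (dom3 F)"
      by (rule unique) (use F N[of "cod3 P F"] N[of "dom3 F"] in simp_all)
  qed (use N in blast)
qed

end

section \<open>Closing a branching by one whiskered 4-generator\<close>

fun whisker3 where
  "whisker3 \<kappa> l r \<rho> (Wh3 \<kappa>' l' A r' \<rho>') =
     Wh3 (\<kappa> \<star>\<^sub>2\<^sub>2 (l \<star>\<^sub>1\<^sub>2 \<kappa>' \<star>\<^sub>2\<^sub>1 r)) (l \<star>\<^sub>1\<^sub>1 l') A (r' \<star>\<^sub>1\<^sub>1 r) ((l \<star>\<^sub>1\<^sub>2 \<rho>' \<star>\<^sub>2\<^sub>1 r) \<star>\<^sub>2\<^sub>2 \<rho>)"

lemma steps3_whisker: "steps3 (\<kappa> \<star>\<^sub>2\<^sub>3 (l \<star>\<^sub>1\<^sub>3 F \<star>\<^sub>3\<^sub>1 r) \<star>\<^sub>3\<^sub>2 \<rho>) = map (whisker3 \<kappa> l r \<rho>) (steps3 F)"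
  by (auto simp: comp23_def comp13_def comp31_def comp32_def split: wh3.splits)

context presentation
begin

definition joinable :: "('o, 'a, 'b, 'c) wh3 \<Rightarrow> ('o, 'a, 'b, 'c) wh3 \<Rightarrow> bool" where
  "joinable w w' \<longleftrightarrow>
     (\<exists>vs vs'. Cell3 (wh3_src P w) (w # vs) \<approx> Cell3 (wh3_src P w) (w' # vs'))"

lemma joinable_refl: "wh3_ok P w \<Longrightarrow> joinable w w"
  unfolding joinable_def
  by (intro exI[of _ "[]"] equiv3_refl cells3I) (simp_all add: wh3_ok_bdry[OF P3])

lemma joinable_sym:
  assumes "joinable w w'"
  shows "joinable w' w"
proof -
  obtain vs vs' where "Cell3 (wh3_src P w) (w # vs) \<approx> Cell3 (wh3_src P w) (w' # vs')"
    using assms by (auto simp: joinable_def)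
  from equiv3_sym[OF this] Cell3_Cons_cells(2)[OF equiv3_cells(2)[OF this]] show ?thesis
    by (auto simp: joinable_def)
qed

text \<open>A 4-generator in context relates two full paths, and only their first steps matter for a
  branching. Local confluence thus reduces to matching the heads of the two sides of some
  \<open>G\<close> with the given redexes.\<close>

lemma joinable_gen4:
  assumes G: "G \<in> gen4 P" "steps3 (src4 P G) \<noteq> []" "steps3 (tgt4 P G) \<noteq> []"
    and "\<kappa> \<in> cells2 P" "\<rho> \<in> cells2 P" "l \<in> cells1 P" "r \<in> cells1 P"
    and "cod1 P l = dom1 (dom2 (dom3 (src4 P G)))" "cod1 P (dom2 (dom3 (src4 P G))) = dom1 r"
    and "cod2 P \<kappa> = l \<star>\<^sub>1\<^sub>1 dom2 (dom3 (src4 P G)) \<star>\<^sub>1\<^sub>1 r"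
    and "l \<star>\<^sub>1\<^sub>1 cod2 P (dom3 (src4 P G)) \<star>\<^sub>1\<^sub>1 r = dom2 \<rho>"
    and w: "w = whisker3 \<kappa> l r \<rho> (hd (steps3 (src4 P G)))"
    and w': "w' = whisker3 \<kappa> l r \<rho> (hd (steps3 (tgt4 P G)))"
  shows "joinable w w'"
proof -
  let ?c = "\<lambda>F. \<kappa> \<star>\<^sub>2\<^sub>3 (l \<star>\<^sub>1\<^sub>3 F \<star>\<^sub>3\<^sub>1 r) \<star>\<^sub>3\<^sub>2 \<rho>"
  have c: "?c (src4 P G) \<approx> ?c (tgt4 P G)"
    by (intro equiv3_whisker2 equiv3_whisker1 equiv3_gen4) (use assms in simp_all)
  have d: "?c F = Cell3 (dom3 (?c F)) (whisker3 \<kappa> l r \<rho> (hd (steps3 F)) # map (whisker3 \<kappa> l r \<rho>) (tl (steps3 F)))"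
    if "steps3 F \<noteq> []" for F
    using that steps3_whisker[of \<kappa> l F r \<rho>] by (intro cell3.expand) (cases "steps3 F", simp_all)
  define \<phi> vs vs' where "\<phi> = dom3 (?c (src4 P G))"
    and "vs = map (whisker3 \<kappa> l r \<rho>) (tl (steps3 (src4 P G)))"
    and "vs' = map (whisker3 \<kappa> l r \<rho>) (tl (steps3 (tgt4 P G)))"
  have "Cell3 \<phi> (w # vs) \<approx> Cell3 \<phi> (w' # vs')"
    using c d[OF G(2)] d[OF G(3)] equiv3_cells(3)[OF c] unfolding w w' \<phi>_def vs_def vs'_def by metis
  moreover from this have "wh3_src P w = \<phi>"
    using Cell3_Cons_cells(2) equiv3_cells(1) by blast
  ultimately show ?thesis by (auto simp: joinable_def)
qed

end


section \<open>Pseudomonoids form a Gray presentation\<close>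

fun arity :: "pm2 \<Rightarrow> nat" where
  "arity Mu = 2"
| "arity Eta = 0"

abbreviation W :: "nat \<Rightarrow> pm2 \<Rightarrow> nat \<Rightarrow> (pm0, pm1, pm2) wh2" where
  "W l \<alpha> r \<equiv> Wh2 (bar l) \<alpha> (bar r)"

text \<open>With a single object, every condition on 0-dimensional boundaries becomes
  trivial.\<close>

lemma pm0_eq: "(x :: pm0) = y"
  by (cases x; cases y) simp

lemma dom1_pm [simp]: "dom1 (f :: (pm0, pm1) cell1) = Obj_x"
  and cod1_pm [simp]: "cod1 (P :: (pm0, pm1, 'b, 'z) prepoly2_scheme) f = Obj_x"
  by (rule pm0_eq)+

lemma bar_len [simp]: "bar (len f) = f"
proof -
  have "xs = replicate (length xs) Gen_a" for xs
    by (induction xs) (auto intro: pm1.exhaust)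
  then show ?thesis
    by (cases f) (auto simp: bar_def len_def pm0_eq)
qed

lemma len_bar [simp]: "len (bar n) = n"
  by (simp add: bar_def len_def)

lemma bar_inject [simp]: "bar m = bar n \<longleftrightarrow> m = n"
  by (metis len_bar)

lemma bar_comp [simp]: "bar m \<star>\<^sub>1\<^sub>1 bar n = bar (m + n)"
  by (simp add: comp11_def bar_def replicate_add)

lemma bar_exhaust: obtains n where "f = bar n"
  by (metis bar_len)

lemma id1_pm [simp]: "id1 Obj_x = bar 0"
  by (simp add: id1_def bar_def)

lemma pm_src2_arity [simp]: "pm_src2 \<alpha> = bar (arity \<alpha>)"
  by (cases \<alpha>) auto

text \<open>The generators are defined through the truncations \<open>PMon2\<close> and
  \<open>PMon3\<close>. Here and below, notions evaluated at a truncation are rewritten to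
  \<open>PMon\<close>.\<close>

lemma PMon_simps [simp]:
  "src2 PMon = pm_src2" "tgt2 PMon = (\<lambda>_. bar 1)" "src3 PMon = pm_src3" "tgt3 PMon = pm_tgt3"
  "src4 PMon = pm_src4" "tgt4 PMon = pm_tgt4" "ichg PMon = pm_ichg"
  "gen0 PMon = UNIV" "gen1 PMon = UNIV" "gen2 PMon = UNIV" "gen3 PMon = UNIV"
  "src2 PMon2 = pm_src2" "tgt2 PMon2 = (\<lambda>_. bar 1)"
  "src2 PMon3 = pm_src2" "tgt2 PMon3 = (\<lambda>_. bar 1)" "src3 PMon3 = pm_src3" "tgt3 PMon3 = pm_tgt3"
  "gen0 PMon3 = UNIV" "gen1 PMon3 = UNIV" "gen2 PMon3 = UNIV" "gen3 PMon3 = UNIV"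
  by (simp_all add: PMon_def PMon2_def PMon3_def)

lemma cells1_pm [simp]: "f \<in> cells1 PMon" "f \<in> cells1 PMon3"
proof -
  have "path1 PMon x as" "path1 PMon3 x as" for x as
    by (induction as arbitrary: x) (auto intro: pm0_eq)
  then show "f \<in> cells1 PMon" "f \<in> cells1 PMon3" by (simp_all add: cells1_def)
qed

lemma wh2_pm [simp]: "wh2_ok PMon w" "wh2_ok PMon3 w"
  "wh2_src PMon (W l \<alpha> r) = bar (l + arity \<alpha> + r)" "wh2_tgt PMon (W l \<alpha> r) = bar (l + 1 + r)"
  "wh2_src PMon3 = wh2_src PMon" "wh2_tgt PMon3 = wh2_tgt PMon"
  "wh2_src PMon2 = wh2_src PMon" "wh2_tgt PMon2 = wh2_tgt PMon"
  by (cases w; simp; fail | intro ext, case_tac x, simp; fail | simp; fail)+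

lemma cod2_pm [simp]: "cod2 PMon3 = cod2 PMon" "cod2 PMon2 = cod2 PMon"
  by (auto simp: cod2_def fun_eq_iff)

lemma path2_pm [simp]: "path2 PMon3 = path2 PMon"
proof (intro ext)
  show "path2 PMon3 f ws = path2 PMon f ws" for f ws
    by (induction ws arbitrary: f) auto
qed

lemma cells2_pm [simp]: "cells2 PMon3 = cells2 PMon"
  by (auto simp: cells2_def)

lemma Cell2_cells_pm [simp]: "Cell2 f ws \<in> cells2 PMon \<longleftrightarrow> path2 PMon f ws"
  by (simp add: cells2_def)

lemma gcell2_pm [simp]: "gcell2 PMon2 \<alpha> = Cell2 (bar (arity \<alpha>)) [W 0 \<alpha> 0]"
  "gcell2 PMon3 \<alpha> = Cell2 (bar (arity \<alpha>)) [W 0 \<alpha> 0]" "gcell2 PMon \<alpha> = Cell2 (bar (arity \<alpha>)) [W 0 \<alpha> 0]"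
  by (simp_all add: gcell2_def)

lemma wcell2_pm [simp]: "wcell2 PMon3 = wcell2 PMon" "wcell2 PMon (W l \<alpha> r) = Cell2 (bar (l + arity \<alpha> + r)) [W l \<alpha> r]"
  by (simp_all add: wcell2_def fun_eq_iff)

section \<open>Generators as explicit lists of whiskers\<close>

lemmas comp2_defs = comp12_def comp21_def comp22_def id2_def
lemmas comp3_defs = comp13_def comp31_def comp23_def comp32_def comp33_def id3_def

text \<open>These equations replace the defining ones as simp rules, so that boundaries and overlaps
  are decided by comparing lists. Each source has exactly two entries.\<close>

lemma pm_src3_eval:
  "pm_src3 Assoc = Cell2 (bar 3) [W 0 Mu 1, W 0 Mu 0]"
  "pm_src3 LUnit = Cell2 (bar 1) [W 0 Eta 1, W 0 Mu 0]"
  "pm_src3 RUnit = Cell2 (bar 1) [W 1 Eta 0, W 0 Mu 0]"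
  "pm_src3 (Ichg \<alpha> n \<beta>) = Cell2 (bar (arity \<alpha> + n + arity \<beta>)) [W 0 \<alpha> (n + arity \<beta>), W (1 + n) \<beta> 0]"
  by (simp_all add: comp2_defs interchange_src_def)

lemma pm_tgt3_eval:
  "pm_tgt3 Assoc = Cell2 (bar 3) [W 1 Mu 0, W 0 Mu 0]"
  "pm_tgt3 LUnit = Cell2 (bar 1) []"
  "pm_tgt3 RUnit = Cell2 (bar 1) []"
  "pm_tgt3 (Ichg \<alpha> n \<beta>) = Cell2 (bar (arity \<alpha> + n + arity \<beta>)) [W (arity \<alpha> + n) \<beta> 0, W 0 \<alpha> (n + 1)]"
  by (simp_all add: comp2_defs interchange_tgt_def)

declare pm_src3.simps [simp del] pm_tgt3.simps [simp del]
declare pm_src3_eval [simp] pm_tgt3_eval [simp]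

lemma prepolygraph3_PMon: "prepolygraph3 PMon"
proof -
  have "pm_src3 A \<in> cells2 PMon \<and> pm_tgt3 A \<in> cells2 PMon \<and> dom2 (pm_src3 A) = dom2 (pm_tgt3 A) \<and>
      cod2 PMon (pm_src3 A) = cod2 PMon (pm_tgt3 A)" for A
    by (cases A) (simp_all add: cod2_def)
  then show ?thesis by (simp add: prepolygraph3_def prepolygraph2_def)
qed

lemma gcell3_pm [simp]: "gcell3 PMon3 = gcell3 PMon"
  by (simp add: gcell3_def fun_eq_iff)

lemma swap1_pm [simp]: "swap1 PMon3 X = swap1 PMon X"
proof (intro ext)
  show "swap1 PMon3 X w v = swap1 PMon X w v" for w v
    by (cases w; cases v) simp
qed

lemma swap2_pm [simp]: "swap2 PMon3 X w h vs = swap2 PMon X w h vs"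
  by (induction vs arbitrary: h) simp_all

lemma swap3_pm [simp]: "swap3 PMon3 X f ws \<psi> = swap3 PMon X f ws \<psi>"
  by (induction ws arbitrary: f) simp_all

lemma interchange_pm [simp]: "interchange PMon3 = interchange PMon"
  by (simp add: interchange_def fun_eq_iff)

lemma gray_defs_pm:
  "independence_src PMon3 = independence_src PMon" "independence_tgt PMon3 = independence_tgt PMon"
  "naturality1_src PMon3 = naturality1_src PMon" "naturality1_tgt PMon3 = naturality1_tgt PMon"
  "naturality2_src PMon3 = naturality2_src PMon" "naturality2_tgt PMon3 = naturality2_tgt PMon"
  "interchange_src PMon2 = interchange_src PMon" "interchange_tgt PMon2 = interchange_tgt PMon"
  by (simp_all add: independence_src_def independence_tgt_def naturality1_src_def naturality1_tgt_def
      naturality2_src_def naturality2_tgt_def interchange_src_def interchange_tgt_def fun_eq_iff)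

lemma independence_defined_pm: "independence_defined PMon3 = independence_defined PMon"
  by (simp add: independence_defined_def fun_eq_iff)

lemma Cell3_cells_pm [simp]: "Cell3 \<phi> ws \<in> cells3 PMon \<longleftrightarrow> \<phi> \<in> cells2 PMon \<and> path3 PMon \<phi> ws"
  by (simp add: cells3_def del: dom3_cells)

lemma gcell3_eval [simp]: "gcell3 PMon A = Cell3 (pm_src3 A)
    [Wh3 (Cell2 (dom2 (pm_src3 A)) []) (bar 0) A (bar 0) (Cell2 (cod2 PMon (pm_src3 A)) [])]"
  by (simp add: gcell3_def id2_def)

text \<open>The condition that \<open>prepolygraph4\<close> puts on the two sides of a
  4-generator.\<close>

definition good :: "(pm0, pm1, pm2, pm3) cell3 \<Rightarrow> (pm0, pm1, pm2, pm3) cell3 \<Rightarrow> bool" where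
  "good F G \<longleftrightarrow> F \<in> cells3 PMon \<and> G \<in> cells3 PMon \<and> dom3 F = dom3 G \<and> cod3 PMon F = cod3 PMon G"

lemmas pm_eval = good_def comp2_defs comp3_defs cod3_def cod2_def interchange_def pm_ichg_def

lemma good_Coh:
  "good (pm_src4 Coh1) (pm_tgt4 Coh1)" "good (pm_src4 Coh2) (pm_tgt4 Coh2)" "good (pm_src4 Coh3) (pm_tgt4 Coh3)"
  "good (pm_src4 Coh4) (pm_tgt4 Coh4)" "good (pm_src4 Coh5) (pm_tgt4 Coh5)"
  by (simp_all add: pm_eval)

lemma good_Nat1: "good (pm_src4 (Nat1 A n \<beta>)) (pm_tgt4 (Nat1 A n \<beta>))"
  by (cases A) (simp_all add: pm_eval naturality1_src_def naturality1_tgt_def)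

lemma good_Nat2: "good (pm_src4 (Nat2 \<alpha> n B)) (pm_tgt4 (Nat2 \<alpha> n B))"
  by (cases B) (simp_all add: pm_eval naturality2_src_def naturality2_tgt_def)


lemma gcell3_cells:
  assumes "prepolygraph3 P" "A \<in> gen3 P"
  shows "gcell3 P A \<in> cells3 P" "dom3 (gcell3 P A) = src3 P A" "cod3 P (gcell3 P A) = tgt3 P A"
proof -
  note P2 = P2[OF assms(1)]
  note [simp] = gen3_cells[OF assms(1,2)] cod2_cells[OF P2] comp12_id1[OF P2] cod1_cells[OF P2]
  have s: "src3 P A \<in> cells2 P" by simp
  show "dom3 (gcell3 P A) = src3 P A" "cod3 P (gcell3 P A) = tgt3 P A"
    by (simp_all add: gcell3_def cod3_def)
  show "gcell3 P A \<in> cells3 P"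
    unfolding gcell3_def by (rule cells3I) (use assms(2) in simp_all)
qed

text \<open>The middle cell \<chi> is arbitrary, so the sides do not evaluate to explicit lists.
  Boundaries come from the general closure lemmas instead, with \<open>gcell3_eval\<close> switched
  off.\<close>

lemma good_Indep:
  assumes "\<chi> \<in> cells2 PMon"
    "independence_defined PMon (pm_src3 A) (pm_src3 B) (bar m) (bar n) \<chi> (bar m') (bar n')"
  shows "good (pm_src4 (Indep A B m n \<chi> m' n')) (pm_tgt4 (Indep A B m n \<chi> m' n'))"
proof -
  note P3 = prepolygraph3_PMon
  note [simp] = comp13_cells[OF P3] comp31_cells[OF P3] comp23_cells[OF P3] comp32_cells[OF P3]
    comp12_cells[OF P2[OF P3]] comp21_cells[OF P2[OF P3]] gen3_cells[OF P3, simplified]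
  have [simp]: "gcell3 PMon C \<in> cells3 PMon" "dom3 (gcell3 PMon C) = pm_src3 C"
    "cod3 PMon (gcell3 PMon C) = pm_tgt3 C" for C
    using gcell3_cells[OF P3, of C] by (simp_all del: gcell3_eval)
  have [simp]: "bar m \<star>\<^sub>1\<^sub>1 (cod2 PMon (pm_src3 A) \<star>\<^sub>1\<^sub>1 bar n) = dom2 \<chi>"
    "cod2 PMon \<chi> = bar m' \<star>\<^sub>1\<^sub>1 (dom2 (pm_src3 B) \<star>\<^sub>1\<^sub>1 bar n')"
    using assms(2) by (simp_all add: independence_defined_def)
  show ?thesis
    using assms(1) by (simp add: good_def gray_defs_pm independence_src_def independence_tgt_def del: gcell3_eval)
qed

lemma gen4_PMon:
  "Indep A B m n \<chi> m' n' \<in> gen4 PMon \<longleftrightarrow> \<chi> \<in> cells2 PMon \<and>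
     independence_defined PMon (pm_src3 A) (pm_src3 B) (bar m) (bar n) \<chi> (bar m') (bar n')"
  "Nat1 A n \<beta> \<in> gen4 PMon" "Nat2 \<alpha> n B \<in> gen4 PMon"
  "Coh1 \<in> gen4 PMon" "Coh2 \<in> gen4 PMon" "Coh3 \<in> gen4 PMon" "Coh4 \<in> gen4 PMon" "Coh5 \<in> gen4 PMon"
proof -
  have "gen4 PMon = {Indep A B m n \<chi> m' n' | A B m n \<chi> m' n'. \<chi> \<in> cells2 PMon3 \<and>
      independence_defined PMon3 (pm_src3 A) (pm_src3 B) (bar m) (bar n) \<chi> (bar m') (bar n')}
    \<union> range (\<lambda>(A, n, \<beta>). Nat1 A n \<beta>) \<union> range (\<lambda>(\<alpha>, n, B). Nat2 \<alpha> n B)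
    \<union> {Coh1, Coh2, Coh3, Coh4, Coh5}"
    by (simp only: PMon_def prepoly4.select_convs)
  note * = this
  show "Indep A B m n \<chi> m' n' \<in> gen4 PMon \<longleftrightarrow> \<chi> \<in> cells2 PMon \<and>
      independence_defined PMon (pm_src3 A) (pm_src3 B) (bar m) (bar n) \<chi> (bar m') (bar n')"
    unfolding * independence_defined_pm cells2_pm
    by (simp only: Un_iff mem_Collect_eq image_iff case_prod_unfold pm4.inject pm4.distinct insert_iff empty_iff) blast
  show "Nat1 A n \<beta> \<in> gen4 PMon" "Nat2 \<alpha> n B \<in> gen4 PMon"
    unfolding * using rangeI[of "\<lambda>(A, n, \<beta>). Nat1 A n \<beta>" "(A, n, \<beta>)"]
      rangeI[of "\<lambda>(\<alpha>, n, B). Nat2 \<alpha> n B" "(\<alpha>, n, B)"]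
    by (simp_all only: Un_iff prod.case simp_thms)
  show "Coh1 \<in> gen4 PMon" "Coh2 \<in> gen4 PMon" "Coh3 \<in> gen4 PMon" "Coh4 \<in> gen4 PMon" "Coh5 \<in> gen4 PMon"
    unfolding * by blast+
qed

lemma PMon_families:
  "indep PMon A B e h \<chi> e' h' = Indep A B (len e) (len h) \<chi> (len e') (len h')"
  "nat1 PMon A g \<beta> = Nat1 A (len g) \<beta>" "nat2 PMon \<alpha> g B = Nat2 \<alpha> (len g) B"
  by (simp_all only: PMon_def gray.select_convs)

lemma prepolygraph4_PMon: "prepolygraph4 PMon"
proof -
  have "good (pm_src4 G) (pm_tgt4 G)" if "G \<in> gen4 PMon" for G
  proof (cases G)
    case (Indep A B m n \<chi> m' n')
    then show ?thesis using that good_Indep by (simp only: gen4_PMon)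
  qed (use good_Nat1 good_Nat2 good_Coh in \<open>simp_all only:\<close>)
  then show ?thesis
    unfolding prepolygraph4_def good_def using prepolygraph3_PMon by simp
qed

theorem gray_presentation_PMon: "gray_presentation PMon"
  unfolding gray_presentation_def
proof (intro conjI)
  show "prepolygraph4 PMon" by (rule prepolygraph4_PMon)
  have i: "ichg PMon \<alpha> g \<beta> \<in> gen3 PMon \<and> src3 PMon (ichg PMon \<alpha> g \<beta>) = interchange_src PMon \<alpha> g \<beta> \<and>
    tgt3 PMon (ichg PMon \<alpha> g \<beta>) = interchange_tgt PMon \<alpha> g \<beta>" for \<alpha> g \<beta>
    by (rule bar_exhaust[of g]) (simp add: pm_ichg_def interchange_src_def interchange_tgt_def comp2_defs)
  then show "\<forall>\<alpha> \<in> gen2 PMon. \<forall>g \<in> cells1 PMon. \<forall>\<beta> \<in> gen2 PMon.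
        cod1 PMon (src2 PMon \<alpha>) = dom1 g \<longrightarrow> cod1 PMon g = dom1 (src2 PMon \<beta>) \<longrightarrow>
        ichg PMon \<alpha> g \<beta> \<in> gen3 PMon \<and>
        src3 PMon (ichg PMon \<alpha> g \<beta>) = interchange_src PMon \<alpha> g \<beta> \<and>
        tgt3 PMon (ichg PMon \<alpha> g \<beta>) = interchange_tgt PMon \<alpha> g \<beta>"
    by blast
qed (simp_all add: PMon_families gen4_PMon gray_defs_pm)


section \<open>Local confluence for pseudomonoids\<close>

interpretation PM: presentation PMon
  by unfold_locales (rule prepolygraph4_PMon)

text \<open>The shared whisker \<open>v\<close> is a multiplication if \<open>A\<close> is an
  associator or unitor, and carries the second 2-generator of \<open>A\<close> if \<open>A\<close>
  is an interchanger. Matching it with the first whisker of the source of \<open>A'\<close> leaves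
  only the listed cases.\<close>

lemma overlap:
  assumes w: "w = Wh3 (Cell2 f ks) (bar l) A (bar r) (Cell2 g (x # rs))" "wh3_ok PMon w"
    and w': "w' = Wh3 (Cell2 f (ks @ [u])) (bar l') A' (bar r') (Cell2 g' rs)" "wh3_ok PMon w'"
    and redexes: "steps2 (bar l \<star>\<^sub>1\<^sub>2 pm_src3 A \<star>\<^sub>2\<^sub>1 bar r) = [u, v]"
      "steps2 (bar l' \<star>\<^sub>1\<^sub>2 pm_src3 A' \<star>\<^sub>2\<^sub>1 bar r') = [v, x]"
  shows "PM.joinable w w'"
proof -
  note [simp] = w w' pm_eval gen4_PMon
  note join = PM.joinable_gen4[of _ "Cell2 f ks" "Cell2 g' rs" "bar l" "bar r'"]
  note hyps = w(2) w'(2) redexes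
  consider
      (AA) "A = Assoc" "A' = Assoc" | (LA) "A = LUnit" "A' = Assoc" | (RA) "A = RUnit" "A' = Assoc"
    | (nat1) n \<beta> where "A' = Ichg Mu n \<beta>" "A = Assoc \<or> A = LUnit \<or> A = RUnit"
    | (XX) \<alpha> n \<beta> n' \<gamma> where "A = Ichg \<alpha> n \<beta>" "A' = Ichg \<beta> n' \<gamma>"
    | (nat2) \<alpha> n where "A' = Assoc \<and> A = Ichg \<alpha> n Mu \<or> A' = LUnit \<and> A = Ichg \<alpha> n Eta"
    | (XR) \<alpha> n where "A = Ichg \<alpha> (Suc n) Eta" "A' = RUnit"
    | (XRM) "A = Ichg Mu 0 Eta" "A' = RUnit"
    | (XRE) "A = Ichg Eta 0 Eta" "A' = RUnit"
  proof -
    have "\<exists>\<alpha> n. A = Ichg \<alpha> n Eta" if "A' = RUnit"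
      using redexes that by (cases A) auto
    moreover have "\<exists>\<alpha> n. A = Ichg \<alpha> n Eta" if "A' = LUnit"
      using redexes that by (cases A) auto
    moreover have "A = Assoc \<or> A = LUnit \<or> A = RUnit \<or> (\<exists>\<alpha> n. A = Ichg \<alpha> n Mu)" if "A' = Assoc"
      using redexes that by (cases A) auto
    moreover have "\<alpha> = Mu \<and> (A = Assoc \<or> A = LUnit \<or> A = RUnit) \<or> (\<exists>\<alpha>' n'. A = Ichg \<alpha>' n' \<alpha>)"
      if "A' = Ichg \<alpha> n \<beta>" for \<alpha> n \<beta>
      using redexes that by (cases A) auto
    ultimately show thesis
      using that by (cases A') (metis pm2.exhaust nat.exhaust)+
  qed
  then show ?thesis
  proof cases
    case AA
    show ?thesis by (rule join[of Coh1]) (use hyps AA in auto)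
  next
    case LA
    show ?thesis by (rule join[of Coh2]) (use hyps LA in auto)
  next
    case RA
    show ?thesis by (rule join[of Coh4]) (use hyps RA in auto)
  next
    case nat1
    show ?thesis by (rule join[of "Nat1 A n \<beta>"]) (use hyps nat1 in \<open>auto simp: naturality1_src_def naturality1_tgt_def\<close>)
  next
    case XX
    show ?thesis by (rule join[of "Nat1 A n' \<gamma>"]) (use hyps XX in \<open>auto simp: naturality1_src_def naturality1_tgt_def\<close>)
  next
    \<comment> \<open>\<open>Nat2\<close>, like \<open>Coh3\<close> and \<open>Coh5\<close>, has the
      redex of \<open>A'\<close> at the head of its source and that of \<open>A\<close> at the head
      of its target, hence the use of symmetry.\<close>
    case nat2
    show ?thesis by (rule PM.joinable_sym, rule join[of "Nat2 \<alpha> n A'"])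
      (use hyps nat2 in \<open>auto simp: naturality2_src_def naturality2_tgt_def\<close>)
  next
    \<comment> \<open>The source of \<open>RUnit\<close> starts with a strand to the left of its
      unit, so gap \<open>Suc n\<close> in the interchanger is gap \<open>n\<close> in the
      naturality generator. With gap 0 the output of \<alpha> is that strand itself.\<close>
    case XR
    show ?thesis by (rule PM.joinable_sym, rule join[of "Nat2 \<alpha> n A'"])
      (use hyps XR in \<open>auto simp: naturality2_src_def naturality2_tgt_def\<close>)
  next
    case XRM
    show ?thesis by (rule PM.joinable_sym, rule join[of Coh3]) (use hyps XRM in auto)
  next
    case XRE
    show ?thesis by (rule PM.joinable_sym, rule join[of Coh5]) (use hyps XRE in auto)
  qed
qed

section \<open>Disjoint redexes and the classification of branchings\<close>

lemma comp_bar_0 [simp]: "bar 0 \<star>\<^sub>1\<^sub>1 f = f" "f \<star>\<^sub>1\<^sub>1 bar 0 = f"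
    "bar 0 \<star>\<^sub>1\<^sub>2 \<phi> = \<phi>" "\<phi> \<star>\<^sub>2\<^sub>1 bar 0 = \<phi>"
proof -
  show *: "bar 0 \<star>\<^sub>1\<^sub>1 f = f" "f \<star>\<^sub>1\<^sub>1 bar 0 = f" for f
    using bar_comp[of 0 "len f"] bar_comp[of "len f" 0] by simp_all
  show "bar 0 \<star>\<^sub>1\<^sub>2 \<phi> = \<phi>" "\<phi> \<star>\<^sub>2\<^sub>1 bar 0 = \<phi>"
    by (cases \<phi>; auto simp: comp12_def comp21_def * split: wh2.splits intro!: map_idI)+
qed

text \<open>Only the first steps are made explicit, since \<open>joinable_gen4\<close> inspects
  nothing else.\<close>

lemma steps3_Indep:
  assumes "bar m \<star>\<^sub>1\<^sub>1 cod2 PMon (pm_src3 A) \<star>\<^sub>1\<^sub>1 bar n = dom2 \<chi>"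
    and \<phi>: "\<phi> = bar m \<star>\<^sub>1\<^sub>2 pm_src3 A \<star>\<^sub>2\<^sub>1 bar n" and \<psi>: "\<psi> = bar m' \<star>\<^sub>1\<^sub>2 pm_src3 B \<star>\<^sub>2\<^sub>1 bar n'"
  shows "\<exists>ws. pm_src4 (Indep A B m n \<chi> m' n') =
      Cell3 (\<phi> \<star>\<^sub>2\<^sub>2 \<chi> \<star>\<^sub>2\<^sub>2 \<psi>) (Wh3 (id2 (dom2 \<phi>)) (bar m) A (bar n) (\<chi> \<star>\<^sub>2\<^sub>2 \<psi>) # ws)"
    "\<exists>ws. pm_tgt4 (Indep A B m n \<chi> m' n') =
      Cell3 (\<phi> \<star>\<^sub>2\<^sub>2 \<chi> \<star>\<^sub>2\<^sub>2 \<psi>) (Wh3 (\<phi> \<star>\<^sub>2\<^sub>2 \<chi>) (bar m') B (bar n') (id2 (cod2 PMon \<psi>)) # ws)"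
  using assms(1)
  by (simp_all add: \<phi> \<psi> gray_defs_pm independence_src_def independence_tgt_def gcell3_def
      comp3_defs del: gcell3_eval)

lemma redex_length: "\<exists>u v. steps2 (bar l \<star>\<^sub>1\<^sub>2 pm_src3 A \<star>\<^sub>2\<^sub>1 bar r) = [u, v] \<and>
    wh2_src PMon u = bar l \<star>\<^sub>1\<^sub>1 dom2 (pm_src3 A) \<star>\<^sub>1\<^sub>1 bar r"
  by (cases A) (auto simp: comp2_defs)

lemma independent:
  assumes w: "w = Wh3 (Cell2 f ks) (bar l) A (bar r) (Cell2 g (us @ as @ rs))" "wh3_ok PMon w"
    and w': "w' = Wh3 (Cell2 f (ks @ bs @ us)) (bar l') A' (bar r') (Cell2 g' rs)" "wh3_ok PMon w'"
    and redexes: "steps2 (bar l \<star>\<^sub>1\<^sub>2 pm_src3 A \<star>\<^sub>2\<^sub>1 bar r) = bs"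
      "steps2 (bar l' \<star>\<^sub>1\<^sub>2 pm_src3 A' \<star>\<^sub>2\<^sub>1 bar r') = as"
  shows "PM.joinable w w'"
proof -
  let ?\<chi> = "Cell2 g us" and ?G = "Indep A A' l r (Cell2 g us) l' r'"
  obtain u v where "as = [u, v]" "wh2_src PMon u = bar l' \<star>\<^sub>1\<^sub>1 dom2 (pm_src3 A') \<star>\<^sub>1\<^sub>1 bar r'"
    using redex_length redexes(2) by metis
  then have \<chi>: "cod2 PMon ?\<chi> = bar l' \<star>\<^sub>1\<^sub>1 dom2 (pm_src3 A') \<star>\<^sub>1\<^sub>1 bar r'" "?\<chi> \<in> cells2 PMon"
    using w by (simp_all add: path2_append)
  have e: "bar l \<star>\<^sub>1\<^sub>1 cod2 PMon (pm_src3 A) \<star>\<^sub>1\<^sub>1 bar r = dom2 ?\<chi>"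
    using w by simp
  obtain ws ws' where s:
    "pm_src4 ?G = Cell3 (bar l \<star>\<^sub>1\<^sub>2 pm_src3 A \<star>\<^sub>2\<^sub>1 bar r \<star>\<^sub>2\<^sub>2 ?\<chi> \<star>\<^sub>2\<^sub>2 (bar l' \<star>\<^sub>1\<^sub>2 pm_src3 A' \<star>\<^sub>2\<^sub>1 bar r'))
      (Wh3 (id2 (dom2 (bar l \<star>\<^sub>1\<^sub>2 pm_src3 A \<star>\<^sub>2\<^sub>1 bar r))) (bar l) A (bar r)
        (?\<chi> \<star>\<^sub>2\<^sub>2 (bar l' \<star>\<^sub>1\<^sub>2 pm_src3 A' \<star>\<^sub>2\<^sub>1 bar r')) # ws)"
    "pm_tgt4 ?G = Cell3 (bar l \<star>\<^sub>1\<^sub>2 pm_src3 A \<star>\<^sub>2\<^sub>1 bar r \<star>\<^sub>2\<^sub>2 ?\<chi> \<star>\<^sub>2\<^sub>2 (bar l' \<star>\<^sub>1\<^sub>2 pm_src3 A' \<star>\<^sub>2\<^sub>1 bar r'))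
      (Wh3 (bar l \<star>\<^sub>1\<^sub>2 pm_src3 A \<star>\<^sub>2\<^sub>1 bar r \<star>\<^sub>2\<^sub>2 ?\<chi>) (bar l') A' (bar r')
        (id2 (cod2 PMon (bar l' \<star>\<^sub>1\<^sub>2 pm_src3 A' \<star>\<^sub>2\<^sub>1 bar r'))) # ws')"
    using steps3_Indep[OF e refl refl] by blast
  \<comment> \<open>The 1-cell whiskers are already arguments of \<open>Indep\<close>, so the outer
    ones are \<open>bar 0\<close>; only the prefix \<open>ks\<close> and suffix \<open>rs\<close>
    remain as context.\<close>
  show ?thesis
    by (rule PM.joinable_gen4[of ?G "Cell2 f ks" "Cell2 g' rs" "bar 0" "bar 0"])
      (use w w' redexes \<chi> e in \<open>simp_all add: s gen4_PMon independence_defined_def path2_append del: pm_src4.simps pm_tgt4.simps\<close>,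
       simp_all add: comp22_def)
qed

text \<open>In an interchanger the second whisker acts strictly to the right of the output of the
  first, otherwise it consumes that output; the first generator and its position relative to the
  second then tell \<open>Assoc\<close>, \<open>LUnit\<close> and \<open>RUnit\<close>
  apart.\<close>

lemma redex_inject:
  assumes "steps2 (bar l \<star>\<^sub>1\<^sub>2 pm_src3 A \<star>\<^sub>2\<^sub>1 bar r) = steps2 (bar l' \<star>\<^sub>1\<^sub>2 pm_src3 A' \<star>\<^sub>2\<^sub>1 bar r')"
  shows "A = A' \<and> l = l' \<and> r = r'"
  using assms by (cases A; cases A') (auto simp: comp2_defs)

lemma branching_ordered:
  assumes ok: "wh3_ok PMon (Wh3 \<kappa> l A r \<rho>)" "wh3_ok PMon (Wh3 \<kappa>' l' A' r' \<rho>')"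
    and src: "wh3_src PMon (Wh3 \<kappa> l A r \<rho>) = wh3_src PMon (Wh3 \<kappa>' l' A' r' \<rho>')"
    and le: "length (steps2 \<kappa>) \<le> length (steps2 \<kappa>')"
  shows "PM.joinable (Wh3 \<kappa> l A r \<rho>) (Wh3 \<kappa>' l' A' r' \<rho>')"
proof -
  obtain f ks g rs where c: "\<kappa> = Cell2 f ks" "\<rho> = Cell2 g rs" by (cases \<kappa>; cases \<rho>)
  obtain f' ks' g' rs' where c': "\<kappa>' = Cell2 f' ks'" "\<rho>' = Cell2 g' rs'" by (cases \<kappa>'; cases \<rho>')
  obtain m n m' n' where b: "l = bar m" "r = bar n" "l' = bar m'" "r' = bar n'"
    by (metis bar_len)
  obtain u v where uv: "steps2 (bar m \<star>\<^sub>1\<^sub>2 pm_src3 A \<star>\<^sub>2\<^sub>1 bar n) = [u, v]"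
    using redex_length by blast
  obtain x y where xy: "steps2 (bar m' \<star>\<^sub>1\<^sub>2 pm_src3 A' \<star>\<^sub>2\<^sub>1 bar n') = [x, y]"
    using redex_length by blast
  have e: "f' = f" "ks @ [u, v] @ rs = ks' @ [x, y] @ rs'"
    using src unfolding b c c' by (auto simp: comp22_def uv xy)
  obtain us where us: "ks' = ks @ us" "[u, v] @ rs = us @ [x, y] @ rs'"
    using e(2) le by (auto simp: c c' append_eq_append_conv2)
  \<comment> \<open>\<open>us\<close> is the offset between the two redexes. As redexes have length
    two, offset 0 means equal redexes, offset 1 an overlap, and a larger offset
    disjointness.\<close>
  consider "us = []" | "us = [u]" | us' where "us = [u, v] @ us'"
    using us(2) by (cases us; cases "tl us") auto
  then show ?thesis
  proof cases
    case 1
    then have "A = A' \<and> m = m' \<and> n = n'" using us(2) uv xy by (intro redex_inject) simp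
    then have "Wh3 \<kappa> l A r \<rho> = Wh3 \<kappa>' l' A' r' \<rho>'"
      using ok e(1) us 1 unfolding b c c' by simp
    then show ?thesis using PM.joinable_refl[OF ok(1)] by simp
  next
    case 2
    then have q: "rs = y # rs'" "x = v" using us(2) by auto
    show ?thesis
      using ok uv xy unfolding b c c' e(1) us(1) 2 q by (rule overlap[OF refl _ refl])
  next
    case 3
    then have q: "rs = us' @ [x, y] @ rs'" using us(2) by simp
    show ?thesis
      using ok uv xy unfolding b c c' e(1) us(1) 3 q by (rule independent[OF refl _ refl])
  qed
qed

theorem branching:
  assumes "wh3_ok PMon w" "wh3_ok PMon w'" "wh3_src PMon w = wh3_src PMon w'"
  shows "PM.joinable w w'"
proof -
  obtain \<kappa> l A r \<rho> where w: "w = Wh3 \<kappa> l A r \<rho>" by (cases w)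
  obtain \<kappa>' l' A' r' \<rho>' where w': "w' = Wh3 \<kappa>' l' A' r' \<rho>'" by (cases w')
  consider "length (steps2 \<kappa>) \<le> length (steps2 \<kappa>')" | "length (steps2 \<kappa>') \<le> length (steps2 \<kappa>)"
    by linarith
  then show ?thesis
    using assms branching_ordered PM.joinable_sym unfolding w w' by cases metis+
qed


section \<open>Termination for pseudomonoids\<close>

text \<open>
  Reading a 2-cell as a planar forest, \<open>F i\<close> is the number of nodes above the first \<open>i\<close> strands.
  A unit costs the number of nodes already lying to its left; a multiplication costs in addition
  the number of nodes of its left subtree. Interchangers and associators both decrease the total
  cost by one; the summand 1 per node makes unitors, which delete two nodes, decrease it as well.
\<close>

definition act :: "nat \<Rightarrow> pm2 \<Rightarrow> (nat \<Rightarrow> nat) \<Rightarrow> nat \<Rightarrow> nat" where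
  "act l \<alpha> F i = (if i \<le> l then F i else F (i - 1 + arity \<alpha>) + 1)"

fun cost :: "(nat \<Rightarrow> nat) \<Rightarrow> (pm0, pm1, pm2) wh2 list \<Rightarrow> nat" where
  "cost F [] = 0"
| "cost F (Wh2 l \<alpha> r # ws) = 1 + F (len l + arity \<alpha> div 2) + cost (act (len l) \<alpha> F) ws"

lemma cost_mono:
  assumes "\<And>i. F i \<le> G i"
  shows "cost F ws \<le> cost G ws"
  using assms
proof (induction ws arbitrary: F G)
  case (Cons w ws)
  obtain l \<alpha> r where w: "w = Wh2 l \<alpha> r" by (cases w)
  have "cost (act (len l) \<alpha> F) ws \<le> cost (act (len l) \<alpha> G) ws"
    by (rule Cons.IH) (use Cons.prems in \<open>simp add: act_def\<close>)
  then show ?case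
    using Cons.prems[of "len l + arity \<alpha> div 2"] by (simp add: w)
qed simp

text \<open>The hypothesis ranges over all \<open>F\<close> because the prefix \<open>ks\<close>
  changes the counts with which the redex is entered.\<close>

lemma cost_context:
  assumes "\<And>F. cost F (us @ rs) < cost F (vs @ rs)"
  shows "cost F (ks @ us @ rs) < cost F (ks @ vs @ rs)"
proof (induction ks arbitrary: F)
  case (Cons k ks)
  then show ?case by (cases k) simp
qed (use assms in simp)

text \<open>The suffix \<open>rs\<close> is included because its cost depends on the counts left
  behind by the redex.\<close>

lemma cost_step:
  "cost F (steps2 (bar l \<star>\<^sub>1\<^sub>2 pm_tgt3 A \<star>\<^sub>2\<^sub>1 bar r) @ rs)
   < cost F (steps2 (bar l \<star>\<^sub>1\<^sub>2 pm_src3 A \<star>\<^sub>2\<^sub>1 bar r) @ rs)"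
proof (cases A)
  case Assoc
  \<comment> \<open>The counts left behind agree. The two multiplications read
    \<open>F (l + 1)\<close> and \<open>F (l + 2) + 1\<close> before the step,
    \<open>F (l + 2)\<close> and \<open>F (l + 1)\<close> after it: the extra 1 is the first node,
    lying in the left subtree of the second.\<close>
  have "act l Mu (act (Suc l) Mu F) = act l Mu (act l Mu F)"
    by (auto simp: act_def fun_eq_iff)
  then show ?thesis by (simp add: Assoc comp2_defs) (simp add: act_def)
next
  case LUnit
  \<comment> \<open>The two removed nodes are counted in every prefix of more than \<open>l\<close>
    strands, so the counts passed to \<open>rs\<close> can only shrink.\<close>
  have "cost F rs \<le> cost (act l Mu (act l Eta F)) rs"
    by (rule cost_mono) (simp add: act_def)
  then show ?thesis by (simp add: LUnit comp2_defs)
next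
  case RUnit
  have "cost F rs \<le> cost (act l Mu (act (Suc l) Eta F)) rs"
    by (rule cost_mono) (simp add: act_def)
  then show ?thesis by (simp add: RUnit comp2_defs)
next
  case (Ichg \<alpha> n \<beta>)
  \<comment> \<open>Before the swap, \<beta> acts second and counts the node of \<alpha> on its
    left; afterwards \<alpha> acts second and the node of \<beta> lies on its right,
    uncounted.\<close>
  have "act l \<alpha> (act (l + arity \<alpha> + n) \<beta> F) = act (l + 1 + n) \<beta> (act l \<alpha> F)"
    by (cases \<alpha>; cases \<beta>) (auto simp: act_def fun_eq_iff intro!: arg_cong[where f = F])
  then show ?thesis
    by (cases \<alpha>; cases \<beta>) (simp_all add: Ichg comp2_defs act_def algebra_simps)
qed

lemma cost_decreasing:
  "cost F (steps2 (wh3_tgt PMon w)) < cost F (steps2 (wh3_src PMon w))"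
proof -
  obtain \<kappa> l A r \<rho> where w: "w = Wh3 \<kappa> l A r \<rho>" by (cases w)
  obtain m n where b: "l = bar m" "r = bar n" by (metis bar_len)
  show ?thesis
    using cost_context[OF cost_step] unfolding w b by (simp add: comp22_def)
qed

theorem mainTheorem7:
  shows "gray_presentation PMon \<and> coherent PMon"
proof
  show "gray_presentation PMon"
    by (rule gray_presentation_PMon)
  show "coherent PMon"
  \<comment> \<open>The constant 0 says that no nodes lie above the input strands.\<close>
  proof (rule PM.squier[of "\<lambda>\<phi>. cost (\<lambda>_. 0) (steps2 \<phi>)"])
    show "\<exists>vs vs'. PM.equiv3 (Cell3 (wh3_src PMon w) (w # vs)) (Cell3 (wh3_src PMon w) (w' # vs'))"
      if "wh3_ok PMon w" "wh3_ok PMon w'" "wh3_src PMon w = wh3_src PMon w'" for w w'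
      using branching[OF that] by (simp add: PM.joinable_def)
  qed (rule cost_decreasing)
qed

end
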